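(* Let $\ell$ be bounded by a polynomial in $n$ and let $\epsilon$ be inverse-polynomial in $n$. Then $(n,\ell,k)$-NeckSplit is polynomial-time reducible to $(n,\ell,\epsilon)$-Con-$1/k$-Division.
   Context: $(n,\ell,\epsilon)$-Con-$1/k$-Division: the input consists of value measures $\mu_i$ on an interval $O$ for $n$ agents $i=1,\dots,n$, given by piecewise constant densities (with polynomially many pieces), and an integer $k\le n$. The output is a partition of $O$ into $k$ parts $O_1,\dots,O_k$ (each a union of subintervals) defined by $(k-1)\ell$ cuts, such that $|\mu_i(O_t)-\mu_i(O_j)|\le\epsilon$ for all $t,j$ and all agents $i$. $(n,\ell,k)$-NeckSplit: the input is $k\cdot m$ beads placed on an interval $O$, with $\alpha_i k$ beads of colour $i$ for $i=1,\dots,n$, $\alpha_i$ positive integers, $k\le n$. The output is a partition of $O$ into $k$ parts $O_1,\dots,O_k$ using $(k-1)\ell$ cuts such that for each colour $i$ and each $j\in\{1,\dots,k\}$, the number $b_i(O_j)$ of beads of colour $i$ in $O_j$ equals $\alpha_i$. *)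

theory Defs
  imports "HOL-Analysis.Analysis" "HOL-Computational_Algebra.Polynomial"
begin

section \<open>Deterministic multi-tape Turing machines\<close>

datatype symbol = Zero | One | Open | Close

type_synonym word = "symbol list"

text \<open>On a tape, 0 is the blank; a machine may use further symbols besides the four
  values of \<open>code\<close> and the blank.\<close>

fun code :: "symbol \<Rightarrow> nat" where
  "code Zero = 1" | "code One = 2" | "code Open = 3" | "code Close = 4"

datatype move = MoveLeft | Stay | MoveRight

fun shift :: "move \<Rightarrow> int" where
  "shift MoveLeft = -1" | "shift Stay = 0" | "shift MoveRight = 1"

text \<open>A tape is infinite in both directions and comes with the position of its head.\<close>

type_synonym tape = "(int \<Rightarrow> nat) \<times> int"

text \<open>The states are \<open>{0..num_states M}\<close>; state 0 is initial and \<open>num_states M\<close> is the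
  halting state. The transition function maps a state and the list of scanned symbols
  to a new state and, for each tape, the symbol to write and the head movement.\<close>

record tm =
  num_tapes :: nat
  num_states :: nat
  num_symbols :: nat
  trans :: "nat \<Rightarrow> nat list \<Rightarrow> nat \<times> (nat \<times> move) list"

definition wf_tm :: "tm \<Rightarrow> bool" where
  "wf_tm M \<longleftrightarrow> num_tapes M > 0 \<and> num_symbols M \<ge> 5 \<and>
    (\<forall>q ss. q < num_states M \<and> length ss = num_tapes M \<and> set ss \<subseteq> {..<num_symbols M} \<longrightarrow>
       fst (trans M q ss) \<le> num_states M \<and>
       length (snd (trans M q ss)) = num_tapes M \<and>
       fst ` set (snd (trans M q ss)) \<subseteq> {..<num_symbols M})"

fun scan :: "tape \<Rightarrow> nat" where
  "scan (f, h) = f h"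

fun act :: "nat \<times> move \<Rightarrow> tape \<Rightarrow> tape" where
  "act (s, d) (f, h) = (f(h := s), h + shift d)"

fun tm_step :: "tm \<Rightarrow> nat \<times> tape list \<Rightarrow> nat \<times> tape list" where
  "tm_step M (q, ts) =
    (if q < num_states M
     then (let (q', as) = trans M q (map scan ts) in (q', map2 act as ts))
     else (q, ts))"

definition word_tape :: "word \<Rightarrow> tape" where
  "word_tape w = (\<lambda>p. if 0 \<le> p \<and> p < int (length w) then code (w ! nat p) else 0, 0)"

definition init_config :: "tm \<Rightarrow> word list \<Rightarrow> nat \<times> tape list" where
  "init_config M ws = (0, map word_tape ws @ replicate (num_tapes M - length ws) (word_tape []))"

text \<open>The inputs are given on the first tapes; when the machine has halted, the last tape
  contains the output and is blank elsewhere.\<close>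

definition computes_within :: "tm \<Rightarrow> word list \<Rightarrow> word \<Rightarrow> nat \<Rightarrow> bool" where
  "computes_within M ws v t \<longleftrightarrow> length ws \<le> num_tapes M \<and>
    (let (q, ts) = (tm_step M ^^ t) (init_config M ws)
     in q = num_states M \<and> fst (last ts) = fst (word_tape v))"

definition poly_time_on :: "'a set \<Rightarrow> ('a \<Rightarrow> word list) \<Rightarrow> ('a \<Rightarrow> word) \<Rightarrow> bool" where
  "poly_time_on D inp out \<longleftrightarrow> (\<exists>M (p :: nat poly). wf_tm M \<and>
    (\<forall>x\<in>D. computes_within M (inp x) (out x) (poly p (sum_list (map length (inp x))))))"


section \<open>Search problems and polynomial-time reductions\<close>

record ('i, 's) search_problem =
  instances :: "'i set"
  is_solution :: "'i \<Rightarrow> 's \<Rightarrow> bool"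
  enc_instance :: "'i \<Rightarrow> word"
  enc_solution :: "'s \<Rightarrow> word"

text \<open>Reducibility of a parametrized problem \<open>A\<close> to a parametrized problem \<open>B\<close>: one
  polynomial-time function \<open>f\<close> translates the instances of every \<open>A p\<close> to instances of \<open>B p\<close>,
  and one polynomial-time function \<open>g\<close> translates solutions back. As the problems need not be
  total, \<open>f\<close> must also preserve solvability.\<close>

definition poly_time_reducible ::
  "('p \<Rightarrow> ('i, 's) search_problem) \<Rightarrow> ('p \<Rightarrow> ('j, 't) search_problem) \<Rightarrow> bool" where
  "poly_time_reducible A B \<longleftrightarrow> (\<exists>f g.
     poly_time_on {(p, x). x \<in> instances (A p)}
       (\<lambda>(p, x). [enc_instance (A p) x])
       (\<lambda>(p, x). enc_instance (B p) (f p x)) \<and>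
     poly_time_on {(p, x, y). x \<in> instances (A p) \<and> is_solution (B p) (f p x) y}
       (\<lambda>(p, x, y). [enc_instance (A p) x, enc_solution (B p) y])
       (\<lambda>(p, x, y). enc_solution (A p) (g p x y)) \<and>
     (\<forall>p. \<forall>x\<in>instances (A p).
        f p x \<in> instances (B p) \<and>
        (\<forall>y. is_solution (B p) (f p x) y \<longrightarrow> is_solution (A p) x (g p x y)) \<and>
        ((\<exists>z. is_solution (A p) x z) \<longrightarrow> (\<exists>y. is_solution (B p) (f p x) y))))"


section \<open>Encodings as words\<close>

text \<open>Binary digits, least significant digit first.\<close>

fun bits :: "nat \<Rightarrow> word" where
  "bits n = (if n = 0 then [] else (if odd n then One else Zero) # bits (n div 2))"

declare bits.simps [simp del]

definition enc_nat :: "nat \<Rightarrow> word" where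
  "enc_nat n = Open # bits n @ [Close]"

definition enc_int :: "int \<Rightarrow> word" where
  "enc_int z = (if z < 0 then One else Zero) # enc_nat (nat \<bar>z\<bar>)"

definition enc_pair :: "('a \<Rightarrow> word) \<Rightarrow> ('b \<Rightarrow> word) \<Rightarrow> 'a \<times> 'b \<Rightarrow> word" where
  "enc_pair e1 e2 = (\<lambda>(x, y). e1 x @ e2 y)"

definition enc_list :: "('a \<Rightarrow> word) \<Rightarrow> 'a list \<Rightarrow> word" where
  "enc_list e xs = Open # concat (map e xs) @ [Close]"

text \<open>Rationals are encoded by numerator and denominator in lowest terms.\<close>

definition enc_rat :: "rat \<Rightarrow> word" where
  "enc_rat r = enc_pair enc_int enc_int (quotient_of r)"

text \<open>All these encodings are uniquely decodable, also within a longer word.\<close>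

definition self_delimiting :: "('a \<Rightarrow> word) \<Rightarrow> bool" where
  "self_delimiting e \<longleftrightarrow> (\<forall>x. e x \<noteq> [] \<and> hd (e x) \<noteq> Close) \<and>
     (\<forall>x y u v. e x @ u = e y @ v \<longrightarrow> x = y \<and> u = v)"

lemma bits_0: "bits 0 = []"
  by (subst bits.simps) simp

lemma bits_pos: "n > 0 \<Longrightarrow> bits n = (if odd n then One else Zero) # bits (n div 2)"
  by (subst bits.simps) simp

lemma bits_delimited: "bits m @ Close # u = bits n @ Close # v \<Longrightarrow> m = n \<and> u = v"
proof (induction m arbitrary: n rule: less_induct)
  case (less m)
  consider "m = 0" "n = 0" | "m = 0" "n > 0" | "m > 0" "n = 0" | "m > 0" "n > 0" by auto
  then show ?case
  proof cases
    case 4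
    then have d: "odd m \<longleftrightarrow> odd n" and "bits (m div 2) @ Close # u = bits (n div 2) @ Close # v"
      using less.prems by (simp_all add: bits_pos split: if_splits)
    then have "m div 2 = n div 2" and u: "u = v"
      using less.IH[of "m div 2" "n div 2"] 4 by simp_all
    with d have "m = n" by presburger
    with u show ?thesis by simp
  qed (use less.prems in \<open>simp_all add: bits_0 bits_pos split: if_splits\<close>)
qed

lemma self_delimitingI:
  assumes "\<And>x. e x \<noteq> []" "\<And>x. hd (e x) \<noteq> Close"
    and "\<And>x y u v. e x @ u = e y @ v \<Longrightarrow> x = y \<and> u = v"
  shows "self_delimiting e"
  unfolding self_delimiting_def using assms by (intro conjI allI impI) fast+

lemma self_delimitingD:
  assumes "self_delimiting e"
  shows "e x \<noteq> []" "hd (e x) \<noteq> Close" "e x @ u = e y @ v \<Longrightarrow> x = y \<and> u = v"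
proof -
  show "e x \<noteq> []" "hd (e x) \<noteq> Close"
    using assms unfolding self_delimiting_def by (fast, fast)
  assume "e x @ u = e y @ v"
  with conjunct2[OF assms[unfolded self_delimiting_def], rule_format, of x u y v]
  show "x = y \<and> u = v" .
qed

lemma self_delimiting_nat: "self_delimiting enc_nat"
proof (rule self_delimitingI)
  fix x y u v
  assume "enc_nat x @ u = enc_nat y @ v"
  then have "bits x @ Close # u = bits y @ Close # v" by (simp add: enc_nat_def)
  then show "x = y \<and> u = v" by (rule bits_delimited)
qed (simp_all add: enc_nat_def)

lemma self_delimiting_int: "self_delimiting enc_int"
proof (rule self_delimitingI)
  fix x y u v
  assume "enc_int x @ u = enc_int y @ v"
  then have sgn: "x < 0 \<longleftrightarrow> y < 0" and "enc_nat (nat \<bar>x\<bar>) @ u = enc_nat (nat \<bar>y\<bar>) @ v"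
    by (simp_all add: enc_int_def split: if_splits)
  from self_delimitingD(3)[OF self_delimiting_nat this(2)]
  show "x = y \<and> u = v" using sgn by linarith
qed (simp_all add: enc_int_def)

lemma self_delimiting_pair:
  assumes "self_delimiting e1" "self_delimiting e2"
  shows "self_delimiting (enc_pair e1 e2)"
proof (rule self_delimitingI)
  fix p q u v
  assume "enc_pair e1 e2 p @ u = enc_pair e1 e2 q @ v"
  then have "e1 (fst p) @ e2 (snd p) @ u = e1 (fst q) @ e2 (snd q) @ v"
    by (simp add: enc_pair_def case_prod_beta)
  from self_delimitingD(3)[OF assms(1) this]
  have "fst p = fst q" "e2 (snd p) @ u = e2 (snd q) @ v" by simp_all
  with self_delimitingD(3)[OF assms(2) this(2)]
  show "p = q \<and> u = v" by (simp add: prod_eq_iff)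
qed (simp_all add: enc_pair_def case_prod_beta self_delimitingD[OF assms(1)])

lemma self_delimiting_list:
  assumes e: "self_delimiting e"
  shows "self_delimiting (enc_list e)"
proof (rule self_delimitingI)
  have ne: "e a @ w \<noteq> Close # v" for a w v
    using self_delimitingD(1,2)[OF e, of a] by (cases "e a") simp_all
  have *: "xs = ys \<and> u = v"
    if "concat (map e xs) @ Close # u = concat (map e ys) @ Close # v" for xs ys u v
    using that
  proof (induction xs arbitrary: ys)
    case Nil
    then show ?case using ne[symmetric] by (cases ys) simp_all
  next
    case (Cons a as)
    show ?case
    proof (cases ys)
      case Nil
      then show ?thesis using Cons.prems ne by simp
    next
      case ys: (Cons b bs)
      have "e a @ concat (map e as) @ Close # u = e b @ concat (map e bs) @ Close # v"
        using Cons.prems ys by simp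
      from self_delimitingD(3)[OF e this]
      show ?thesis using Cons.IH[of bs] ys by simp
    qed
  qed
  fix xs ys u v
  assume "enc_list e xs @ u = enc_list e ys @ v"
  then show "xs = ys \<and> u = v" by (intro *) (simp add: enc_list_def)
qed (simp_all add: enc_list_def)

lemma self_delimiting_rat: "self_delimiting enc_rat"
proof (rule self_delimitingI)
  note pair = self_delimiting_pair[OF self_delimiting_int self_delimiting_int]
  fix x y u v
  show "enc_rat x \<noteq> []" "hd (enc_rat x) \<noteq> Close"
    using self_delimitingD(1,2)[OF pair] by (simp_all add: enc_rat_def)
  assume "enc_rat x @ u = enc_rat y @ v"
  from self_delimitingD(3)[OF pair this[unfolded enc_rat_def]]
  show "x = y \<and> u = v" by (simp add: quotient_of_inject_eq)
qed


section \<open>Dividing an interval by cuts\<close>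

text \<open>A division is given by the list of cuts in increasing order and, for each of the
  resulting subintervals from left to right, the (0-based) index of the part that receives it.
  Cuts may coincide with each other or with the end points, so that some of the subintervals
  are empty. Subintervals are half-open, which makes the parts an exact partition.\<close>

type_synonym 'a division = "'a list \<times> nat list"

fun valid_division :: "'a::linorder \<Rightarrow> 'a \<Rightarrow> nat \<Rightarrow> nat \<Rightarrow> 'a division \<Rightarrow> bool" where
  "valid_division a b c k (cs, ls) \<longleftrightarrow>
     length cs = c \<and> sorted cs \<and> set cs \<subseteq> {a..b} \<and> length ls = c + 1 \<and> set ls \<subseteq> {..<k}"

fun part :: "'a::linorder \<Rightarrow> 'a \<Rightarrow> 'a division \<Rightarrow> nat \<Rightarrow> 'a set" where
  "part a b (cs, ls) t =
     (let es = a # cs @ [b]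
      in \<Union>j\<in>{j. j < length ls \<and> ls ! j = t}. {es ! j ..< es ! Suc j})"

lemma parts_partition:
  assumes "valid_division a b c k D" "a \<le> b"
  shows "(\<Union>t<k. part a b D t) = {a..<b}"
    and "disjoint_family_on (part a b D) {..<k}"
proof -
  obtain cs ls where D: "D = (cs, ls)" by (cases D)
  define es where "es = a # cs @ [b]"
  have v: "length cs = c" "sorted cs" "set cs \<subseteq> {a..b}" "length ls = c + 1" "set ls \<subseteq> {..<k}"
    using assms by (auto simp: D)
  have s: "sorted es" using v assms by (auto simp: es_def sorted_append)
  have le: "length es = Suc (length ls)" using v by (simp add: es_def)
  have e0: "es ! 0 = a" and eL: "es ! length ls = b"
    using v by (auto simp: es_def nth_append)
  have mono: "es ! i \<le> es ! j" if "i \<le> j" "j \<le> length ls" for i j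
    using s that le by (simp add: sorted_iff_nth_mono)
  have p: "part a b D t = (\<Union>j\<in>{j. j < length ls \<and> ls ! j = t}. {es ! j ..< es ! Suc j})" for t
    by (simp add: D es_def)
  show "(\<Union>t<k. part a b D t) = {a..<b}"
  proof (intro equalityI subsetI)
    fix x assume "x \<in> (\<Union>t<k. part a b D t)"
    then obtain j where j: "j < length ls" "es ! j \<le> x" "x < es ! Suc j" by (auto simp: p)
    then show "x \<in> {a..<b}"
      using mono[of 0 j] mono[of "Suc j" "length ls"] e0 eL by auto
  next
    fix x assume x: "x \<in> {a..<b}"
    define i where "i = (LEAST i. x < es ! i)"
    have "x < es ! length ls" using x eL by simp
    then have i: "x < es ! i" "i \<le> length ls"
      unfolding i_def by (rule LeastI, rule Least_le)
    have "i \<noteq> 0" using i e0 x by (metis atLeastLessThan_iff leD)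
    then obtain j where j: "i = Suc j" by (cases i) auto
    then have "es ! j \<le> x" using not_less_Least[of j "\<lambda>i. x < es ! i"] i_def by auto
    then have "j < length ls \<and> x \<in> {es ! j ..< es ! Suc j}" using i j by simp
    then have "x \<in> part a b D (ls ! j)" unfolding p by blast
    moreover have "ls ! j < k" using v i j by (metis Suc_le_lessD lessThan_iff nth_mem subsetD)
    ultimately show "x \<in> (\<Union>t<k. part a b D t)" by auto
  qed
  have "i = j" if "i < length ls" "j < length ls" "x \<in> {es ! i ..< es ! Suc i}"
    "x \<in> {es ! j ..< es ! Suc j}" for i j x
    using that mono[of "Suc i" j] mono[of "Suc j" i]
    by (cases i j rule: linorder_cases) (auto simp: Suc_le_eq)
  then show "disjoint_family_on (part a b D) {..<k}"
    unfolding disjoint_family_on_def p by blast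
qed


section \<open>Necklace splitting\<close>

text \<open>A necklace is the list of the colours (numbered from 0) of its beads from left to right.
  Bead \<open>p\<close> lies at position \<open>p\<close> of \<open>{0..<length w}\<close>, and a cut at \<open>c\<close> separates beads
  \<open>c - 1\<close> and \<open>c\<close>. The number of beads is \<open>k * m\<close> with \<open>m = (\<Sum>i<n. \<alpha> i)\<close>.\<close>

definition is_necklace :: "nat \<Rightarrow> nat \<Rightarrow> (nat \<Rightarrow> nat) \<Rightarrow> nat list \<Rightarrow> bool" where
  "is_necklace n k \<alpha> w \<longleftrightarrow> length w = k * (\<Sum>i<n. \<alpha> i) \<and> set w \<subseteq> {..<n} \<and>
     (\<forall>i<n. \<alpha> i > 0 \<and> count_list w i = \<alpha> i * k)"

definition beads :: "nat list \<Rightarrow> nat \<Rightarrow> nat set \<Rightarrow> nat" where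
  "beads w i S = card {p \<in> S. p < length w \<and> w ! p = i}"

definition neck_split :: "nat \<Rightarrow> nat \<Rightarrow> nat \<Rightarrow> (nat list, nat division) search_problem" where
  "neck_split n l k =
    \<lparr>instances = {w. 1 \<le> k \<and> k \<le> n \<and> (\<exists>\<alpha>. is_necklace n k \<alpha> w)},
     is_solution = (\<lambda>w D. valid_division 0 (length w) ((k - 1) * l) k D \<and>
       (\<forall>\<alpha>. is_necklace n k \<alpha> w \<longrightarrow>
          (\<forall>i<n. \<forall>j<k. beads w i (part 0 (length w) D j) = \<alpha> i))),
     enc_instance = (\<lambda>w. enc_pair enc_nat (enc_list enc_nat) (k, w)),
     enc_solution = enc_pair (enc_list enc_nat) (enc_list enc_nat)\<rparr>"


section \<open>Approximate consensus division\<close>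

text \<open>A block \<open>(l, r, h)\<close> stands for the density \<open>h\<close> on \<open>[l, r)\<close>; the density is 0 outside
  of the blocks. Value measures are not required to be normalized.\<close>

type_synonym blocks = "(rat \<times> rat \<times> rat) list"

definition valid_blocks :: "rat \<Rightarrow> rat \<Rightarrow> blocks \<Rightarrow> bool" where
  "valid_blocks a b bs \<longleftrightarrow> (\<forall>(l, r, h)\<in>set bs. a \<le> l \<and> l < r \<and> r \<le> b \<and> 0 \<le> h) \<and>
     sorted_wrt (\<lambda>(l, r, h) (l', r', h'). r \<le> l') bs"

definition step_density :: "blocks \<Rightarrow> real \<Rightarrow> real" where
  "step_density bs x =
     (\<Sum>(l, r, h)\<leftarrow>bs. of_rat h * indicator {of_rat l ..< of_rat r} x)"

definition value_measure :: "blocks \<Rightarrow> real measure" where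
  "value_measure bs = density lborel (\<lambda>x. ennreal (step_density bs x))"

fun real_part :: "rat \<Rightarrow> rat \<Rightarrow> rat division \<Rightarrow> nat \<Rightarrow> real set" where
  "real_part a b (cs, ls) t = part (of_rat a) (of_rat b) (map of_rat cs, ls) t"

text \<open>An instance consists of the end points of the interval and the agents' densities.\<close>

definition con_division ::
  "nat \<Rightarrow> nat \<Rightarrow> real \<Rightarrow> nat \<Rightarrow> (rat \<times> rat \<times> blocks list, rat division) search_problem" where
  "con_division n l \<epsilon> k =
    \<lparr>instances = {(a, b, \<mu>s). 1 \<le> k \<and> k \<le> n \<and> a < b \<and> length \<mu>s = n \<and>
       (\<forall>bs\<in>set \<mu>s. valid_blocks a b bs)},
     is_solution = (\<lambda>(a, b, \<mu>s) D. valid_division a b ((k - 1) * l) k D \<and>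
       (\<forall>i<n. \<forall>t<k. \<forall>j<k.
          \<bar>measure (value_measure (\<mu>s ! i)) (real_part a b D t) -
           measure (value_measure (\<mu>s ! i)) (real_part a b D j)\<bar> \<le> \<epsilon>)),
     enc_instance = (\<lambda>I. enc_pair enc_nat (enc_pair enc_rat (enc_pair enc_rat
       (enc_list (enc_list (enc_pair enc_rat (enc_pair enc_rat enc_rat)))))) (k, I)),
     enc_solution = enc_pair (enc_list enc_rat) (enc_list enc_nat)\<rparr>"


section \<open>Growth of the parameters\<close>

definition poly_bounded :: "(nat \<Rightarrow> nat) \<Rightarrow> bool" where
  "poly_bounded l \<longleftrightarrow> (\<exists>p :: real poly. \<forall>n\<ge>1. real (l n) \<le> poly p (real n))"

text \<open>This includes, with \<open>p = q\<close>, the functions \<open>1 / poly p n\<close>. As for these, the upper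
  bound keeps the function bounded.\<close>

definition inverse_polynomial :: "(nat \<Rightarrow> real) \<Rightarrow> bool" where
  "inverse_polynomial \<epsilon> \<longleftrightarrow> (\<exists>p q :: real poly. \<forall>n\<ge>1.
     0 < poly p (real n) \<and> 0 < poly q (real n) \<and>
     1 / poly p (real n) \<le> \<epsilon> n \<and> \<epsilon> n \<le> 1 / poly q (real n))"

end

theory Submission
  imports Defs
begin

text \<open>Bead \<open>p\<close> of the necklace becomes a block of uniform density on \<open>[2 ^ p, 2 ^ Suc p)\<close> whose
  mass is so large that the tolerance is a small fraction of a bead. A division into parts of
  almost equal value then distributes the beads of each colour fractionally among the parts, and
  each part receives almost the right number of them. As in Hall's theorem, the integrality gap is
  closed by counting: the beads can be assigned as a whole, each to a part that touches it, such that
  all numbers are exact. Moving the cuts inside a bead to its ends realizes the assignment without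
  additional cuts. The assignment is found by a push-relabel algorithm: a bead of an overfull part
  is moved to a part of smaller height that touches it, and an overfull part without such a bead is
  raised. The fractional solution bounds the heights by the number of parts, so that
  polynomially many steps suffice.

  For the running times, a small imperative language is compiled to Turing machines. Data are trees
  on a stack, and polynomial-time functions on them are closed under composition, case distinction
  and iteration as long as all intermediate results have polynomial size.\<close>

section \<open>Structured programs for Turing machines\<close>

text \<open>The input word contains \<open>k\<close> and the necklace, but not the tolerance. What
  the machine can use is a constant \<open>e\<close> with \<open>\<epsilon> n \<le> 2 ^ e\<close>
  for all \<open>n \<ge> 1\<close>. As value measures need not be normalized, every bead gets the
  mass \<open>2 ^ L\<close>, where \<open>L\<close> is the length of the input word plus
  \<open>e\<close>; then \<open>\<delta> = \<epsilon> n / 2 ^ L\<close> satisfies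
  \<open>k * \<delta> < 1\<close>. This is what the counting can absorb: a colour has
  \<open>k\<close> nodes, each exceeds its target by at most \<open>\<delta>\<close>, and a total
  excess below one bead cannot spoil an inequality between integers.

  Rounding each cut to the nearest end of a bead would fail, since the errors of many cuts add up;
  the roundings have to be coordinated for each colour. The colours do not interfere: whichever
  touching piece each bead chooses, the chosen pieces are in the order of the beads.

  Solvability is preserved because a cut at \<open>c\<close> of an exact splitting becomes a cut at
  \<open>2 ^ c\<close>, which splits no bead.\<close>

datatype com =
    Act "nat list \<Rightarrow> (nat \<times> move) list"
  | Seq com com  (infixr ";;" 60)
  | Cond "nat list \<Rightarrow> bool" com com
  | Loop "nat list \<Rightarrow> bool" com

text \<open>The times are exact step counts of the compiled code: a test costs one step, and so does
  the jump over an else branch or back to the head of a loop.\<close>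

inductive exec :: "com \<Rightarrow> tape list \<Rightarrow> nat \<Rightarrow> tape list \<Rightarrow> bool" where
  exec_Act: "exec (Act f) ts 1 (map2 act (f (map scan ts)) ts)"
| exec_Seq: "exec c ts t us \<Longrightarrow> exec d us u vs \<Longrightarrow> exec (c ;; d) ts (t + u) vs"
| exec_CondT: "b (map scan ts) \<Longrightarrow> exec c ts t us \<Longrightarrow> exec (Cond b c d) ts (1 + t + 1) us"
| exec_CondF: "\<not> b (map scan ts) \<Longrightarrow> exec d ts t us \<Longrightarrow> exec (Cond b c d) ts (1 + t) us"
| exec_LoopF: "\<not> b (map scan ts) \<Longrightarrow> exec (Loop b c) ts 1 ts"
| exec_LoopT: "b (map scan ts) \<Longrightarrow> exec c ts t us \<Longrightarrow> exec (Loop b c) us u vs \<Longrightarrow>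
    exec (Loop b c) ts (1 + t + 1 + u) vs"

definition stay :: "nat list \<Rightarrow> (nat \<times> move) list" where
  "stay ss = map (\<lambda>s. (s, Stay)) ss"

fun com_len :: "com \<Rightarrow> nat" where
  "com_len (Act f) = 1"
| "com_len (c ;; d) = com_len c + com_len d"
| "com_len (Cond b c d) = com_len c + com_len d + 2"
| "com_len (Loop b c) = com_len c + 2"

text \<open>The program \<open>compile c s\<close> occupies the states \<open>s\<close>, ..., \<open>s + com_len c - 1\<close> and is left
  through the state \<open>s + com_len c\<close>.\<close>

fun compile :: "com \<Rightarrow> nat \<Rightarrow> (nat list \<Rightarrow> nat \<times> (nat \<times> move) list) list" where
  "compile (Act f) s = [\<lambda>ss. (Suc s, f ss)]"
| "compile (c ;; d) s = compile c s @ compile d (s + com_len c)"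
| "compile (Cond b c d) s =
     (\<lambda>ss. (if b ss then Suc s else s + com_len c + 2, stay ss)) # compile c (Suc s) @
     (\<lambda>ss. (s + com_len c + 2 + com_len d, stay ss)) # compile d (s + com_len c + 2)"
| "compile (Loop b c) s =
     (\<lambda>ss. (if b ss then Suc s else s + com_len c + 2, stay ss)) # compile c (Suc s) @
     [\<lambda>ss. (s, stay ss)]"

lemma length_compile [simp]: "length (compile c s) = com_len c"
  by (induction c arbitrary: s) auto

text \<open>The bound keeps all states of the segment below the halting state, in which
  \<open>tm_step\<close> stands still. Only the exit of the segment may be the halting
  state.\<close>

definition code_at :: "tm \<Rightarrow> nat \<Rightarrow> (nat list \<Rightarrow> nat \<times> (nat \<times> move) list) list \<Rightarrow> bool" where
  "code_at M s is \<longleftrightarrow> s + length is \<le> num_states M \<and> (\<forall>i<length is. trans M (s + i) = is ! i)"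

lemma code_at_Cons:
  "code_at M s (i # is) \<longleftrightarrow> s < num_states M \<and> trans M s = i \<and> code_at M (Suc s) is"
  by (auto simp: code_at_def All_less_Suc2)

lemma code_at_append:
  "code_at M s (is @ js) \<longleftrightarrow> code_at M s is \<and> code_at M (s + length is) js"
proof (induction "is" arbitrary: s)
  case Nil
  then show ?case by (auto simp: code_at_def)
next
  case (Cons a "is")
  then show ?case by (simp add: code_at_Cons)
qed

lemma act_stay: "map2 act (stay (map scan ts)) ts = ts"
  by (induction ts) (auto simp: stay_def)

lemma tm_step_code:
  assumes "code_at M s (i # is)"
  shows "tm_step M (s, ts) = (fst (i (map scan ts)), map2 act (snd (i (map scan ts))) ts)"
  using assms by (simp add: code_at_Cons case_prod_beta)

lemma funpow_add_apply: "(f ^^ (m + n)) x = (f ^^ n) ((f ^^ m) x)"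
  by (metis add.commute comp_apply funpow_add)

lemma compile_correct:
  assumes "exec c ts t us" "code_at M s (compile c s)"
  shows "(tm_step M ^^ t) (s, ts) = (s + com_len c, us)"
  using assms
proof (induction arbitrary: s rule: exec.induct)
  case (exec_Act f ts)
  then show ?case by (simp add: tm_step_code del: tm_step.simps)
next
  case (exec_Seq c ts t us d u vs)
  then show ?case by (simp add: funpow_add_apply code_at_append add.assoc del: tm_step.simps)
next
  case (exec_CondT b ts c t us d)
  have "(tm_step M ^^ (1 + t)) (s, ts) = (s + com_len c + 1, us)"
    using exec_CondT by (simp add: funpow_swap1 code_at_append code_at_Cons
      tm_step_code[OF exec_CondT.prems[unfolded compile.simps]] act_stay del: tm_step.simps)
  then show ?case
    using exec_CondT.prems unfolding funpow_add_apply[of _ "1 + t"]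
    by (simp add: code_at_append code_at_Cons act_stay)
next
  case (exec_CondF b ts d t us c)
  then show ?case by (simp add: funpow_swap1 code_at_append code_at_Cons
      tm_step_code[OF exec_CondF.prems[unfolded compile.simps]] act_stay add_ac del: tm_step.simps)
next
  case (exec_LoopF b ts c)
  then show ?case by (simp add: tm_step_code[OF exec_LoopF.prems[unfolded compile.simps]] act_stay
    del: tm_step.simps)
next
  case (exec_LoopT b ts c t us u vs)
  have "(tm_step M ^^ (1 + t)) (s, ts) = (s + com_len c + 1, us)"
    using exec_LoopT by (simp add: funpow_swap1 code_at_append code_at_Cons
      tm_step_code[OF exec_LoopT.prems[unfolded compile.simps]] act_stay del: tm_step.simps)
  then have *: "(tm_step M ^^ (1 + t + 1)) (s, ts) = (s, us)"
    using exec_LoopT.prems unfolding funpow_add_apply[of _ "1 + t"]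
    by (simp add: code_at_append code_at_Cons act_stay)
  have "(tm_step M ^^ u) (s, us) = (s + com_len (Loop b c), vs)"
    using exec_LoopT by simp
  then show ?case by (simp only: funpow_add_apply[of "1 + t + 1"] *)
qed

fun wf_com :: "nat \<Rightarrow> nat \<Rightarrow> com \<Rightarrow> bool" where
  "wf_com K B (Act f) \<longleftrightarrow> (\<forall>ss. length ss = K \<and> set ss \<subseteq> {..<B} \<longrightarrow>
     length (f ss) = K \<and> fst ` set (f ss) \<subseteq> {..<B})"
| "wf_com K B (c ;; d) \<longleftrightarrow> wf_com K B c \<and> wf_com K B d"
| "wf_com K B (Cond b c d) \<longleftrightarrow> wf_com K B c \<and> wf_com K B d"
| "wf_com K B (Loop b c) \<longleftrightarrow> wf_com K B c"

definition com_tm :: "nat \<Rightarrow> nat \<Rightarrow> com \<Rightarrow> tm" where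
  "com_tm K B c = \<lparr>num_tapes = K, num_states = com_len c, num_symbols = B,
     trans = (\<lambda>q. compile c 0 ! q)\<rparr>"

definition good_instr :: "nat \<Rightarrow> nat \<Rightarrow> nat \<Rightarrow> (nat list \<Rightarrow> nat \<times> (nat \<times> move) list) \<Rightarrow> bool" where
  "good_instr K B m i \<longleftrightarrow> (\<forall>ss. length ss = K \<and> set ss \<subseteq> {..<B} \<longrightarrow>
     fst (i ss) \<le> m \<and> length (snd (i ss)) = K \<and> fst ` set (snd (i ss)) \<subseteq> {..<B})"

lemma good_compile:
  assumes "wf_com K B c" "s + com_len c \<le> m" "i \<in> set (compile c s)"
  shows "good_instr K B m i"
  using assms
proof (induction c arbitrary: s)
  case (Act f)
  then show ?case by (simp add: good_instr_def)
next
  case (Seq c d)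
  then show ?case using Seq.IH(1)[of s] Seq.IH(2)[of "s + com_len c"] by auto
next
  case (Cond b c d)
  then show ?case using Cond.IH(1)[of "Suc s"] Cond.IH(2)[of "s + com_len c + 2"]
    by (auto simp: good_instr_def stay_def)
next
  case (Loop b c)
  then show ?case using Loop.IH[of "Suc s"]
    by (auto simp: good_instr_def stay_def)
qed

lemma wf_com_tm:
  assumes "wf_com K B c" "K > 0" "B \<ge> 5"
  shows "wf_tm (com_tm K B c)"
  unfolding wf_tm_def
proof (intro conjI allI impI)
  fix q ss
  assume *: "q < num_states (com_tm K B c) \<and> length ss = num_tapes (com_tm K B c) \<and>
    set ss \<subseteq> {..<num_symbols (com_tm K B c)}"
  then have "good_instr K B (com_len c) (compile c 0 ! q)"
    using good_compile[OF assms(1), of 0 "com_len c"] by (simp add: com_tm_def)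
  with * show "fst (trans (com_tm K B c) q ss) \<le> num_states (com_tm K B c)"
    "length (snd (trans (com_tm K B c) q ss)) = num_tapes (com_tm K B c)"
    "fst ` set (snd (trans (com_tm K B c) q ss)) \<subseteq> {..<num_symbols (com_tm K B c)}"
    by (simp_all add: com_tm_def good_instr_def)
qed (use assms in \<open>simp_all add: com_tm_def\<close>)

text \<open>The halting state is a fixed point of \<open>tm_step\<close>. Hence an upper bound on
  the time suffices, although \<open>computes_within\<close> inspects one exact moment.\<close>

lemma com_tm_run:
  assumes "exec c ts t us" "t \<le> T"
  shows "(tm_step (com_tm K B c) ^^ T) (0, ts) = (num_states (com_tm K B c), us)"
proof -
  let ?M = "com_tm K B c"
  have "code_at ?M 0 (compile c 0)" by (simp add: code_at_def com_tm_def)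
  from compile_correct[OF assms(1) this]
  have "(tm_step ?M ^^ t) (0, ts) = (num_states ?M, us)" by (simp add: com_tm_def)
  moreover have "(tm_step ?M ^^ n) (num_states ?M, us) = (num_states ?M, us)" for n
    by (induction n) simp_all
  ultimately show ?thesis
    using assms(2) by (metis funpow_add_apply le_add_diff_inverse)
qed


section \<open>Tapes as stacks\<close>

text \<open>A stack of nonzero symbols fills the cells from 0 on and has its top under the head; for the
  empty stack the head is at cell -1.\<close>

definition stk :: "nat list \<Rightarrow> tape" where
  "stk xs = (\<lambda>p. if 0 \<le> p \<and> p < int (length xs) then rev xs ! nat p else 0, int (length xs) - 1)"

definition top_sym :: "nat list \<Rightarrow> nat" where
  "top_sym xs = (case xs of [] \<Rightarrow> 0 | x # _ \<Rightarrow> x)"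

lemma top_sym_simps [simp]: "top_sym [] = 0" "top_sym (x # xs) = x"
  by (simp_all add: top_sym_def)

lemma scan_stk [simp]: "scan (stk xs) = top_sym xs"
  by (cases xs) (simp_all add: stk_def nth_append)

lemma map_scan_stk [simp]: "map (scan \<circ> stk) xss = map top_sym xss"
  by simp

text \<open>Only an upper bound on the time, so that estimates can be rounded up when programs are
  composed.\<close>

definition run :: "com \<Rightarrow> nat list list \<Rightarrow> nat \<Rightarrow> nat list list \<Rightarrow> bool" where
  "run c xss t yss \<longleftrightarrow> (\<exists>t'\<le>t. exec c (map stk xss) t' (map stk yss))"

lemma runI: "exec c (map stk xss) t (map stk yss) \<Longrightarrow> t \<le> u \<Longrightarrow> run c xss u yss"
  unfolding run_def by blast

lemma run_mono: "run c xss t yss \<Longrightarrow> t \<le> u \<Longrightarrow> run c xss u yss"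
  unfolding run_def by (meson order_trans)

lemma run_Seq:
  assumes "run c xss t yss" "run d yss u zss" "t + u \<le> v"
  shows "run (c ;; d) xss v zss"
proof -
  obtain t' u' where "t' \<le> t" "u' \<le> u" "exec c (map stk xss) t' (map stk yss)"
    "exec d (map stk yss) u' (map stk zss)"
    using assms unfolding run_def by blast
  then have "exec (c ;; d) (map stk xss) (t' + u') (map stk zss)" "t' + u' \<le> v"
    using exec_Seq assms(3) by auto
  then show ?thesis unfolding run_def by blast
qed

lemma run_CondT:
  assumes "b (map top_sym xss)" "run c xss t yss" "t + 2 \<le> v"
  shows "run (Cond b c d) xss v yss"
proof -
  obtain t' where t: "t' \<le> t" "exec c (map stk xss) t' (map stk yss)"
    using assms unfolding run_def by blast
  from exec_CondT[of b "map stk xss", OF _ t(2)] assms(1)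
  have "exec (Cond b c d) (map stk xss) (1 + t' + 1) (map stk yss)" by simp
  then show ?thesis unfolding run_def using t assms by (intro exI[of _ "1 + t' + 1"]) auto
qed

lemma run_CondF:
  assumes "\<not> b (map top_sym xss)" "run d xss t yss" "t + 1 \<le> v"
  shows "run (Cond b c d) xss v yss"
proof -
  obtain t' where t: "t' \<le> t" "exec d (map stk xss) t' (map stk yss)"
    using assms unfolding run_def by blast
  from exec_CondF[of b "map stk xss", OF _ t(2)] assms(1)
  have "exec (Cond b c d) (map stk xss) (1 + t') (map stk yss)" by simp
  then show ?thesis unfolding run_def using t assms by (intro exI[of _ "1 + t'"]) auto
qed

lemma run_LoopF: "\<not> b (map top_sym xss) \<Longrightarrow> 1 \<le> v \<Longrightarrow> run (Loop b c) xss v xss"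
  unfolding run_def using exec_LoopF[of b "map stk xss" c] by auto

lemma run_LoopT:
  assumes "b (map top_sym xss)" "run c xss t yss" "run (Loop b c) yss u zss" "t + u + 2 \<le> v"
  shows "run (Loop b c) xss v zss"
proof -
  obtain t' u' where t: "t' \<le> t" "u' \<le> u" "exec c (map stk xss) t' (map stk yss)"
    "exec (Loop b c) (map stk yss) u' (map stk zss)"
    using assms unfolding run_def by blast
  from exec_LoopT[of b "map stk xss", OF _ t(3,4)] assms(1)
  have "exec (Loop b c) (map stk xss) (1 + t' + 1 + u') (map stk zss)" by simp
  then show ?thesis unfolding run_def using t assms by (intro exI[of _ "1 + t' + 1 + u'"]) auto
qed

text \<open>\<open>act\<close> writes before it moves, so a push takes two steps, a move to the
  right and a write. A pop erases and moves left at once, which keeps the cells above the stack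
  blank as \<open>stk\<close> demands.\<close>

definition push :: "nat \<Rightarrow> nat \<Rightarrow> com" where
  "push i a = Act (\<lambda>ss. (stay ss)[i := (ss ! i, MoveRight)]) ;; Act (\<lambda>ss. (stay ss)[i := (a, Stay)])"

definition pop :: "nat \<Rightarrow> com" where
  "pop i = Act (\<lambda>ss. (stay ss)[i := (0, MoveLeft)])"

definition mv :: "nat \<Rightarrow> nat \<Rightarrow> com" where
  "mv i j = Act (\<lambda>ss. (stay ss)[j := (ss ! j, MoveRight)]) ;;
     Act (\<lambda>ss. (stay ss)[i := (0, MoveLeft), j := (ss ! i, Stay)])"

definition mv2 :: "nat \<Rightarrow> nat \<Rightarrow> nat \<Rightarrow> com" where
  "mv2 i j k = Act (\<lambda>ss. (stay ss)[j := (ss ! j, MoveRight)]) ;;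
     Act (\<lambda>ss. (stay ss)[k := (ss ! k, MoveRight)]) ;;
     Act (\<lambda>ss. (stay ss)[i := (0, MoveLeft), j := (ss ! i, Stay), k := (ss ! i, Stay)])"

definition skip :: com where
  "skip = Act stay"

definition up :: "tape \<Rightarrow> tape" where
  "up T = (fst T, snd T + 1)"

lemma act_Right_scan: "act (scan T, MoveRight) T = up T"
  by (cases T) (simp add: up_def)

lemma act_up_stk: "act (a, Stay) (up (stk xs)) = stk (a # xs)"
  by (auto simp: stk_def up_def fun_eq_iff nth_append nat_less_iff)

lemma act_pop_stk: "act (0, MoveLeft) (stk (x # xs)) = stk xs"
  by (auto simp: stk_def fun_eq_iff nth_append nat_less_iff)

lemma scan_up_stk [simp]: "scan (up (stk xs)) = 0"
  by (simp add: stk_def up_def)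

lemma act_id: "act (scan T, Stay) T = T"
  by (cases T) simp

lemma act_top_sym: "act (top_sym xs, Stay) (stk xs) = stk xs"
  using act_id[of "stk xs"] by simp

lemma map2_act_stay_update:
  assumes "i < length ts"
  shows "map2 act ((stay (map scan ts))[i := a]) ts = ts[i := act a (ts ! i)]"
  by (rule nth_equalityI) (use assms in \<open>auto simp: stay_def nth_list_update act_id\<close>)

lemma exec_Act': "us = map2 act (f (map scan ts)) ts \<Longrightarrow> exec (Act f) ts 1 us"
  using exec_Act by simp

lemma exec_right:
  "i < length ts \<Longrightarrow> exec (Act (\<lambda>ss. (stay ss)[i := (ss ! i, MoveRight)])) ts 1 (ts[i := up (ts ! i)])"
  by (rule exec_Act') (simp add: map2_act_stay_update act_Right_scan del: act.simps)

lemma run_push: "i < length xss \<Longrightarrow> run (push i a) xss 2 (xss[i := a # xss ! i])"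
proof -
  assume i: "i < length xss"
  let ?ts = "map stk xss"
  have "exec (Act (\<lambda>ss. (stay ss)[i := (a, Stay)])) (?ts[i := up (?ts ! i)]) 1
    (map stk (xss[i := a # xss ! i]))"
    by (rule exec_Act')
       (use i map2_act_stay_update[of i "?ts[i := up (?ts ! i)]" "(a, Stay)"]
         in \<open>simp add: act_up_stk map_update del: act.simps\<close>)
  from exec_Seq[OF exec_right this] i
  have "exec (push i a) ?ts (1 + 1) (map stk (xss[i := a # xss ! i]))"
    unfolding push_def by simp
  then show ?thesis by (rule runI) simp
qed

lemma run_pop:
  "i < length xss \<Longrightarrow> xss ! i = a # xs \<Longrightarrow> run (pop i) xss 1 (xss[i := xs])"
  unfolding run_def pop_def
  by (intro exI[of _ 1] conjI exec_Act')
     (use map2_act_stay_update[of i "map stk xss" "(0, MoveLeft)"]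
       in \<open>simp_all add: act_pop_stk map_update del: act.simps\<close>)

lemma run_mv:
  assumes "i < length xss" "j < length xss" "i \<noteq> j" "xss ! i = a # xs"
  shows "run (mv i j) xss 2 (xss[i := xs, j := a # xss ! j])"
proof -
  let ?ts = "map stk xss"
  have "exec (Act (\<lambda>ss. (stay ss)[i := (0, MoveLeft), j := (ss ! i, Stay)])) (?ts[j := up (?ts ! j)]) 1
    (map stk (xss[i := xs, j := a # xss ! j]))"
  proof (rule exec_Act', rule nth_equalityI, goal_cases)
    case (2 p)
    then show ?case using assms
      by (auto simp: stay_def nth_list_update act_top_sym act_up_stk act_pop_stk simp del: act.simps)
  qed (simp add: stay_def)
  from exec_Seq[OF exec_right this] assms
  have "exec (mv i j) ?ts (1 + 1) (map stk (xss[i := xs, j := a # xss ! j]))"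
    unfolding mv_def by simp
  then show ?thesis by (rule runI) simp
qed

lemma run_mv2:
  assumes "i < length xss" "j < length xss" "k < length xss" "i \<noteq> j" "i \<noteq> k" "j \<noteq> k" "xss ! i = a # xs"
  shows "run (mv2 i j k) xss 3 (xss[i := xs, j := a # xss ! j, k := a # xss ! k])"
proof -
  let ?ts = "map stk xss"
  let ?us = "?ts[j := up (?ts ! j)]"
  have 1: "exec (Act (\<lambda>ss. (stay ss)[i := (0, MoveLeft), j := (ss ! i, Stay), k := (ss ! i, Stay)]))
    (?us[k := up (?us ! k)]) 1 (map stk (xss[i := xs, j := a # xss ! j, k := a # xss ! k]))"
  proof (rule exec_Act', rule nth_equalityI, goal_cases)
    case (2 p)
    then show ?case using assms
      by (auto simp: stay_def nth_list_update act_top_sym act_up_stk act_pop_stk simp del: act.simps)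
  qed (simp add: stay_def)
  have "exec (mv2 i j k) ?ts (1 + (1 + 1)) (map stk (xss[i := xs, j := a # xss ! j, k := a # xss ! k]))"
    unfolding mv2_def using assms by (intro exec_Seq[OF exec_right exec_Seq[OF exec_right 1]]) auto
  then show ?thesis by (rule runI) simp
qed

lemma run_skip: "run skip xss 1 xss"
  unfolding skip_def
  by (rule runI[OF exec_Act']) (use act_stay[of "map stk xss"] in simp_all)

lemma fst_update:
  "fst ` set ys \<subseteq> {..<B} \<Longrightarrow> fst y < B \<Longrightarrow> fst ` set (ys[i := y]) \<subseteq> {..<B}" for B :: nat
  by (rule subset_trans[OF image_mono[OF set_update_subset_insert]]) simp

lemma fst_stay: "set ss \<subseteq> {..<B} \<Longrightarrow> fst ` set (stay ss) \<subseteq> {..<B}"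
  by (auto simp: stay_def)

lemma length_stay [simp]: "length (stay ss) = length ss"
  by (simp add: stay_def)

lemma wf_basic [simp]:
  "a < B \<Longrightarrow> i < K \<Longrightarrow> wf_com K B (push i a)"
  "0 < B \<Longrightarrow> wf_com K B (pop i)"
  "i < K \<Longrightarrow> j < K \<Longrightarrow> 0 < B \<Longrightarrow> wf_com K B (mv i j)"
  "i < K \<Longrightarrow> j < K \<Longrightarrow> k < K \<Longrightarrow> 0 < B \<Longrightarrow> wf_com K B (mv2 i j k)"
  "wf_com K B skip"
proof -
  have *: "length ss = K \<Longrightarrow> i < K \<Longrightarrow> set ss \<subseteq> {..<B} \<Longrightarrow> ss ! i < B" for ss :: "nat list" and i
    using nth_mem by blast
  show "a < B \<Longrightarrow> i < K \<Longrightarrow> wf_com K B (push i a)"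
    "0 < B \<Longrightarrow> wf_com K B (pop i)"
    "i < K \<Longrightarrow> j < K \<Longrightarrow> 0 < B \<Longrightarrow> wf_com K B (mv i j)"
    "i < K \<Longrightarrow> j < K \<Longrightarrow> k < K \<Longrightarrow> 0 < B \<Longrightarrow> wf_com K B (mv2 i j k)"
    "wf_com K B skip"
    unfolding push_def pop_def mv_def mv2_def skip_def wf_com.simps
    by (intro conjI allI impI fst_update fst_stay; simp add: *)+
qed

section \<open>Data on the stack\<close>

text \<open>All data are binary trees, written in prefix notation with the symbol 1 for a leaf and the
  symbol 2 for an inner node.\<close>

datatype data = Leaf | Node data data

fun tree_word :: "data \<Rightarrow> nat list" where
  "tree_word Leaf = [1]"
| "tree_word (Node l r) = 2 # tree_word l @ tree_word r"

lemma zero_notin_tree_word [simp]: "0 \<notin> set (tree_word d)"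
  by (induction d) auto

lemma tree_word_neq_Nil [simp]: "tree_word d \<noteq> []"
  by (cases d) auto

text \<open>Prefix notation is uniquely readable within a longer word. The remainders are arbitrary
  because the right subtree is part of the remainder of the left one.\<close>

lemma tree_word_prefix: "tree_word d @ u = tree_word e @ v \<Longrightarrow> d = e \<and> u = v"
proof (induction d arbitrary: e u v)
  case Leaf
  then show ?case by (cases e) auto
next
  case (Node l r)
  from Node.prems obtain l' r' where e: "e = Node l' r'" by (cases e) auto
  with Node.prems have "tree_word l @ tree_word r @ u = tree_word l' @ tree_word r' @ v" by simp
  from Node.IH(1)[OF this] Node.IH(2)[of u r' v] e show ?case by simp
qed

section \<open>Types encoded as trees\<close>

class encodable =
  fixes enc :: "'a \<Rightarrow> data"
  assumes inj_enc: "enc x = enc y \<Longrightarrow> x = y"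

definition wd :: "'a::encodable \<Rightarrow> nat list" where
  "wd x = tree_word (enc x)"

definition sz :: "'a::encodable \<Rightarrow> nat" where
  "sz x = length (wd x)"

lemma wd_inject: "wd x = wd y \<longleftrightarrow> x = y"
  using tree_word_prefix[of "enc x" "[]" "enc y" "[]"] inj_enc by (auto simp: wd_def)

lemma zero_notin_wd [simp]: "0 \<notin> set (wd x)"
  by (simp add: wd_def)

lemma sz_pos: "sz x > 0"
  by (simp add: sz_def wd_def)

instantiation unit :: encodable
begin
definition "enc (x::unit) = Leaf"
instance by standard (simp add: enc_unit_def)
end

instantiation bool :: encodable
begin
definition "enc b = (if b then Node Leaf Leaf else Leaf)"
instance by standard (auto simp: enc_bool_def split: if_splits)
end

text \<open>Unary, since these numbers are indices, counters and lengths, whose values are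
  polynomial in the input. Numbers that may be large stay words of binary digits.\<close>

instantiation nat :: encodable
begin
primrec enc_nat :: "nat \<Rightarrow> data" where
  "enc_nat 0 = Leaf"
| "enc_nat (Suc n) = Node Leaf (enc_nat n)"
instance
proof
  fix x y :: nat
  show "enc x = enc y \<Longrightarrow> x = y"
  proof (induction x arbitrary: y)
    case 0 then show ?case by (cases y) auto
  next
    case (Suc x) then show ?case by (cases y) auto
  qed
qed
end

text \<open>The words of the four trees can be told apart by at most three tests of single stack
  symbols, which is how \<open>write_symbol\<close> decodes them.\<close>

instantiation symbol :: encodable
begin
definition "enc s = (case s of Zero \<Rightarrow> Node Leaf Leaf | One \<Rightarrow> Node Leaf (Node Leaf Leaf)
  | Open \<Rightarrow> Node (Node Leaf Leaf) Leaf | Close \<Rightarrow> Leaf)"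
instance by standard (auto simp: enc_symbol_def split: symbol.splits)
end

instantiation prod :: (encodable, encodable) encodable
begin
definition "enc p = Node (enc (fst p)) (enc (snd p))"
instance by standard (auto simp: enc_prod_def prod_eq_iff intro: inj_enc)
end

instantiation list :: (encodable) encodable
begin
primrec enc_list :: "'a list \<Rightarrow> data" where
  "enc_list [] = Leaf"
| "enc_list (x # xs) = Node (enc x) (enc_list xs)"
instance
proof
  fix x y :: "'a list"
  show "enc x = enc y \<Longrightarrow> x = y"
  proof (induction x arbitrary: y)
    case Nil then show ?case by (cases y) auto
  next
    case (Cons a x) then show ?case by (cases y) (auto intro: inj_enc)
  qed
qed
end

lemma wd_simps [simp]:
  "wd () = [1]" "wd True = [2, 1, 1]" "wd False = [1]" "wd (0::nat) = [1]"
  "wd (Suc n) = 2 # 1 # wd n" "wd (a, b) = 2 # wd a @ wd b"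
  "wd ([] :: 'a::encodable list) = [1]" "wd (y # ys) = 2 # wd y @ wd ys"
  by (simp_all add: wd_def enc_unit_def enc_bool_def enc_prod_def)

text \<open>A number and the list of so many units have the same word. Conversions between them are
  free, and arithmetic reduces to list operations.\<close>

lemma wd_nat: "wd n = wd (replicate n ())"
  by (induction n) simp_all

lemma sz_simps [simp]:
  "sz () = 1" "sz True = 3" "sz False = 1" "sz (0::nat) = 1"
  "sz (Suc n) = sz n + 2" "sz (a, b) = Suc (sz a + sz b)"
  "sz ([] :: 'a::encodable list) = 1" "sz (y # ys) = Suc (sz y + sz ys)"
  by (simp_all add: sz_def)

text \<open>Tapes 0 and 1 are the inputs, tape 2 is the main stack, tapes 3 to 5 are scratch space and
  tape 6 is the output.\<close>

definition st :: "nat list \<Rightarrow> nat list \<Rightarrow> nat list \<Rightarrow> nat list \<Rightarrow> nat list list" where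
  "st s a b c = [[], [], s, a, b, c, []]"

section \<open>Moving words between stacks\<close>

definition flush :: "nat \<Rightarrow> nat \<Rightarrow> com" where
  "flush i j = Loop (\<lambda>ss. ss ! i \<noteq> 0) (mv i j)"

definition flush2 :: "nat \<Rightarrow> nat \<Rightarrow> nat \<Rightarrow> com" where
  "flush2 i j k = Loop (\<lambda>ss. ss ! i \<noteq> 0) (mv2 i j k)"

definition clear :: "nat \<Rightarrow> com" where
  "clear i = Loop (\<lambda>ss. ss ! i \<noteq> 0) (pop i)"

lemma run_flush:
  assumes "i < length xss" "j < length xss" "i \<noteq> j" "0 \<notin> set xs" "xss ! i = xs"
  shows "run (flush i j) xss (4 * length xs + 1) (xss[i := [], j := rev xs @ xss ! j])"
  using assms
proof (induction xs arbitrary: xss)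
  case Nil
  then have "xss[i := [], j := rev [] @ xss ! j] = xss" using list_update_id[of xss i] by simp
  with Nil show ?case unfolding flush_def
    by (simp only:) (rule run_LoopF; simp)
next
  case (Cons x xs)
  let ?yss = "xss[i := xs, j := x # xss ! j]"
  have "run (flush i j) ?yss (4 * length xs + 1) (?yss[i := [], j := rev xs @ ?yss ! j])"
    using Cons by (intro Cons.IH) auto
  moreover have "?yss[i := [], j := rev xs @ ?yss ! j] = xss[i := [], j := rev (x # xs) @ xss ! j]"
    using Cons.prems by (auto intro!: nth_equalityI simp: nth_list_update)
  ultimately show ?case unfolding flush_def
    using Cons.prems by - (rule run_LoopT[OF _ run_mv[of i xss j x xs]], auto)
qed

lemma run_flush2:
  assumes "i < length xss" "j < length xss" "k < length xss" "i \<noteq> j" "i \<noteq> k" "j \<noteq> k"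
    "0 \<notin> set xs" "xss ! i = xs"
  shows "run (flush2 i j k) xss (5 * length xs + 1) 
    (xss[i := [], j := rev xs @ xss ! j, k := rev xs @ xss ! k])"
  using assms
proof (induction xs arbitrary: xss)
  case Nil
  then have "xss[i := [], j := rev [] @ xss ! j, k := rev [] @ xss ! k] = xss"
    using list_update_id[of xss i] by simp
  with Nil show ?case unfolding flush2_def
    by (simp only:) (rule run_LoopF; simp)
next
  case (Cons x xs)
  let ?yss = "xss[i := xs, j := x # xss ! j, k := x # xss ! k]"
  have "run (flush2 i j k) ?yss (5 * length xs + 1)
    (?yss[i := [], j := rev xs @ ?yss ! j, k := rev xs @ ?yss ! k])"
    using Cons by (intro Cons.IH) auto
  moreover have "?yss[i := [], j := rev xs @ ?yss ! j, k := rev xs @ ?yss ! k]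
      = xss[i := [], j := rev (x # xs) @ xss ! j, k := rev (x # xs) @ xss ! k]"
    using Cons.prems by (auto intro!: nth_equalityI simp: nth_list_update)
  ultimately show ?case unfolding flush2_def
    using Cons.prems by - (rule run_LoopT[OF _ run_mv2[of i xss j k x xs]], auto)
qed

lemma run_clear:
  assumes "i < length xss" "0 \<notin> set xs" "xss ! i = xs"
  shows "run (clear i) xss (3 * length xs + 1) (xss[i := []])"
  using assms
proof (induction xs arbitrary: xss)
  case Nil
  then have "xss[i := []] = xss" using list_update_id[of xss i] by simp
  with Nil show ?case unfolding clear_def
    by (simp only:) (rule run_LoopF; simp)
next
  case (Cons x xs)
  have "run (clear i) (xss[i := xs]) (3 * length xs + 1) ((xss[i := xs])[i := []])"
    using Cons by (intro Cons.IH) auto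
  then show ?case unfolding clear_def
    using Cons.prems by - (rule run_LoopT[OF _ run_pop[of i xss x xs]], auto)
qed

lemma st_ops:
  "run (push 2 x) (st s a b c) 2 (st (x # s) a b c)"
  "run (push 5 x) (st s a b c) 2 (st s a b (x # c))"
  "run (pop 2) (st (x # s) a b c) 1 (st s a b c)"
  "run (pop 4) (st s a (x # b) c) 1 (st s a b c)"
  "run (pop 5) (st s a b (x # c)) 1 (st s a b c)"
  "run (mv 2 3) (st (x # s) a b c) 2 (st s (x # a) b c)"
  using run_push[of 2 "st s a b c" x] run_push[of 5 "st s a b c" x]
    run_pop[of 2 "st (x # s) a b c" x s] run_pop[of 4 "st s a (x # b) c" x b]
    run_pop[of 5 "st s a b (x # c)" x c] run_mv[of 2 "st (x # s) a b c" 3 x s]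
  by (simp_all add: st_def eval_nat_numeral)

lemma st_flush:
  "0 \<notin> set a \<Longrightarrow> run (flush 3 2) (st s a b c) (4 * length a + 1) (st (rev a @ s) [] b c)"
  "0 \<notin> set a \<Longrightarrow> run (flush 3 4) (st s a b c) (4 * length a + 1) (st s [] (rev a @ b) c)"
  "0 \<notin> set a \<Longrightarrow> run (flush 3 5) (st s a b c) (4 * length a + 1) (st s [] b (rev a @ c))"
  "0 \<notin> set b \<Longrightarrow> run (flush 4 3) (st s a b c) (4 * length b + 1) (st s (rev b @ a) [] c)"
  "0 \<notin> set b \<Longrightarrow> run (flush 4 5) (st s a b c) (4 * length b + 1) (st s a [] (rev b @ c))"
  "0 \<notin> set c \<Longrightarrow> run (flush 5 2) (st s a b c) (4 * length c + 1) (st (rev c @ s) a b [])"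
  "0 \<notin> set a \<Longrightarrow> run (flush2 3 2 4) (st s a b c) (5 * length a + 1) (st (rev a @ s) [] (rev a @ b) c)"
  "0 \<notin> set a \<Longrightarrow> run (clear 3) (st s a b c) (3 * length a + 1) (st s [] b c)"
  "0 \<notin> set b \<Longrightarrow> run (clear 4) (st s a b c) (3 * length b + 1) (st s a [] c)"
  "0 \<notin> set c \<Longrightarrow> run (clear 5) (st s a b c) (3 * length c + 1) (st s a b [])"
  using run_flush[of 3 "st s a b c" 2 a] run_flush[of 3 "st s a b c" 4 a]
    run_flush[of 3 "st s a b c" 5 a] run_flush[of 4 "st s a b c" 3 b] run_flush[of 4 "st s a b c" 5 b]
    run_flush[of 5 "st s a b c" 2 c] run_flush2[of 3 "st s a b c" 2 4 a]
    run_clear[of 3 "st s a b c" a] run_clear[of 4 "st s a b c" b] run_clear[of 5 "st s a b c" c]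
  by (simp_all add: st_def eval_nat_numeral)

lemma wf_flush [simp]:
  "i < K \<Longrightarrow> j < K \<Longrightarrow> 0 < B \<Longrightarrow> wf_com K B (flush i j)"
  "i < K \<Longrightarrow> j < K \<Longrightarrow> k < K \<Longrightarrow> 0 < B \<Longrightarrow> wf_com K B (flush2 i j k)"
  "0 < B \<Longrightarrow> wf_com K B (clear i)"
  by (simp_all add: flush_def flush2_def clear_def)

lemma top_st [simp]:
  "map top_sym (st s a b c) ! 2 = top_sym s" "map top_sym (st s a b c) ! 3 = top_sym a"
  "map top_sym (st s a b c) ! 4 = top_sym b" "map top_sym (st s a b c) ! 5 = top_sym c"
  by (simp_all add: st_def)

text \<open>Stack 5 counts the subtrees still to be read.\<close>

definition xfer_loop :: com where
  "xfer_loop = Loop (\<lambda>ss. ss ! 5 \<noteq> 0) (mv 2 3 ;; Cond (\<lambda>ss. ss ! 3 = 1) (pop 5) (push 5 1))"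

definition xfer :: com where
  "xfer = push 5 1 ;; xfer_loop"

text \<open>The statement is in continuation form: \<open>t\<close> and \<open>z\<close> describe
  the run that remains after one tree. The loop is not left between the two subtrees of a node, so a
  statement about complete runs of the loop would not compose.\<close>

lemma run_xfer_loop:
  assumes "run xfer_loop (st s (rev (tree_word d) @ a) b c) t z"
  shows "run xfer_loop (st (tree_word d @ s) a b (1 # c)) (t + 8 * length (tree_word d)) z"
  using assms
proof (induction d arbitrary: s a c t)
  case Leaf
  have 1: "run (mv 2 3 ;; Cond (\<lambda>ss. ss ! 3 = 1) (pop 5) (push 5 1)) (st (1 # s) a b (1 # c)) 5
      (st s (1 # a) b c)"
    by (rule run_Seq[OF st_ops(6)], rule run_CondT, simp, rule st_ops(5), rule order_refl, simp)
  have 2: "run xfer_loop (st s (1 # a) b c) t z" using Leaf by simp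
  show ?case unfolding xfer_loop_def
    by (rule run_LoopT[OF _ _ 2[unfolded xfer_loop_def]]) (use 1 in auto)
next
  case (Node l r)
  have "run xfer_loop (st (tree_word r @ s) (rev (2 # tree_word l) @ a) b (1 # c))
      (t + 8 * length (tree_word r)) z"
    using Node.prems by (intro Node.IH(2)) simp
  then have "run xfer_loop (st (tree_word r @ s) (rev (tree_word l) @ (2 # a)) b (1 # c))
      (t + 8 * length (tree_word r)) z"
    by simp
  from Node.IH(1)[OF this]
  have 1: "run xfer_loop (st (tree_word l @ tree_word r @ s) (2 # a) b (1 # 1 # c))
      (t + 8 * length (tree_word r) + 8 * length (tree_word l)) z" .
  have 2: "run (mv 2 3 ;; Cond (\<lambda>ss. ss ! 3 = 1) (pop 5) (push 5 1))
     (st (2 # tree_word l @ tree_word r @ s) a b (1 # c)) 5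
      (st (tree_word l @ tree_word r @ s) (2 # a) b (1 # 1 # c))"
    by (rule run_Seq[OF st_ops(6)], rule run_CondF, simp, rule st_ops(2), rule order_refl, simp)
  show ?case unfolding xfer_loop_def
    by (rule run_LoopT[OF _ _ 1[unfolded xfer_loop_def]]) (use 2 in auto)
qed

lemma run_xfer:
  "run xfer (st (wd x @ s) a b []) (8 * sz x + 3) (st s (rev (wd x) @ a) b [])"
proof -
  have "run xfer_loop (st s (rev (wd x) @ a) b []) 1 (st s (rev (wd x) @ a) b [])"
    unfolding xfer_loop_def by (rule run_LoopF) simp_all
  then have "run xfer_loop (st (wd x @ s) a b [1]) (1 + 8 * sz x) (st s (rev (wd x) @ a) b [])"
    using run_xfer_loop unfolding wd_def sz_def by blast
  then show ?thesis unfolding xfer_def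
    by (rule run_Seq[OF st_ops(2)]) linarith
qed

lemma wf_xfer [simp]: "wf_com 7 5 xfer"
  by (simp add: xfer_def xfer_loop_def)

text \<open>A transfer between stacks reverses the word, so every tree is moved an even number of
  times. In \<open>swap\<close> the first tree takes the way over stacks 4 and 5 in order to come
  back below the second.\<close>

definition dup :: com where
  "dup = xfer ;; flush2 3 2 4 ;; flush 4 3 ;; flush 3 2"

definition drop1 :: com where
  "drop1 = xfer ;; clear 3"

definition swap :: com where
  "swap = xfer ;; flush 3 4 ;; xfer ;; flush 4 5 ;; flush 5 2 ;; flush 3 2"

lemma wf_dup [simp]: "wf_com 7 5 dup" "wf_com 7 5 drop1" "wf_com 7 5 swap"
  by (simp_all add: dup_def drop1_def swap_def)

abbreviation main :: "nat list \<Rightarrow> nat list list" where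
  "main s \<equiv> st s [] [] []"

lemma run_dup: "run dup (main (wd x @ s)) (21 * sz x + 6) (main (wd x @ wd x @ s))"
proof -
  let ?x = "wd x" and ?n = "sz x"
  have "run xfer (main (?x @ s)) (8 * ?n + 3) (st s (rev ?x) [] [])"
    using run_xfer[of x s "[]" "[]"] by simp
  moreover have "run (flush2 3 2 4) (st s (rev ?x) [] []) (5 * ?n + 1) (st (?x @ s) [] ?x [])"
    using st_flush(7)[of "rev ?x" s "[]" "[]"] by (simp add: sz_def)
  moreover have "run (flush 4 3) (st (?x @ s) [] ?x []) (4 * ?n + 1) (st (?x @ s) (rev ?x) [] [])"
    using st_flush(4)[of ?x "?x @ s" "[]" "[]"] by (simp add: sz_def)
  moreover have "run (flush 3 2) (st (?x @ s) (rev ?x) [] []) (4 * ?n + 1) (main (?x @ ?x @ s))"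
    using st_flush(1)[of "rev ?x" "?x @ s" "[]" "[]"] by (simp add: sz_def)
  ultimately show ?thesis unfolding dup_def
    by - (rule run_Seq[OF _ run_Seq[OF _ run_Seq[OF _ _ order_refl] order_refl]], assumption+, simp)
qed

lemma run_drop: "run drop1 (main (wd x @ s)) (11 * sz x + 4) (main s)"
proof -
  let ?x = "wd x" and ?n = "sz x"
  have "run xfer (main (?x @ s)) (8 * ?n + 3) (st s (rev ?x) [] [])"
    using run_xfer[of x s "[]" "[]"] by simp
  moreover have "run (clear 3) (st s (rev ?x) [] []) (3 * ?n + 1) (main s)"
    using st_flush(8)[of "rev ?x" s "[]" "[]"] by (simp add: sz_def)
  ultimately show ?thesis unfolding drop1_def
    by - (rule run_Seq, assumption+, simp)
qed

lemma run_swap: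
  "run swap (main (wd x @ wd y @ s)) (20 * (sz x + sz y) + 10) (main (wd y @ wd x @ s))"
proof -
  let ?x = "wd x" and ?n = "sz x" and ?y = "wd y" and ?m = "sz y"
  have "run xfer (main (?x @ ?y @ s)) (8 * ?n + 3) (st (?y @ s) (rev ?x) [] [])"
    using run_xfer[of x "?y @ s" "[]" "[]"] by simp
  moreover have "run (flush 3 4) (st (?y @ s) (rev ?x) [] []) (4 * ?n + 1) (st (?y @ s) [] ?x [])"
    using st_flush(2)[of "rev ?x" "?y @ s" "[]" "[]"] by (simp add: sz_def)
  moreover have "run xfer (st (?y @ s) [] ?x []) (8 * ?m + 3) (st s (rev ?y) ?x [])"
    using run_xfer[of y s "[]" "?x"] by simp
  moreover have "run (flush 4 5) (st s (rev ?y) ?x []) (4 * ?n + 1) (st s (rev ?y) [] (rev ?x))"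
    using st_flush(5)[of ?x s "rev ?y" "[]"] by (simp add: sz_def)
  moreover have "run (flush 5 2) (st s (rev ?y) [] (rev ?x)) (4 * ?n + 1) (st (?x @ s) (rev ?y) [] [])"
    using st_flush(6)[of "rev ?x" s "rev ?y" "[]"] by (simp add: sz_def)
  moreover have "run (flush 3 2) (st (?x @ s) (rev ?y) [] []) (4 * ?m + 1) (main (?y @ ?x @ s))"
    using st_flush(1)[of "rev ?y" "?x @ s" "[]" "[]"] by (simp add: sz_def)
  ultimately show ?thesis unfolding swap_def
    by - (rule run_Seq[OF _ run_Seq[OF _ run_Seq[OF _ run_Seq[OF _ run_Seq[OF _ _ order_refl]
      order_refl] order_refl] order_refl]], assumption+, simp)
qed

definition cmp_loop :: com where
  "cmp_loop = Loop (\<lambda>ss. ss ! 4 = ss ! 5 \<and> ss ! 4 \<noteq> 0) (pop 4 ;; pop 5)"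

text \<open>An empty stack shows the blank, so a word that ends early counts as a mismatch. Of the
  leftovers only the emptiness matters, and their lengths bound the time for clearing them.\<close>

lemma run_cmp_loop:
  assumes "0 \<notin> set u" "0 \<notin> set v"
  shows "\<exists>u' v'. run cmp_loop (st s a u v) (4 * length u + 1) (st s a u' v') \<and>
    (u = v \<longleftrightarrow> u' = [] \<and> v' = []) \<and> length u' \<le> length u \<and> length v' \<le> length v \<and>
    0 \<notin> set u' \<and> 0 \<notin> set v'"
  using assms
proof (induction u arbitrary: v)
  case Nil
  have "run cmp_loop (st s a [] v) 1 (st s a [] v)"
    unfolding cmp_loop_def by (rule run_LoopF) simp_all
  with Nil show ?case by (intro exI[of _ "[]"] exI[of _ v]) auto
next
  case (Cons x u)
  show ?case
  proof (cases "v \<noteq> [] \<and> hd v = x")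
    case True
    then obtain w where v: "v = x # w" by (cases v) auto
    from Cons.IH[of w] Cons.prems v obtain u' v' where *:
      "run cmp_loop (st s a u w) (4 * length u + 1) (st s a u' v')"
      "(u = w \<longleftrightarrow> u' = [] \<and> v' = [])" "length u' \<le> length u" "length v' \<le> length w"
      "0 \<notin> set u'" "0 \<notin> set v'"
      by auto
    have "run (pop 4 ;; pop 5) (st s a (x # u) (x # w)) 2 (st s a u w)"
      by (rule run_Seq[OF st_ops(4,5)]) simp
    then have "run cmp_loop (st s a (x # u) v) (4 * length (x # u) + 1) (st s a u' v')"
      using Cons.prems unfolding cmp_loop_def v by - (rule run_LoopT[OF _ _ *(1)[unfolded cmp_loop_def]], auto)
    with * v show ?thesis by (intro exI[of _ u'] exI[of _ v']) auto
  next
    case False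
    have "run cmp_loop (st s a (x # u) v) (4 * length (x # u) + 1) (st s a (x # u) v)"
      unfolding cmp_loop_def using False Cons.prems by (intro run_LoopF) (cases v; auto)+
    with False Cons.prems show ?thesis by (intro exI[of _ "x # u"] exI[of _ v]) auto
  qed
qed

definition eq_test :: com where
  "eq_test = xfer ;; flush 3 4 ;; xfer ;; flush 3 5 ;; cmp_loop ;;
     Cond (\<lambda>ss. ss ! 4 = 0 \<and> ss ! 5 = 0) (push 2 1 ;; push 2 1 ;; push 2 2)
       (clear 4 ;; clear 5 ;; push 2 1)"

lemma wf_eq_test [simp]: "wf_com 7 5 eq_test"
  by (simp add: eq_test_def cmp_loop_def)

lemma run_eq_test:
  "run eq_test (main (wd x @ wd y @ s)) (30 * (sz x + sz y) + 30) (main (wd (x = y) @ s))"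
proof -
  let ?x = "wd x" and ?n = "sz x" and ?y = "wd y" and ?m = "sz y"
  obtain u' v' where uv: "run cmp_loop (st s [] ?x ?y) (4 * length ?x + 1) (st s [] u' v')"
    "(?x = ?y \<longleftrightarrow> u' = [] \<and> v' = [])" "length u' \<le> length ?x" "length v' \<le> length ?y"
    "0 \<notin> set u'" "0 \<notin> set v'"
    using run_cmp_loop[of ?x ?y s "[]", OF zero_notin_wd zero_notin_wd] by blast
  have 1: "run xfer (main (?x @ ?y @ s)) (8 * ?n + 3) (st (?y @ s) (rev ?x) [] [])"
    using run_xfer[of x "?y @ s" "[]" "[]"] by simp
  have 2: "run (flush 3 4) (st (?y @ s) (rev ?x) [] []) (4 * ?n + 1) (st (?y @ s) [] ?x [])"
    using st_flush(2)[of "rev ?x" "?y @ s" "[]" "[]"] by (simp add: sz_def)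
  have 3: "run xfer (st (?y @ s) [] ?x []) (8 * ?m + 3) (st s (rev ?y) ?x [])"
    using run_xfer[of y s "[]" "?x"] by simp
  have 4: "run (flush 3 5) (st s (rev ?y) ?x []) (4 * ?m + 1) (st s [] ?x ?y)"
    using st_flush(3)[of "rev ?y" s ?x "[]"] by (simp add: sz_def)
  have 5: "run (Cond (\<lambda>ss. ss ! 4 = 0 \<and> ss ! 5 = 0) (push 2 1 ;; push 2 1 ;; push 2 2)
       (clear 4 ;; clear 5 ;; push 2 1)) (st s [] u' v') (3 * ?n + 3 * ?m + 8) (main (wd (x = y) @ s))"
  proof (cases "x = y")
    case True
    have "run (push 2 1 ;; push 2 1 ;; push 2 2) (main s) 6 (main (2 # 1 # 1 # s))"
      by (rule run_Seq[OF st_ops(1) run_Seq[OF st_ops(1) st_ops(1) order_refl]]) simp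
    with True uv show ?thesis by (intro run_CondT) auto
  next
    case False
    then have n: "\<not> (u' = [] \<and> v' = [])" using uv(2) by (simp add: wd_inject)
    then have "\<not> (top_sym u' = 0 \<and> top_sym v' = 0)" using uv(5,6) by (cases u'; cases v') auto
    moreover have "run (clear 4 ;; clear 5 ;; push 2 1) (st s [] u' v') (3 * ?n + 3 * ?m + 4) (main (1 # s))"
      by (rule run_Seq[OF st_flush(9) run_Seq[OF st_flush(10) st_ops(1) order_refl]])
         (use uv in \<open>auto simp: sz_def\<close>)
    ultimately show ?thesis using False by (intro run_CondF) auto
  qed
  show ?thesis unfolding eq_test_def
    by (rule run_Seq[OF 1 run_Seq[OF 2 run_Seq[OF 3 run_Seq[OF 4 run_Seq[OF uv(1) 5 order_refl]
          order_refl] order_refl] order_refl]])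
       (auto simp: sz_def)
qed

fun push_word :: "nat list \<Rightarrow> com" where
  "push_word [] = skip"
| "push_word (x # xs) = push_word xs ;; push 2 x"

definition io :: "nat list \<Rightarrow> nat list \<Rightarrow> nat list \<Rightarrow> nat list \<Rightarrow> nat list list" where
  "io a b s out = [a, b, s, [], [], [], out]"

lemma run_push_word_io: "run (push_word xs) (io a b s out) (2 * length xs + 1) (io a b (xs @ s) out)"
proof (induction xs)
  case Nil
  then show ?case using run_skip[of "io a b s out"] by simp
next
  case (Cons x xs)
  show ?case unfolding push_word.simps
    by (rule run_Seq[OF Cons])
       (use run_push[of 2 "io a b (xs @ s) out" x] in \<open>auto simp: io_def eval_nat_numeral\<close>)
qed

lemma main_io: "main s = io [] [] s []"
  by (simp add: st_def io_def)

lemma run_push_word: "run (push_word xs) (main s) (2 * length xs + 1) (main (xs @ s))"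
  using run_push_word_io by (simp add: main_io)

lemma wf_push_word [simp]: "set xs \<subseteq> {..<5} \<Longrightarrow> wf_com 7 5 (push_word xs)"
  by (induction xs) auto

lemma tree_word_bound: "set (tree_word d) \<subseteq> {..<5}"
  by (induction d) auto

section \<open>Polynomial-time functions on data\<close>

text \<open>All bounds are polynomials with natural coefficients, which makes them monotone;
  compositions of bounds rely on this.\<close>

lemma poly_mono: "m \<le> n \<Longrightarrow> poly p m \<le> poly p n" for p :: "nat poly"
  by (induction p) (auto intro!: add_mono mult_mono)

text \<open>The program leaves the rest \<open>s\<close> of the stack alone, so that programs compose without any
  allocation of tapes.\<close>

definition pt :: "('a::encodable \<Rightarrow> 'b::encodable) \<Rightarrow> bool" where
  "pt f \<longleftrightarrow> (\<exists>c p. wf_com 7 5 c \<and> (\<forall>x. sz (f x) \<le> poly p (sz x)) \<and>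
     (\<forall>x s. run c (main (wd x @ s)) (poly p (sz x)) (main (wd (f x) @ s))))"

lemma ptI:
  assumes "wf_com 7 5 c" "\<And>x. sz (f x) \<le> poly p (sz x)"
    "\<And>x s. run c (main (wd x @ s)) (poly q (sz x)) (main (wd (f x) @ s))"
  shows "pt f"
  unfolding pt_def
proof (intro exI[of _ c] exI[of _ "p + q"] conjI allI)
  show "sz (f x) \<le> poly (p + q) (sz x)" for x
    using assms(2)[of x] by simp
  show "run c (main (wd x @ s)) (poly (p + q) (sz x)) (main (wd (f x) @ s))" for x s
    by (rule run_mono[OF assms(3)]) simp
qed (rule assms)

lemma ptE:
  assumes "pt f"
  obtains c p where "wf_com 7 5 c" "\<And>x. sz (f x) \<le> poly p (sz x)"
    "\<And>x s. run c (main (wd x @ s)) (poly p (sz x)) (main (wd (f x) @ s))"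
  using assms unfolding pt_def by blast

definition bdd :: "('a::encodable \<Rightarrow> nat) \<Rightarrow> bool" where
  "bdd f \<longleftrightarrow> (\<exists>p. \<forall>x. f x \<le> poly p (sz x))"

named_theorems pt_intros
named_theorems bdd_intros

lemma bdd_const [bdd_intros]: "bdd (\<lambda>x. k)"
  unfolding bdd_def by (rule exI[of _ "[:k:]"]) simp

lemma bdd_add [bdd_intros]:
  assumes "bdd f" "bdd g" shows "bdd (\<lambda>x. f x + g x)"
proof -
  from assms obtain p q where "\<forall>x. f x \<le> poly p (sz x)" "\<forall>x. g x \<le> poly q (sz x)"
    unfolding bdd_def by blast
  then show ?thesis unfolding bdd_def by (intro exI[of _ "p + q"]) (auto intro: add_mono)
qed

lemma bdd_mult [bdd_intros]:
  assumes "bdd f" "bdd g" shows "bdd (\<lambda>x. f x * g x)"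
proof -
  from assms obtain p q where "\<forall>x. f x \<le> poly p (sz x)" "\<forall>x. g x \<le> poly q (sz x)"
    unfolding bdd_def by blast
  then show ?thesis unfolding bdd_def by (intro exI[of _ "p * q"]) (auto intro: mult_mono)
qed

lemma bdd_Suc [bdd_intros]: "bdd f \<Longrightarrow> bdd (\<lambda>x. Suc (f x))"
  using bdd_add[OF _ bdd_const[of 1], of f] by simp

lemma bdd_le: "bdd f \<Longrightarrow> (\<And>x. g x \<le> f x) \<Longrightarrow> bdd g"
  unfolding bdd_def by (meson order_trans)

lemma bdd_sz [bdd_intros]: "pt f \<Longrightarrow> bdd (\<lambda>x. sz (f x))"
  unfolding bdd_def by (erule ptE) blast

lemma pt_bdd_poly:
  assumes "pt f" obtains p where "\<And>x. sz (f x) \<le> poly p (sz x)"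
  using assms by (erule_tac ptE) blast

lemma bdd_poly_sz:
  assumes "bdd f" shows "bdd (\<lambda>x. poly q (f x))"
proof -
  from assms obtain p where "\<forall>x. f x \<le> poly p (sz x)"
    unfolding bdd_def by blast
  then show ?thesis unfolding bdd_def
    by (intro exI[of _ "pcompose q p"]) (auto simp: poly_pcompose intro!: poly_mono)
qed

text \<open>A change of type that leaves the word alone costs nothing. The constructors
  \<open>#\<close> and \<open>Suc\<close> are of this kind, when seen as functions on pairs.\<close>

lemma pt_cast: "(\<And>x. wd (f x) = wd x) \<Longrightarrow> pt f"
  by (rule ptI[of skip _ "[:0, 1:]" "[:1:]"]) (use run_skip in \<open>auto simp: sz_def\<close>)

lemma pt_id [pt_intros]: "pt (\<lambda>x. x)"
  by (rule pt_cast) simp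

lemma pt_const [pt_intros]: "pt (\<lambda>x. k)"
proof (rule ptI[of "drop1 ;; push_word (wd k)" _ "[:sz k:]" "[:2 * sz k + 5, 11:]"])
  show "wf_com 7 5 (drop1 ;; push_word (wd k))"
    using tree_word_bound by (auto simp: wd_def intro!: wf_push_word)
  show "run (drop1 ;; push_word (wd k)) (main (wd x @ s)) (poly [:2 * sz k + 5, 11:] (sz x))
    (main (wd k @ s))" for x s
    by (rule run_Seq[OF run_drop run_push_word]) (simp add: sz_def)
qed simp

section \<open>Closure under composition, branching and loops\<close>

lemma pt_comp:
  assumes "pt f" "pt g" shows "pt (\<lambda>x. f (g x))"
proof -
  from assms(1) obtain c p where f: "wf_com 7 5 c" "\<And>x. sz (f x) \<le> poly p (sz x)"
    "\<And>x s. run c (main (wd x @ s)) (poly p (sz x)) (main (wd (f x) @ s))" by (rule ptE) blast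
  from assms(2) obtain d q where g: "wf_com 7 5 d" "\<And>x. sz (g x) \<le> poly q (sz x)"
    "\<And>x s. run d (main (wd x @ s)) (poly q (sz x)) (main (wd (g x) @ s))" by (rule ptE) blast
  have le: "poly p (sz (g x)) \<le> poly (pcompose p q) (sz x)" for x
    unfolding poly_pcompose by (rule poly_mono[OF g(2)])
  show ?thesis
  proof (rule ptI[of "d ;; c" _ "pcompose p q" "q + pcompose p q"])
    show "sz (f (g x)) \<le> poly (pcompose p q) (sz x)" for x
      using f(2) le order_trans by blast
    show "run (d ;; c) (main (wd x @ s)) (poly (q + pcompose p q) (sz x)) (main (wd (f (g x)) @ s))" for x s
      by (rule run_Seq[OF g(3) f(3)]) (use le[of x] in simp)
  qed (simp add: f g)
qed

lemma pt_pair [pt_intros]: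
  assumes "pt f" "pt g" shows "pt (\<lambda>x. (f x, g x))"
proof -
  from assms(1) obtain c p where f: "wf_com 7 5 c" "\<And>x. sz (f x) \<le> poly p (sz x)"
    "\<And>x s. run c (main (wd x @ s)) (poly p (sz x)) (main (wd (f x) @ s))" by (rule ptE) blast
  from assms(2) obtain d q where g: "wf_com 7 5 d" "\<And>x. sz (g x) \<le> poly q (sz x)"
    "\<And>x s. run d (main (wd x @ s)) (poly q (sz x)) (main (wd (g x) @ s))" by (rule ptE) blast
  show ?thesis
  proof (rule ptI[of "dup ;; d ;; swap ;; c ;; push 2 2" _ "[:1:] + p + q"
      "[:18, 41:] + p + [:21:] * q"])
    show "sz (f x, g x) \<le> poly ([:1:] + p + q) (sz x)" for x
      using f(2)[of x] g(2)[of x] by simp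
    fix x s
    have 1: "run (push 2 2) (main (wd (f x) @ wd (g x) @ s)) 2 (main (wd (f x, g x) @ s))"
      using st_ops(1) by simp
    show "run (dup ;; d ;; swap ;; c ;; push 2 2) (main (wd x @ s))
        (poly ([:18, 41:] + p + [:21:] * q) (sz x)) (main (wd (f x, g x) @ s))"
      by (rule run_Seq[OF run_dup run_Seq[OF g(3) run_Seq[OF run_swap run_Seq[OF f(3) 1 order_refl]
            order_refl] order_refl]])
        (use g(2)[of x] in \<open>simp add: algebra_simps\<close>)
  qed (simp add: f g)
qed

lemma pt_fst_plain: "pt (fst :: 'c::encodable \<times> 'd::encodable \<Rightarrow> 'c)"
proof (rule ptI[of "pop 2 ;; swap ;; drop1" _ "[:0, 1:]" "[:15, 31:]"])
    show "sz (fst x) \<le> poly [:0, 1:] (sz x)" for x :: "'c::encodable \<times> 'd::encodable" by (cases x) simp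
    fix x :: "('c::encodable \<times> 'd::encodable)" and s
    obtain a b where x: "x = (a, b)" by (cases x)
    have "run (pop 2) (main (wd x @ s)) 1 (main (wd a @ wd b @ s))"
      unfolding x using st_ops(3) by simp
    then show "run (pop 2 ;; swap ;; drop1) (main (wd x @ s)) (poly [:15, 31:] (sz x)) (main (wd (fst x) @ s))"
      unfolding x fst_conv by (rule run_Seq[OF _ run_Seq[OF run_swap run_drop order_refl]]) simp
qed simp

lemma pt_snd_plain: "pt (snd :: 'c::encodable \<times> 'd::encodable \<Rightarrow> 'd)"
proof (rule ptI[of "pop 2 ;; drop1" _ "[:0, 1:]" "[:5, 11:]"])
    show "sz (snd x) \<le> poly [:0, 1:] (sz x)" for x :: "'c::encodable \<times> 'd::encodable" by (cases x) simp
    fix x :: "('c::encodable \<times> 'd::encodable)" and s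
    obtain a b where x: "x = (a, b)" by (cases x)
    have "run (pop 2) (main (wd x @ s)) 1 (main (wd a @ wd b @ s))"
      unfolding x using st_ops(3) by simp
    then show "run (pop 2 ;; drop1) (main (wd x @ s)) (poly [:5, 11:] (sz x)) (main (wd (snd x) @ s))"
      unfolding x snd_conv by (rule run_Seq[OF _ run_drop]) simp
qed simp

lemma pt_fst [pt_intros]: "pt f \<Longrightarrow> pt (\<lambda>x. fst (f x))"
  by (rule pt_comp[OF pt_fst_plain])

lemma pt_snd [pt_intros]: "pt f \<Longrightarrow> pt (\<lambda>x. snd (f x))"
  by (rule pt_comp[OF pt_snd_plain])

lemma pt_comp2: "pt (\<lambda>p. h (fst p) (snd p)) \<Longrightarrow> pt f \<Longrightarrow> pt g \<Longrightarrow> pt (\<lambda>x. h (f x) (g x))"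
  using pt_comp[of "\<lambda>p. h (fst p) (snd p)" "\<lambda>x. (f x, g x)"] pt_pair[of f g] by simp

lemma pt_eq [pt_intros]:
  assumes "pt f" "pt g" shows "pt (\<lambda>x. f x = g x)"
proof (rule pt_comp2[OF _ assms])
  show "pt (\<lambda>p. (fst p :: 'b) = snd p)"
  proof (rule ptI[of "pop 2 ;; eq_test" _ "[:3:]" "[:31, 30:]"])
    show "sz (fst x = snd x) \<le> poly [:3:] (sz x)" for x :: "'b \<times> 'b"
      by (cases "fst x = snd x") simp_all
    fix x :: "'b \<times> 'b" and s
    obtain a b where x: "x = (a, b)" by (cases x)
    have "run (pop 2) (main (wd x @ s)) 1 (main (wd a @ wd b @ s))"
      unfolding x using st_ops(3) by simp
    then show "run (pop 2 ;; eq_test) (main (wd x @ s)) (poly [:31, 30:] (sz x))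
      (main (wd (fst x = snd x) @ s))"
      unfolding x fst_conv snd_conv by (rule run_Seq[OF _ run_eq_test]) simp
  qed simp
qed

lemma pt_if [pt_intros]:
  assumes "pt b" "pt f" "pt g" shows "pt (\<lambda>x. if b x then f x else g x)"
proof -
  from assms(1) obtain e r where b: "wf_com 7 5 e" "\<And>x. sz (b x) \<le> poly r (sz x)"
    "\<And>x s. run e (main (wd x @ s)) (poly r (sz x)) (main (wd (b x) @ s))" by (rule ptE) blast
  from assms(2) obtain c p where f: "wf_com 7 5 c" "\<And>x. sz (f x) \<le> poly p (sz x)"
    "\<And>x s. run c (main (wd x @ s)) (poly p (sz x)) (main (wd (f x) @ s))" by (rule ptE) blast
  from assms(3) obtain d q where g: "wf_com 7 5 d" "\<And>x. sz (g x) \<le> poly q (sz x)"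
    "\<And>x s. run d (main (wd x @ s)) (poly q (sz x)) (main (wd (g x) @ s))" by (rule ptE) blast
  show ?thesis
  proof (rule ptI[of "dup ;; e ;; Cond (\<lambda>ss. ss ! 2 = 2) (drop1 ;; c) (drop1 ;; d)" _ "p + q"
      "[:50, 21:] + r + p + q"])
    show "sz (if b x then f x else g x) \<le> poly (p + q) (sz x)" for x
      using f(2)[of x] g(2)[of x] by simp
    fix x s
    \<comment> \<open>A truth value has size at most 3, and \<open>11 * 3 + 4 = 37\<close>.\<close>
    have d: "run drop1 (main (wd (b x) @ wd x @ s)) 37 (main (wd x @ s))"
      by (rule run_mono[OF run_drop]) (cases "b x"; simp)
    have "run (Cond (\<lambda>ss. ss ! 2 = 2) (drop1 ;; c) (drop1 ;; d)) (main (wd (b x) @ wd x @ s))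
      (39 + poly p (sz x) + poly q (sz x)) (main (wd (if b x then f x else g x) @ s))"
    proof (cases "b x")
      case True
      then show ?thesis using run_Seq[OF d f(3) order_refl]
        by (intro run_CondT) auto
    next
      case False
      then show ?thesis using run_Seq[OF d g(3) order_refl]
        by (intro run_CondF) auto
    qed
    from run_Seq[OF run_dup run_Seq[OF b(3) this order_refl] order_refl]
    show "run (dup ;; e ;; Cond (\<lambda>ss. ss ! 2 = 2) (drop1 ;; c) (drop1 ;; d)) (main (wd x @ s))
       (poly ([:50, 21:] + r + p + q) (sz x)) (main (wd (if b x then f x else g x) @ s))"
      by (rule run_mono) simp
  qed (simp add: b f g)
qed

text \<open>The list \<open>y # ys\<close> and the pair \<open>(y, ys)\<close> have the same word.
  One more node symbol thus turns \<open>x\<close> and the list into the argument of the second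
  branch.\<close>

lemma pt_case_list [pt_intros]:
  assumes "pt l" "pt f" "pt (\<lambda>p. g (fst p) (fst (snd p)) (snd (snd p)))"
  shows "pt (\<lambda>x. case l x of [] \<Rightarrow> f x | y # ys \<Rightarrow> g x y ys)"
proof -
  from assms(1) obtain e r where l: "wf_com 7 5 e" "\<And>x. sz (l x) \<le> poly r (sz x)"
    "\<And>x s. run e (main (wd x @ s)) (poly r (sz x)) (main (wd (l x) @ s))" by (rule ptE) blast
  from assms(2) obtain c p where f: "wf_com 7 5 c" "\<And>x. sz (f x) \<le> poly p (sz x)"
    "\<And>x s. run c (main (wd x @ s)) (poly p (sz x)) (main (wd (f x) @ s))" by (rule ptE) blast
  define G where "G = (\<lambda>p. g (fst p) (fst (snd p)) (snd (snd p)))"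
  from assms(3)[folded G_def] obtain d q where g: "wf_com 7 5 d" "\<And>x. sz (G x) \<le> poly q (sz x)"
    "\<And>x s. run d (main (wd x @ s)) (poly q (sz x)) (main (wd (G x) @ s))" by (rule ptE) blast
  let ?Q = "pcompose q ([:1, 1:] + r)"
  let ?C = "Cond (\<lambda>ss. ss ! 2 = 2) (swap ;; push 2 2 ;; d) (drop1 ;; c)"
  let ?h = "\<lambda>x. case l x of [] \<Rightarrow> f x | y # ys \<Rightarrow> g x y ys"
  have G: "poly q (sz (x, l x)) \<le> poly ?Q (sz x)" for x
    unfolding poly_pcompose using l(2)[of x] by (intro poly_mono) simp
  have wd_l: "wd (x, l x) = wd (x, y, ys)" "sz (x, y, ys) = sz (x, l x)" if "l x = y # ys" for x y ys
    using that by simp_all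
  show ?thesis
  proof (rule ptI[of "dup ;; e ;; ?C" _ "p + ?Q" "[:100, 100:] + [:50:] * r + p + ?Q"])
    show "sz (?h x) \<le> poly (p + ?Q) (sz x)" for x
    proof (cases "l x")
      case Nil
      then show ?thesis using f(2)[of x] by simp
    next
      case (Cons y ys)
      have "sz (G (x, y, ys)) \<le> poly ?Q (sz x)"
        using order_trans[OF g(2)[of "(x, y, ys)", unfolded wd_l(2)[OF Cons]] G] .
      then show ?thesis using Cons by (simp add: G_def)
    qed
    fix x s
    have "run ?C (main (wd (l x) @ wd x @ s))
      (20 * (sz (l x) + sz x) + 20 + poly p (sz x) + poly ?Q (sz x)) (main (wd (?h x) @ s))"
    proof (cases "l x")
      case Nil
      then show ?thesis using run_Seq[OF run_drop[of "l x"] f(3) order_refl]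
        by (intro run_CondF) auto
    next
      case (Cons y ys)
      have 1: "run (push 2 2) (main (wd x @ wd (l x) @ s)) 2 (main (wd (x, y, ys) @ s))"
        using st_ops(1) Cons by simp
      have "run d (main (wd (x, y, ys) @ s)) (poly ?Q (sz x)) (main (wd (G (x, y, ys)) @ s))"
        by (rule run_mono[OF g(3)]) (unfold wd_l(2)[OF Cons], rule G)
      from run_Seq[OF run_swap run_Seq[OF 1 this order_refl] order_refl] Cons
      show ?thesis by (intro run_CondT) (auto simp: G_def)
    qed
    then show "run (dup ;; e ;; ?C) (main (wd x @ s)) (poly ([:100, 100:] + [:50:] * r + p + ?Q) (sz x))
        (main (wd (?h x) @ s))"
      by (rule run_Seq[OF run_dup run_Seq[OF l(3) _ order_refl]]) (use l(2)[of x] in simp)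
  qed (simp add: l f g)
qed

text \<open>Iterating a polynomial-time function can produce values of exponential size. Therefore
  \<open>B\<close> has to bound every intermediate value; it also bounds the number
  \<open>n x\<close> of rounds.\<close>

lemma pt_while:
  fixes f :: "'b::encodable \<Rightarrow> 'b" and g :: "'a::encodable \<Rightarrow> 'b"
  assumes "pt b" "pt f" "pt g" "bdd B"
    and n: "\<And>x. n x \<le> B x" "\<And>x. w x = (f ^^ n x) (g x)"
    and sz: "\<And>x i. i \<le> n x \<Longrightarrow> sz ((f ^^ i) (g x)) \<le> B x"
    and b: "\<And>x i. i < n x \<Longrightarrow> b ((f ^^ i) (g x))" "\<And>x. \<not> b ((f ^^ n x) (g x))"
  shows "pt w"
proof -
  from assms(1) obtain e r where e: "wf_com 7 5 e" "\<And>x. sz (b x) \<le> poly r (sz x)"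
    "\<And>x s. run e (main (wd x @ s)) (poly r (sz x)) (main (wd (b x) @ s))" by (rule ptE) blast
  from assms(2) obtain c p where c: "wf_com 7 5 c" "\<And>x. sz (f x) \<le> poly p (sz x)"
    "\<And>x s. run c (main (wd x @ s)) (poly p (sz x)) (main (wd (f x) @ s))" by (rule ptE) blast
  from assms(3) obtain h u where g: "wf_com 7 5 h" "\<And>x. sz (g x) \<le> poly u (sz x)"
    "\<And>x s. run h (main (wd x @ s)) (poly u (sz x)) (main (wd (g x) @ s))" by (rule ptE) blast
  from assms(4) obtain q where q: "\<And>x. B x \<le> poly q (sz x)" unfolding bdd_def by blast
  let ?body = "drop1 ;; c ;; dup ;; e"
  let ?L = "Loop (\<lambda>ss. ss ! 2 = 2) ?body"
  let ?t = "\<lambda>x. 60 + 21 * B x + poly p (B x) + poly r (B x)"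
  have test: "run (dup ;; e) (main (wd y @ s)) (21 * m + 6 + poly r m) (main (wd (b y) @ wd y @ s))"
    if "sz y \<le> m" for y s m
    by (rule run_Seq[OF run_dup e(3)]) (use that poly_mono[OF that, of r] in simp)
  have loop: "run (?L ;; drop1) (main (wd (b ((f ^^ i) (g x))) @ wd ((f ^^ i) (g x)) @ s))
     ((n x - i) * ?t x + 20) (main (wd (w x) @ s))" if "i \<le> n x" for i x s
    using that
  proof (induction "n x - i" arbitrary: i)
    case 0
    then have i: "i = n x" by simp
    have "run ?L (main (wd (b ((f ^^ i) (g x))) @ wd ((f ^^ i) (g x)) @ s)) 1
        (main (wd (b ((f ^^ i) (g x))) @ wd ((f ^^ i) (g x)) @ s))"
      using b(2)[of x] i by (intro run_LoopF) auto
    from run_Seq[OF this run_drop, of 20] i n(2)[of x] b(2)[of x] show ?case by auto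
  next
    case (Suc k)
    then have i: "i < n x" "Suc i \<le> n x" "k = n x - Suc i" by simp_all
    let ?y = "(f ^^ i) (g x)" and ?z = "(f ^^ Suc i) (g x)"
    have "run ?body (main (wd (b ?y) @ wd ?y @ s)) (48 + 21 * B x + poly p (B x) + poly r (B x))
      (main (wd (b ?z) @ wd ?z @ s))"
    proof (rule run_Seq[OF run_drop run_Seq[OF c(3) _ order_refl]])
      show "run (dup ;; e) (main (wd (f ?y) @ s)) (21 * B x + 6 + poly r (B x)) (main (wd (b ?z) @ wd ?z @ s))"
        using test[OF sz[OF i(2)]] by simp
      show "11 * sz (b ?y) + 4 + (poly p (sz ?y) + (21 * B x + 6 + poly r (B x)))
        \<le> 48 + 21 * B x + poly p (B x) + poly r (B x)"
        using b(1)[OF i(1)] poly_mono[OF sz[of i x], of p] i(1) by simp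
    qed
    moreover have "run (?L ;; drop1) (main (wd (b ?z) @ wd ?z @ s))
        ((n x - Suc i) * ?t x + 20) (main (wd (w x) @ s))"
      using Suc.hyps(1)[OF i(3) i(2)] .
    \<comment> \<open>The induction hypothesis speaks of \<open>?L ;; drop1\<close>. It is taken
      apart on the level of \<open>exec\<close> so that one more round can be put in front of the
      loop alone.\<close>
    ultimately obtain t1 t2 where t: "t1 \<le> 48 + 21 * B x + poly p (B x) + poly r (B x)"
      "t2 \<le> (n x - Suc i) * ?t x + 20"
      "exec ?body (map stk (main (wd (b ?y) @ wd ?y @ s))) t1 (map stk (main (wd (b ?z) @ wd ?z @ s)))"
      "exec (?L ;; drop1) (map stk (main (wd (b ?z) @ wd ?z @ s))) t2 (map stk (main (wd (w x) @ s)))"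
      unfolding run_def by blast
    from t(4) obtain t3 t4 us where u: "t2 = t3 + t4"
      "exec ?L (map stk (main (wd (b ?z) @ wd ?z @ s))) t3 us" "exec drop1 us t4 (map stk (main (wd (w x) @ s)))"
      by (cases rule: exec.cases) auto
    have "map scan (map stk (main (wd (b ?y) @ wd ?y @ s))) ! 2 = 2"
      using b(1)[OF i(1)] by (simp add: st_def)
    from exec_Seq[OF exec_LoopT[of "\<lambda>ss. ss ! 2 = 2", OF this t(3) u(2)] u(3)]
    show ?case
    proof (rule runI)
      have "(n x - i) * ?t x = ?t x + (n x - Suc i) * ?t x"
        using i by (metis Suc_diff_Suc mult_Suc)
      with t(1,2) u(1) show "1 + t1 + 1 + t3 + t4 \<le> (n x - i) * ?t x + 20" by linarith
    qed
  qed
  show ?thesis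
  proof (rule ptI[of "h ;; dup ;; e ;; ?L ;; drop1" _ q
      "u + [:26:] + [:21:] * q + pcompose r q + q * ([:60:] + [:21:] * q + pcompose p q + pcompose r q)"])
    show "sz (w x) \<le> poly q (sz x)" for x
      using sz[of "n x" x] n(2)[of x] q[of x] by simp
    fix x s
    have le: "poly p (B x) \<le> poly p (poly q (sz x))" "poly r (B x) \<le> poly r (poly q (sz x))"
      by (intro poly_mono q)+
    have "run (dup ;; e) (main (wd (g x) @ s)) (21 * B x + 6 + poly r (B x)) (main (wd (b (g x)) @ wd (g x) @ s))"
      using test[of "g x" "B x"] sz[of 0 x] by simp
    then obtain t1 where t1: "t1 \<le> 21 * B x + 6 + poly r (B x)"
      "exec (dup ;; e) (map stk (main (wd (g x) @ s))) t1 (map stk (main (wd (b (g x)) @ wd (g x) @ s)))"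
      unfolding run_def by blast
    from t1(2) obtain t3 t4 us where u: "t1 = t3 + t4"
      "exec dup (map stk (main (wd (g x) @ s))) t3 us"
      "exec e us t4 (map stk (main (wd (b (g x)) @ wd (g x) @ s)))"
      by (cases rule: exec.cases) auto
    from loop[of 0 x s] obtain t2 where t2: "t2 \<le> n x * ?t x + 20"
      "exec (?L ;; drop1) (map stk (main (wd (b (g x)) @ wd (g x) @ s))) t2 (map stk (main (wd (w x) @ s)))"
      unfolding run_def by auto
    have "run (dup ;; e ;; ?L ;; drop1) (main (wd (g x) @ s)) (t1 + t2) (main (wd (w x) @ s))"
      by (rule runI[OF exec_Seq[OF u(2) exec_Seq[OF u(3) t2(2)]]]) (simp add: u)
    then show "run (h ;; dup ;; e ;; ?L ;; drop1) (main (wd x @ s)) (poly (u + [:26:] + [:21:] * q +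
        pcompose r q + q * ([:60:] + [:21:] * q + pcompose p q + pcompose r q)) (sz x)) (main (wd (w x) @ s))"
    proof (rule run_Seq[OF g(3)])
      have "n x * ?t x \<le> poly q (sz x) * (60 + 21 * poly q (sz x) + poly p (poly q (sz x)) + poly r (poly q (sz x)))"
        using n(1)[of x] q[of x] le by (intro mult_mono add_mono) auto
      then show "poly u (sz x) + (t1 + t2) \<le> poly (u + [:26:] + [:21:] * q + pcompose r q +
        q * ([:60:] + [:21:] * q + pcompose p q + pcompose r q)) (sz x)"
        using t1(1) t2(1) q[of x] le by (simp add: poly_pcompose)
    qed
  qed (simp add: c e g)
qed

section \<open>Functions on lists and natural numbers\<close>

lemma pt_Cons [pt_intros]: "pt f \<Longrightarrow> pt g \<Longrightarrow> pt (\<lambda>x. f x # g x)"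
  by (rule pt_comp2[of "(#)"]) (rule pt_cast, auto)

lemma pt_Suc [pt_intros]: "pt f \<Longrightarrow> pt (\<lambda>x. Suc (f x))"
  by (rule pt_comp2[of "\<lambda>_ n. Suc n" "\<lambda>_. ()"]) (rule pt_cast, auto intro: pt_const)

lemma pt_length_unit: "pt f \<Longrightarrow> pt (\<lambda>x. length (f x :: unit list))"
proof (rule pt_comp[of length], rule pt_cast)
  show "wd (length us) = wd us" for us :: "unit list" by (induction us) simp_all
qed

lemma pt_units: "pt f \<Longrightarrow> pt (\<lambda>x. replicate (f x) ())"
  by (rule pt_comp[of "\<lambda>n. replicate n ()"], rule pt_cast, rule wd_nat[symmetric])

lemma pt_conj [pt_intros]: "pt f \<Longrightarrow> pt g \<Longrightarrow> pt (\<lambda>x. f x \<and> g x)"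
proof -
  assume "pt f" "pt g"
  then have "pt (\<lambda>x. if f x then g x else False)" by (intro pt_intros)
  moreover have "(\<lambda>x. if f x then g x else False) = (\<lambda>x. f x \<and> g x)" by auto
  ultimately show ?thesis by simp
qed

lemma pt_not [pt_intros]: "pt f \<Longrightarrow> pt (\<lambda>x. \<not> f x)"
  using pt_if[of f "\<lambda>_. False" "\<lambda>_. True"] pt_const[of False] pt_const[of True]
  by (simp add: if_bool_eq_conj)

lemma sz_list: "sz xs = 1 + (\<Sum>x\<leftarrow>xs. Suc (sz x))"
  by (induction xs) simp_all

lemma sz_nat: "sz (n::nat) = 2 * n + 1"
  by (induction n) simp_all

lemma sz_append: "sz (xs @ ys) + 1 = sz xs + sz ys"
  by (induction xs) simp_all

lemma sz_rev [simp]: "sz (rev xs) = sz xs"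
  by (simp add: sz_list rev_map[symmetric])

lemma length_le_sz: "length xs \<le> sz xs"
  by (induction xs) simp_all

lemma sz_take: "sz (take i xs) \<le> sz xs"
  using sz_append[of "take i xs" "drop i xs"] sz_pos[of "drop i xs"] by simp

lemma sz_member: "x \<in> set xs \<Longrightarrow> sz x < sz xs"
  by (induction xs) auto

lemma sz_bool: "sz (b::bool) \<le> 3"
  by (cases b) simp_all

lemma bdd_length [bdd_intros]: "pt f \<Longrightarrow> bdd (\<lambda>x. length (f x))"
  by (rule bdd_le[OF bdd_sz length_le_sz])

lemma bdd_nat: "pt f \<Longrightarrow> bdd f"
  by (rule bdd_le[OF bdd_sz[of f]]) (simp_all add: sz_nat)

text \<open>The loop state carries the argument \<open>x\<close>, the unread rest of the list and
  the accumulator. Most list functions below are folds, for which only a size bound on the folds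
  over prefixes remains to be shown.\<close>

lemma pt_foldl:
  assumes F: "pt (\<lambda>p. F (fst p) (fst (snd p)) (snd (snd p)))" and a: "pt a" and xs: "pt xs"
    and B: "bdd B" "\<And>x i. i \<le> length (xs x) \<Longrightarrow> sz (foldl (F x) (a x) (take i (xs x))) \<le> B x"
  shows "pt (\<lambda>x. foldl (F x) (a x) (xs x))"
proof -
  define step where "step = (\<lambda>s. (fst s, case fst (snd s) of [] \<Rightarrow> snd s
      | y # ys \<Rightarrow> (ys, F (fst s) (snd (snd s)) y)))"
  define g where "g = (\<lambda>x. (x, xs x, a x))"
  have step_i: "(step ^^ i) (g x) = (x, drop i (xs x), foldl (F x) (a x) (take i (xs x)))"
    if "i \<le> length (xs x)" for x i
    using that
  proof (induction i)
    case 0 then show ?case by (simp add: g_def)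
  next
    case (Suc i)
    then have "drop i (xs x) = xs x ! i # drop (Suc i) (xs x)"
      by (simp add: Cons_nth_drop_Suc)
    with Suc show ?case by (simp add: step_def take_Suc_conv_app_nth)
  qed
  have pg: "pt g" unfolding g_def by (intro pt_intros xs a)
  have ps: "pt step" unfolding step_def
    by (intro pt_intros pt_comp[OF F, of "\<lambda>p. (fst (fst p), snd (snd (fst p)), fst (snd p))", simplified])
  have sz_drop: "sz (drop i ys) \<le> sz ys" for i and ys :: "'c list"
    using sz_append[of "take i ys" "drop i ys"] sz_pos[of "take i ys"] by simp
  have "pt (\<lambda>x. (step ^^ length (xs x)) (g x))"
  proof (rule pt_while[where b = "\<lambda>s. fst (snd s) \<noteq> []" and f = step and g = g
        and n = "\<lambda>x. length (xs x)" and B = "\<lambda>x. 2 + sz x + sz (xs x) + B x"])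
    show "pt (\<lambda>s :: 'a \<times> 'c list \<times> 'b. fst (snd s) \<noteq> [])" by (intro pt_intros)
    show "bdd (\<lambda>x. 2 + sz x + sz (xs x) + B x)" by (intro bdd_intros B pt_id xs)
    show "length (xs x) \<le> 2 + sz x + sz (xs x) + B x" for x
      using length_le_sz[of "xs x"] by simp
    show "sz ((step ^^ i) (g x)) \<le> 2 + sz x + sz (xs x) + B x" if "i \<le> length (xs x)" for x i
      using that B(2)[OF that] sz_drop[of i "xs x"] by (simp add: step_i)
    show "fst (snd ((step ^^ i) (g x))) \<noteq> []" if "i < length (xs x)" for x i
      using that by (simp add: step_i)
    show "\<not> fst (snd ((step ^^ length (xs x)) (g x))) \<noteq> []" for x
      by (simp add: step_i)
  qed (rule ps pg refl)+
  then have "pt (\<lambda>x. snd (snd ((step ^^ length (xs x)) (g x))))" by (intro pt_intros)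
  then show ?thesis by (simp add: step_i)
qed

lemma pt_rev [pt_intros]:
  assumes "pt f" shows "pt (\<lambda>x. rev (f x))"
proof -
  have *: "foldl (\<lambda>a y. y # a) [] ys = rev ys" for ys :: "'b list"
    by (induction ys rule: rev_induct) simp_all
  have "pt (\<lambda>x. foldl (\<lambda>a y. y # a) [] (f x))"
    by (rule pt_foldl[where B = "\<lambda>x. sz (f x)"])
       (intro pt_intros bdd_intros assms | simp add: * sz_take)+
  then show ?thesis by (simp add: *)
qed

lemma pt_append [pt_intros]:
  assumes "pt f" "pt g" shows "pt (\<lambda>x. f x @ g x)"
proof -
  have *: "foldl (\<lambda>a y. y # a) zs ys = rev ys @ zs" for ys zs :: "'b list"
    by (induction ys rule: rev_induct) simp_all
  have "sz (rev (take i (rev (f x))) @ g x) \<le> sz (f x) + sz (g x)" for i x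
    using sz_append[of "rev (take i (rev (f x)))" "g x"] sz_take[of i "rev (f x)"] by simp
  then have "pt (\<lambda>x. foldl (\<lambda>a y. y # a) (g x) (rev (f x)))"
    by - (rule pt_foldl[where B = "\<lambda>x. sz (f x) + sz (g x)"],
       (intro pt_intros bdd_intros assms | simp add: *)+)
  then show ?thesis by (simp add: *)
qed

lemma sum_list_bound: "(\<And>y. y \<in> set ys \<Longrightarrow> h y \<le> m) \<Longrightarrow> (\<Sum>y\<leftarrow>ys. h y) \<le> length ys * (m::nat)"
  by (induction ys) (auto intro: add_mono)

lemma bdd_member:
  assumes f: "pt (\<lambda>p. f (fst p) (snd p))" and xs: "pt xs"
  obtains B where "bdd B" "\<And>x y. y \<in> set (xs x) \<Longrightarrow> sz (f x y) \<le> B x"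
proof -
  obtain p where p: "\<And>q. sz (f (fst q) (snd q)) \<le> poly p (sz q)"
    using f by (erule_tac pt_bdd_poly) blast
  show ?thesis
  proof
    show "bdd (\<lambda>x. poly p (1 + sz x + sz (xs x)))"
      by (intro bdd_poly_sz bdd_intros xs pt_id)
    show "sz (f x y) \<le> poly p (1 + sz x + sz (xs x))" if "y \<in> set (xs x)" for x y
    proof -
      have "sz (f x y) \<le> poly p (sz (x, y))" using p[of "(x, y)"] by simp
      also have "\<dots> \<le> poly p (1 + sz x + sz (xs x))"
        by (rule poly_mono) (use sz_member[OF that] in simp)
      finally show ?thesis .
    qed
  qed
qed

lemma pt_map [pt_intros]:
  assumes f: "pt (\<lambda>p. f (fst p) (snd p))" and xs: "pt xs"
  shows "pt (\<lambda>x. map (f x) (xs x))"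
proof -
  have *: "foldl (\<lambda>a y. f x y # a) [] ys = rev (map (f x) ys)" for x ys
    by (induction ys rule: rev_induct) simp_all
  obtain B where B: "bdd B" "\<And>x y. y \<in> set (xs x) \<Longrightarrow> sz (f x y) \<le> B x"
    using bdd_member[OF f xs] by blast
  have "sz (map (f x) (take i (xs x))) \<le> 1 + length (xs x) * (1 + B x)" for x i
  proof -
    have "(\<Sum>y\<leftarrow>take i (xs x). Suc (sz (f x y))) \<le> length (take i (xs x)) * (1 + B x)"
      by (rule sum_list_bound) (auto dest!: in_set_takeD simp: B(2))
    also have "\<dots> \<le> length (xs x) * (1 + B x)" by (intro mult_right_mono) auto
    finally show ?thesis by (simp add: sz_list comp_def)
  qed
  then have "pt (\<lambda>x. foldl (\<lambda>a y. f x y # a) [] (xs x))"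
    by - (rule pt_foldl[where B = "\<lambda>x. 1 + length (xs x) * (1 + B x)"],
       (intro pt_intros bdd_intros xs B pt_comp2[OF f] | simp add: *)+)
  then have "pt (\<lambda>x. rev (foldl (\<lambda>a y. f x y # a) [] (xs x)))" by (rule pt_rev)
  then show ?thesis by (simp add: *)
qed

lemma sz_filter: "sz (filter P xs) \<le> sz xs"
  by (induction xs) auto

lemma pt_filter [pt_intros]:
  assumes f: "pt (\<lambda>p. P (fst p) (snd p))" and xs: "pt xs"
  shows "pt (\<lambda>x. filter (P x) (xs x))"
proof -
  have *: "foldl (\<lambda>a y. if P x y then y # a else a) [] ys = rev (filter (P x) ys)" for x ys
    by (induction ys rule: rev_induct) simp_all
  have "pt (\<lambda>x. foldl (\<lambda>a y. if P x y then y # a else a) [] (xs x))"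
    by (rule pt_foldl[where B = "\<lambda>x. sz (xs x)"])
       (intro pt_intros bdd_intros xs pt_comp2[OF f] |
         simp add: * order_trans[OF sz_filter sz_take])+
  then have "pt (\<lambda>x. rev (foldl (\<lambda>a y. if P x y then y # a else a) [] (xs x)))" by (rule pt_rev)
  then show ?thesis by (simp add: *)
qed

lemma pt_length [pt_intros]: "pt f \<Longrightarrow> pt (\<lambda>x. length (f x))"
proof -
  assume "pt f"
  then have "pt (\<lambda>x. length (map (\<lambda>_. ()) (f x)))" by (intro pt_length_unit pt_map pt_const)
  then show ?thesis by simp
qed

lemma pt_concat [pt_intros]:
  assumes "pt f" shows "pt (\<lambda>x. concat (f x))"
proof -
  have *: "foldl (@) [] ys = concat ys" for ys :: "'b list list"
    by (induction ys rule: rev_induct) simp_all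
  have "sz (concat ys) \<le> sz ys" for ys :: "'b list list"
  proof (induction ys)
    case (Cons y ys)
    then show ?case using sz_append[of y "concat ys"] by simp
  qed simp
  from order_trans[OF this sz_take]
  have "pt (\<lambda>x. foldl (@) [] (f x))"
    by - (rule pt_foldl[where B = "\<lambda>x. sz (f x)"], (intro pt_intros bdd_intros assms | simp add: *)+)
  then show ?thesis by (simp add: *)
qed

lemma pt_plus [pt_intros]: "pt f \<Longrightarrow> pt g \<Longrightarrow> pt (\<lambda>x. f x + g x :: nat)"
  using pt_length[of "\<lambda>x. replicate (f x) () @ replicate (g x) ()"] pt_append pt_units by auto

lemma pt_times [pt_intros]:
  assumes "pt f" "pt g" shows "pt (\<lambda>x. f x * g x :: nat)"
proof -
  have "pt (\<lambda>x. length (concat (map (\<lambda>_. replicate (g x) ()) (replicate (f x) ()))))"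
    by (intro pt_intros pt_units pt_comp[OF assms(1)] pt_comp[OF assms(2)])
  then show ?thesis by (simp add: length_concat sum_list_replicate comp_def map_replicate)
qed

lemma pt_tl [pt_intros]: "pt f \<Longrightarrow> pt (\<lambda>x. tl (f x))"
proof -
  assume "pt f"
  then have "pt (\<lambda>x. case f x of [] \<Rightarrow> [] | y # ys \<Rightarrow> ys)" by (intro pt_intros)
  moreover have "(case f x of [] \<Rightarrow> [] | y # ys \<Rightarrow> ys) = tl (f x)" for x by (cases "f x") simp_all
  ultimately show ?thesis by simp
qed

text \<open>\<open>hd []\<close> is a fixed though unspecified value, hence a constant with some
  word.\<close>

lemma pt_hd [pt_intros]: "pt f \<Longrightarrow> pt (\<lambda>x. hd (f x))"
proof -
  assume "pt f"
  then have "pt (\<lambda>x. case f x of [] \<Rightarrow> hd [] | y # ys \<Rightarrow> y)" by (intro pt_intros)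
  moreover have "(case f x of [] \<Rightarrow> hd [] | y # ys \<Rightarrow> y) = hd (f x)" for x by (cases "f x") simp_all
  ultimately show ?thesis by simp
qed

lemma pt_drop [pt_intros]:
  assumes "pt n" "pt f" shows "pt (\<lambda>x. drop (n x) (f x))"
proof -
  have *: "foldl (\<lambda>a _. tl a) ys us = drop (length us) ys" for ys :: "'b list" and us :: "unit list"
    by (induction us rule: rev_induct) (simp_all add: drop_Suc tl_drop)
  have "sz (drop i ys) \<le> sz ys" for i and ys :: "'b list"
    using sz_append[of "take i ys" "drop i ys"] sz_pos[of "take i ys"] by simp
  then have "pt (\<lambda>x. foldl (\<lambda>a _. tl a) (f x) (replicate (n x) ()))"
    by - (rule pt_foldl[where B = "\<lambda>x. sz (f x)"], (intro pt_intros pt_units bdd_intros assms | simp add: *)+)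
  then show ?thesis by (simp add: *)
qed

lemma pt_minus [pt_intros]: "pt f \<Longrightarrow> pt g \<Longrightarrow> pt (\<lambda>x. f x - g x :: nat)"
  using pt_length[OF pt_drop[OF _ pt_units], of g f] by simp

lemma pt_le [pt_intros]: "pt f \<Longrightarrow> pt g \<Longrightarrow> pt (\<lambda>x. f x \<le> (g x :: nat))"
  using pt_eq[OF pt_minus pt_const[of 0], of f g] by simp

lemma pt_less [pt_intros]: "pt f \<Longrightarrow> pt g \<Longrightarrow> pt (\<lambda>x. f x < (g x :: nat))"
  using pt_le[OF pt_Suc, of f g] by (simp add: Suc_le_eq)

lemma pt_replicate [pt_intros]: "pt n \<Longrightarrow> pt f \<Longrightarrow> pt (\<lambda>x. replicate (n x) (f x))"
proof -
  assume n: "pt n" and f: "pt f"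
  have "pt (\<lambda>x. map (\<lambda>_. f x) (replicate (n x) ()))"
    by (intro pt_map pt_units pt_comp[OF f] n pt_intros)
  then show ?thesis by (simp add: map_replicate)
qed

lemma pt_member [pt_intros]: "pt f \<Longrightarrow> pt g \<Longrightarrow> pt (\<lambda>x. f x \<in> set (g x))"
proof -
  assume f: "pt f" and g: "pt g"
  have "pt (\<lambda>x. filter (\<lambda>y. y = f x) (g x) \<noteq> [])"
    by (intro pt_intros pt_comp[OF f] g)
  moreover have "filter (\<lambda>y. y = f x) (g x) \<noteq> [] \<longleftrightarrow> f x \<in> set (g x)" for x
    by (auto simp: filter_empty_conv)
  ultimately show ?thesis by simp
qed

text \<open>\<open>remdups\<close> keeps last occurrences, so the fold runs over the reversed
  list.\<close>

lemma pt_remdups [pt_intros]: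
  assumes "pt f" shows "pt (\<lambda>x. remdups (f x))"
proof -
  have *: "foldl (\<lambda>a y. if y \<in> set a then a else y # a) [] (rev ys) = remdups ys" for ys :: "'b list"
    by (induction ys) simp_all
  have **: "foldl (\<lambda>a y. if y \<in> set a then a else y # a) [] zs = remdups (rev zs)" for zs :: "'b list"
    using *[of "rev zs"] by simp
  have "sz (remdups ys) \<le> sz ys" for ys :: "'b list"
    by (induction ys) auto
  from order_trans[OF this[of "rev _", unfolded sz_rev] sz_take]
  have A: "sz (remdups (rev (take i ys))) \<le> sz ys" for i and ys :: "'b list" .
  have "sz (remdups (rev (take i (rev ys)))) \<le> sz ys" for i and ys :: "'b list"
    using A[of i "rev ys"] by simp
  then have "pt (\<lambda>x. foldl (\<lambda>a y. if y \<in> set a then a else y # a) [] (rev (f x)))"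
    by - (rule pt_foldl[where B = "\<lambda>x. sz (f x)"], (intro pt_intros bdd_intros assms | simp add: **)+)
  then show ?thesis by (simp add: *)
qed

text \<open>Folding from the right needs no flag: an element that fails the test discards everything
  collected behind it.\<close>

lemma pt_takeWhile [pt_intros]:
  assumes f: "pt (\<lambda>p. P (fst p) (snd p))" and xs: "pt xs"
  shows "pt (\<lambda>x. takeWhile (P x) (xs x))"
proof -
  have *: "foldl (\<lambda>a y. if P x y then y # a else []) [] (rev ys) = takeWhile (P x) ys" for x ys
    by (induction ys) simp_all
  have **: "foldl (\<lambda>a y. if P x y then y # a else []) [] zs = takeWhile (P x) (rev zs)" for x zs
    using *[of x "rev zs"] by simp
  have "sz (takeWhile (P x) ys) \<le> sz ys" for x and ys :: "'b list"
    by (induction ys) auto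
  from order_trans[OF this[of _ "rev _", unfolded sz_rev] sz_take]
  have A: "sz (takeWhile (P x) (rev (take i ys))) \<le> sz ys" for x i and ys :: "'b list" .
  have "sz (takeWhile (P x) (rev (take i (rev ys)))) \<le> sz ys" for x i and ys :: "'b list"
    using A[of x i "rev ys"] by simp
  then have "pt (\<lambda>x. foldl (\<lambda>a y. if P x y then y # a else []) [] (rev (xs x)))"
    by - (rule pt_foldl[where B = "\<lambda>x. sz (xs x)"],
       (intro pt_intros bdd_intros xs pt_comp2[OF f] | simp add: **)+)
  then show ?thesis by (simp add: *)
qed

lemma pt_upt [pt_intros]:
  assumes "pt n" shows "pt (\<lambda>x. [0..<n x])"
proof -
  have *: "foldl (\<lambda>a _. length a # a) [] us = rev [0..<length us]" for us :: "unit list"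
    by (induction us rule: rev_induct) simp_all
  have "sz [0..<k] \<le> 1 + k * (2 * n x + 2)" if "k \<le> n x" for k x
    using that sum_list_bound[of "[0..<k]" "\<lambda>y. Suc (sz y)" "2 * n x + 2"]
    by (simp add: sz_list sz_nat)
  then have "sz [0..<i] \<le> 1 + n x * (2 * n x + 2)" if "i \<le> n x" for i x
    using that by (meson add_left_mono mult_le_mono1 order_trans)
  then have "pt (\<lambda>x. foldl (\<lambda>a _. length a # a) [] (replicate (n x) ()))"
    by - (rule pt_foldl[where B = "\<lambda>x. 1 + n x * (2 * n x + 2)"],
       (intro pt_intros pt_units bdd_intros bdd_nat assms | simp add: *)+)
  then have "pt (\<lambda>x. rev (foldl (\<lambda>a _. length a # a) [] (replicate (n x) ())))" by (rule pt_rev)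
  then show ?thesis by (simp add: *)
qed

lemma pt_zip [pt_intros]:
  assumes "pt f" "pt g" shows "pt (\<lambda>x. zip (f x) (g x))"
proof -
  define F :: "('b \<times> 'c) list \<times> 'c list \<Rightarrow> 'b \<Rightarrow> ('b \<times> 'c) list \<times> 'c list" where
    "F = (\<lambda>a y. case snd a of [] \<Rightarrow> (fst a, []) | z # zs \<Rightarrow> ((y, z) # fst a, zs))"
  have z: "zip ys (take (length ys) zs) = zip ys zs" for ys :: "'b list" and zs :: "'c list"
    by (metis length_zip min.cobounded1 order_refl take_all take_zip)
  have *: "foldl F ([], zs) ys = (rev (zip ys zs), drop (length ys) zs)" for ys zs
  proof (induction ys rule: rev_induct)
    case (snoc y ys)
    show ?case
    proof (cases "drop (length ys) zs")
      case Nil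
      with snoc show ?thesis by (simp add: F_def zip_append1 z)
    next
      case (Cons w ws)
      then have "drop (Suc (length ys)) zs = ws" by (metis drop_Suc list.sel(3) tl_drop)
      with Cons snoc show ?thesis by (simp add: F_def zip_append1 z)
    qed
  qed simp
  have Z: "sz (zip ys zs) \<le> sz ys + sz zs" for ys :: "'b list" and zs :: "'c list"
  proof (induction ys arbitrary: zs)
    case (Cons y ys)
    show ?case using Cons[of "tl zs"] by (cases zs) simp_all
  qed simp
  have D: "sz (drop i ys) \<le> sz ys" for i and ys :: "'c list"
    using sz_append[of "take i ys" "drop i ys"] sz_pos[of "take i ys"] by simp
  have "sz (zip (take i ys) zs) + sz (drop j zs) \<le> sz ys + (sz zs + sz zs)"
    for i j and ys :: "'b list" and zs :: "'c list"
    using Z[of "take i ys" zs] D[of j zs] sz_take[of i ys] by linarith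
  then have "pt (\<lambda>x. foldl F ([], g x) (f x))"
    by - (rule pt_foldl[where B = "\<lambda>x. Suc (sz (f x) + (sz (g x) + sz (g x)))"],
       (intro pt_intros pt_units bdd_intros assms | simp add: * | simp only: F_def)+)
  then have "pt (\<lambda>x. rev (fst (foldl F ([], g x) (f x))))" by (intro pt_intros)
  then show ?thesis by (simp add: *)
qed

lemma pt_funpow:
  fixes F :: "'a::encodable \<Rightarrow> 'b::encodable \<Rightarrow> 'b"
  assumes F: "pt (\<lambda>p. F (fst p) (snd p))" and a: "pt a" and n: "pt n"
    and B: "bdd B" "\<And>x i. i \<le> n x \<Longrightarrow> sz ((F x ^^ i) (a x)) \<le> B x"
  shows "pt (\<lambda>x. (F x ^^ n x) (a x))"
proof -
  have *: "foldl (\<lambda>a _. F x a) b us = (F x ^^ length us) b" for x b and us :: "unit list"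
    by (induction us rule: rev_induct) simp_all
  have "pt (\<lambda>x. foldl (\<lambda>a _. F x a) (a x) (replicate (n x) ()))"
    by (rule pt_foldl[where B = B]) (intro pt_intros pt_units B a n pt_comp2[OF F] | simp add: * B)+
  then show ?thesis by (simp add: *)
qed

section \<open>Input and output\<close>

definition seek :: "nat \<Rightarrow> com" where
  "seek i = Loop (\<lambda>ss. ss ! i \<noteq> 0) (Act (\<lambda>ss. (stay ss)[i := (ss ! i, MoveRight)]))"

lemma code_pos [simp]: "0 < code s" "code s \<noteq> 0"
  by (cases s; simp)+

lemma word_tape_stk: "word_tape w = (fst (stk (rev (map code w))), 0)"
  by (auto simp: word_tape_def stk_def fun_eq_iff nat_less_iff)

lemma exec_seek:
  assumes "i < length ts" "k \<le> length w"
  shows "exec (seek i) (ts[i := (fst (word_tape w), int k)]) (3 * (length w - k) + 1)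
    (ts[i := (fst (word_tape w), int (length w))])"
  using assms(2)
proof (induction "length w - k" arbitrary: k)
  case 0
  then have k: "k = length w" by simp
  have "\<not> map scan (ts[i := (fst (word_tape w), int k)]) ! i \<noteq> 0"
    using assms(1) k by (simp add: word_tape_def)
  from exec_LoopF[of "\<lambda>ss. ss ! i \<noteq> 0", OF this] k show ?case by (simp add: seek_def)
next
  case (Suc m)
  then have k: "k < length w" "Suc k \<le> length w" "m = length w - Suc k" by simp_all
  let ?ts = "ts[i := (fst (word_tape w), int k)]"
  have 1: "map scan ?ts ! i \<noteq> 0"
    using assms(1) k by (simp add: word_tape_def)
  have 2: "exec (Act (\<lambda>ss. (stay ss)[i := (ss ! i, MoveRight)])) ?ts 1 (ts[i := (fst (word_tape w), int (Suc k))])"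
    using exec_right[of i ?ts] assms(1) by (simp add: up_def add.commute)
  have "3 * (length w - k) + 1 = 1 + 1 + 1 + (3 * (length w - Suc k) + 1)"
    using k by simp
  with exec_LoopT[of "\<lambda>ss. ss ! i \<noteq> 0", OF 1 2 Suc.hyps(1)[OF k(3,2), unfolded seek_def]]
  show ?case unfolding seek_def by simp
qed

text \<open>An input word with the head on its last symbol is a stack holding the reversed word.
  After the heads have passed the inputs, one common step to the left makes stacks of all tapes,
  also of the empty ones, whose head belongs at cell -1.\<close>

definition init_stacks :: com where
  "init_stacks = seek 0 ;; seek 1 ;; Act (map (\<lambda>s. (s, MoveLeft)))"

lemma exec_init_stacks:
  "exec init_stacks (map word_tape [u, v] @ replicate 5 (word_tape []))
     (3 * (length u + length v) + 3)
     (map stk [rev (map code u), rev (map code v), [], [], [], [], []])"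
proof -
  let ?e = "word_tape []"
  let ?u = "(fst (word_tape u), int (length u))" and ?v = "(fst (word_tape v), int (length v))"
  have w: "word_tape w = (fst (word_tape w), int 0)" for w by (simp add: word_tape_def)
  have "exec (seek 0) [word_tape u, word_tape v, ?e, ?e, ?e, ?e, ?e] (3 * length u + 1)
      [?u, word_tape v, ?e, ?e, ?e, ?e, ?e]"
    using exec_seek[of 0 "[word_tape u, word_tape v, ?e, ?e, ?e, ?e, ?e]" 0 u] w[of u] by simp
  moreover have "exec (seek 1) [?u, word_tape v, ?e, ?e, ?e, ?e, ?e] (3 * length v + 1)
      [?u, ?v, ?e, ?e, ?e, ?e, ?e]"
    using exec_seek[of 1 "[?u, word_tape v, ?e, ?e, ?e, ?e, ?e]" 0 v] w[of v] by simp
  moreover have "exec (Act (map (\<lambda>s. (s, MoveLeft)))) [?u, ?v, ?e, ?e, ?e, ?e, ?e] 1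
     (map stk [rev (map code u), rev (map code v), [], [], [], [], []])"
    by (rule exec_Act') (auto simp: word_tape_def fun_eq_iff stk_def)
  ultimately have "exec init_stacks [word_tape u, word_tape v, ?e, ?e, ?e, ?e, ?e]
     (3 * length u + 1 + (3 * length v + 1 + 1))
     (map stk [rev (map code u), rev (map code v), [], [], [], [], []])"
    unfolding init_stacks_def by (intro exec_Seq)
  moreover have "3 * length u + 1 + (3 * length v + 1 + 1) = 3 * (length u + length v) + 3" by simp
  moreover have "map word_tape [u, v] @ replicate 5 ?e = [word_tape u, word_tape v, ?e, ?e, ?e, ?e, ?e]"
    by (simp add: eval_nat_numeral)
  ultimately show ?thesis by (simp only:)
qed

lemma wf_init_stacks [simp]: "wf_com 7 5 init_stacks"
proof -
  have "wf_com 7 5 (Act (\<lambda>ss. (stay ss)[i := (ss ! i, MoveRight)]))" if "i < 7" for i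
    unfolding wf_com.simps
  proof (intro allI impI conjI fst_update fst_stay)
    fix ss :: "nat list" assume "length ss = 7 \<and> set ss \<subseteq> {..<5}"
    then show "fst (ss ! i, MoveRight) < 5" using that by (metis fst_conv lessThan_iff nth_mem subsetD)
  qed auto
  then show ?thesis by (auto simp: init_stacks_def seek_def)
qed

lemma io_ops:
  "run (pop 0) (io (x # a) b s out) 1 (io a b s out)"
  "run (pop 1) (io a (x # b) s out) 1 (io a b s out)"
  "run (pop 2) (io a b (x # s) out) 1 (io a b s out)"
  "run (push 6 x) (io a b s out) 2 (io a b s (x # out))"
  using run_pop[of 0 "io (x # a) b s out" x a] run_pop[of 1 "io a (x # b) s out" x b]
    run_pop[of 2 "io a b (x # s) out" x s] run_push[of 6 "io a b s out" x]
  by (simp_all add: io_def eval_nat_numeral)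

lemma top_io [simp]:
  "map top_sym (io a b s out) ! 0 = top_sym a" "map top_sym (io a b s out) ! Suc 0 = top_sym b"
  "map top_sym (io a b s out) ! 2 = top_sym s"
  by (simp_all add: io_def)

lemma wd_symbol: "wd Zero = [2, 1, 1]" "wd One = [2, 1, 2, 1, 1]" "wd Open = [2, 2, 1, 1, 1]" "wd Close = [1]"
  by (simp_all add: wd_def enc_symbol_def)

definition read_symbol :: "nat \<Rightarrow> com" where
  "read_symbol i =
     Cond (\<lambda>ss. ss ! i = 1) (pop i ;; push_word (2 # wd Zero))
    (Cond (\<lambda>ss. ss ! i = 2) (pop i ;; push_word (2 # wd One))
    (Cond (\<lambda>ss. ss ! i = 3) (pop i ;; push_word (2 # wd Open)) (pop i ;; push_word (2 # wd Close))))"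

text \<open>The last symbol is on top, so consing the symbols in the order of popping restores the
  word.\<close>

definition read_word :: "nat \<Rightarrow> com" where
  "read_word i = push_word [1] ;; Loop (\<lambda>ss. ss ! i \<noteq> 0) (read_symbol i)"

lemma run_read_symbol:
  assumes "run (pop i) xss 1 (io a b s out)" "map top_sym xss ! i = code x"
  shows "run (read_symbol i) xss 20 (io a b (2 # wd x @ s) out)"
proof -
  have *: "run (pop i ;; push_word (2 # wd x)) xss 15 (io a b (2 # wd x @ s) out)"
    using run_push_word_io[of "2 # wd x" a b s out]
    by - (rule run_Seq[OF assms(1)], auto, cases x, auto simp: wd_symbol)
  show ?thesis
    using * assms(2) unfolding read_symbol_def
    by (cases x) (force intro: run_CondT run_CondF run_CondT[OF _ _ order_refl] run_CondF[OF _ _ order_refl])+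
qed

lemma run_read_loop:
  "run (Loop (\<lambda>ss. ss ! 0 \<noteq> 0) (read_symbol 0)) (io (rev (map code w)) b (wd v @ s) out)
     (22 * length w + 1) (io [] b (wd (w @ v) @ s) out)"
  "run (Loop (\<lambda>ss. ss ! 1 \<noteq> 0) (read_symbol 1)) (io a (rev (map code w)) (wd v @ s) out)
     (22 * length w + 1) (io a [] (wd (w @ v) @ s) out)"
proof (induction w arbitrary: v rule: rev_induct)
  case Nil
  { case 1 show ?case by (simp, rule run_LoopF) simp_all }
  { case 2 show ?case by (simp, rule run_LoopF) simp_all }
next
  case (snoc x w)
  { case 1
    have "run (read_symbol 0) (io (rev (map code (w @ [x]))) b (wd v @ s) out) 20
        (io (rev (map code w)) b (wd (x # v) @ s) out)"
      using run_read_symbol[of 0 "io (rev (map code (w @ [x]))) b (wd v @ s) out"] io_ops(1) by simp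
    from run_LoopT[OF _ this snoc(1)] show ?case by simp }
  { case 2
    have "run (read_symbol 1) (io a (rev (map code (w @ [x]))) (wd v @ s) out) 20
        (io a (rev (map code w)) (wd (x # v) @ s) out)"
      using run_read_symbol[of 1 "io a (rev (map code (w @ [x]))) (wd v @ s) out"] io_ops(2) by simp
    from run_LoopT[OF _ this snoc(2)] show ?case by simp }
qed

lemma run_read_word:
  "run (read_word 0) (io (rev (map code w)) b s out) (22 * length w + 4) (io [] b (wd w @ s) out)"
  "run (read_word 1) (io a (rev (map code w)) s out) (22 * length w + 4) (io a [] (wd w @ s) out)"
proof -
  show "run (read_word 0) (io (rev (map code w)) b s out) (22 * length w + 4) (io [] b (wd w @ s) out)"
    unfolding read_word_def using run_read_loop(1)[of w b "[]" s out]
    by - (rule run_Seq[OF run_push_word_io], auto)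
  show "run (read_word 1) (io a (rev (map code w)) s out) (22 * length w + 4) (io a [] (wd w @ s) out)"
    unfolding read_word_def using run_read_loop(2)[of a w "[]" s out]
    by - (rule run_Seq[OF run_push_word_io], auto)
qed

definition write_symbol :: com where
  "write_symbol = pop 2 ;; Cond (\<lambda>ss. ss ! 2 = 1) (pop 2 ;; push 6 4)
     (pop 2 ;; Cond (\<lambda>ss. ss ! 2 = 1)
        (pop 2 ;; Cond (\<lambda>ss. ss ! 2 = 1) (pop 2 ;; push 6 1) (pop 2 ;; pop 2 ;; pop 2 ;; push 6 2))
        (pop 2 ;; pop 2 ;; pop 2 ;; pop 2 ;; push 6 3))"

definition write_word :: com where
  "write_word = Loop (\<lambda>ss. ss ! 2 = 2) write_symbol"

lemma run_write_symbol:
  "run write_symbol (io a b (2 # wd x @ s) out) 20 (io a b s (code x # out))"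
proof (cases x)
  case Zero
  show ?thesis unfolding write_symbol_def Zero wd_symbol append.simps code.simps
    by (rule run_Seq[OF io_ops(3)],
        rule run_CondF, simp,
        rule run_Seq[OF io_ops(3)],
        rule run_CondT, simp,
        rule run_Seq[OF io_ops(3)],
        rule run_CondT, simp,
        rule run_Seq[OF io_ops(3) io_ops(4)])
       (rule order_refl | simp)+
next
  case One
  show ?thesis unfolding write_symbol_def One wd_symbol append.simps code.simps
    by (rule run_Seq[OF io_ops(3)],
        rule run_CondF, simp,
        rule run_Seq[OF io_ops(3)],
        rule run_CondT, simp,
        rule run_Seq[OF io_ops(3)],
        rule run_CondF, simp,
        rule run_Seq[OF io_ops(3)],
        rule run_Seq[OF io_ops(3)],
        rule run_Seq[OF io_ops(3) io_ops(4)])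
       (rule order_refl | simp)+
next
  case Open
  show ?thesis unfolding write_symbol_def Open wd_symbol append.simps code.simps
    by (rule run_Seq[OF io_ops(3)],
        rule run_CondF, simp,
        rule run_Seq[OF io_ops(3)],
        rule run_CondF, simp,
        rule run_Seq[OF io_ops(3)],
        rule run_Seq[OF io_ops(3)],
        rule run_Seq[OF io_ops(3)],
        rule run_Seq[OF io_ops(3) io_ops(4)])
       (rule order_refl | simp)+
next
  case Close
  show ?thesis unfolding write_symbol_def Close wd_symbol append.simps code.simps
    by (rule run_Seq[OF io_ops(3)],
        rule run_CondT, simp,
        rule run_Seq[OF io_ops(3) io_ops(4)])
       (rule order_refl | simp)+
qed

text \<open>Pushing the symbols in their order fills the tape from cell 0 on, so the output tape has
  the contents of \<open>word_tape w\<close>.\<close>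

lemma run_write_word:
  "run write_word (io a b (wd w @ s) out) (22 * length w + 1) (io a b (1 # s) (rev (map code w) @ out))"
proof (induction w arbitrary: out)
  case Nil
  show ?case unfolding write_word_def by (simp, rule run_LoopF) simp_all
next
  case (Cons x w)
  have "run write_symbol (io a b (wd (x # w) @ s) out) 20 (io a b (wd w @ s) (code x # out))"
    using run_write_symbol by simp
  from run_LoopT[OF _ this Cons[unfolded write_word_def]] show ?case by (simp add: write_word_def)
qed

lemma wf_io [simp]: "wf_com 7 5 (read_word i)" "wf_com 7 5 write_word"
  by (simp_all add: read_word_def read_symbol_def write_word_def write_symbol_def wd_symbol)

lemma sz_word: "sz (w :: word) \<le> 6 * length w + 1"
proof (induction w)
  case (Cons x w)
  have "sz x \<le> 5" by (cases x) (simp_all add: sz_def wd_symbol)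
  with Cons show ?case by simp
qed simp

theorem pt_poly_time:
  fixes F :: "word \<times> word \<Rightarrow> word"
  assumes "pt F"
  shows "\<exists>M p. wf_tm M \<and> num_tapes M = 7 \<and>
    (\<forall>u v. computes_within M [u, v] (F (u, v)) (poly p (length u + length v)))"
proof -
  from assms obtain c p where c: "wf_com 7 5 c" "\<And>x. sz (F x) \<le> poly p (sz x)"
    "\<And>x s. run c (main (wd x @ s)) (poly p (sz x)) (main (wd (F x) @ s))" by (rule ptE) blast
  let ?rest = "read_word 1 ;; read_word 0 ;; push_word [2] ;; c ;; write_word"
  let ?M = "com_tm 7 5 (init_stacks ;; ?rest)"
  \<comment> \<open>The value \<open>3 + 6 * n\<close> bounds the size of the pair of inputs by
    \<open>sz_word\<close>. Of the 23 copies of the composed bound, one is the time of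
    \<open>c\<close> and 22 pay for writing the output, whose length it bounds as well.\<close>
  let ?p = "[:30, 30:] + [:23:] * pcompose p [:3, 6:]"
  show ?thesis
  proof (intro exI[of _ ?M] exI[of _ ?p] conjI allI)
    show "wf_tm ?M" by (rule wf_com_tm) (simp_all add: c)
    show "num_tapes ?M = 7" by (simp add: com_tm_def)
    fix u v :: word
    let ?n = "length u + length v"
    have sz_uv: "sz (u, v) \<le> 3 + 6 * ?n"
      using sz_word[of u] sz_word[of v] by simp
    have le: "poly p (sz (u, v)) \<le> poly p (3 + 6 * ?n)"
      by (rule poly_mono[OF sz_uv])
    have 1: "run (push_word [2]) (io [] [] (wd u @ wd v) []) 3 (io [] [] (wd (u, v)) [])"
      using run_push_word_io[of "[2]" "[]" "[]" "wd u @ wd v" "[]"] by simp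
    have 2: "run c (io [] [] (wd (u, v)) []) (poly p (sz (u, v))) (io [] [] (wd (F (u, v))) [])"
      using c(3)[of "(u, v)" "[]"] unfolding main_io by simp
    have 3: "run write_word (io [] [] (wd (F (u, v))) []) (22 * length (F (u, v)) + 1)
        (io [] [] [1] (rev (map code (F (u, v)))))"
      using run_write_word[of "[]" "[]" "F (u, v)" "[]" "[]"] by simp
    have 4: "run (read_word 1) (io (rev (map code u)) (rev (map code v)) [] []) (22 * length v + 4)
        (io (rev (map code u)) [] (wd v) [])"
      using run_read_word(2)[of "rev (map code u)" v "[]" "[]"] by simp
    have "run ?rest (io (rev (map code u)) (rev (map code v)) [] [])
      (22 * length v + 4 + (22 * length u + 4 + (3 + (poly p (sz (u, v)) + (22 * length (F (u, v)) + 1)))))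
      (io [] [] [1] (rev (map code (F (u, v)))))"
      by (rule run_Seq[OF 4 run_Seq[OF run_read_word(1) run_Seq[OF 1 run_Seq[OF 2 3 order_refl]
            order_refl] order_refl] order_refl])
    then obtain t where t: "t \<le> 22 * length v + 4 + (22 * length u + 4 + (3 + (poly p (sz (u, v)) +
        (22 * length (F (u, v)) + 1))))"
      "exec ?rest (map stk (io (rev (map code u)) (rev (map code v)) [] [])) t
         (map stk (io [] [] [1] (rev (map code (F (u, v))))))"
      unfolding run_def by blast
    have ex: "exec (init_stacks ;; ?rest) (map word_tape [u, v] @ replicate 5 (word_tape []))
      (3 * ?n + 3 + t) (map stk (io [] [] [1] (rev (map code (F (u, v))))))"
      by (rule exec_Seq[OF exec_init_stacks t(2)[unfolded io_def[of "rev (map code u)"]]])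
    have "length (F (u, v)) \<le> poly p (3 + 6 * ?n)"
      using length_le_sz[of "F (u, v)"] c(2)[of "(u, v)"] le by linarith
    then have "3 * ?n + 3 + t \<le> poly ?p ?n"
      using t(1) le by (simp add: poly_pcompose algebra_simps)
    from com_tm_run[OF ex this, of 7 5]
    show "computes_within ?M [u, v] (F (u, v)) (poly ?p ?n)"
      by (simp add: computes_within_def init_config_def word_tape_stk com_tm_def io_def)
  qed
qed

corollary poly_time_on_pair:
  assumes "pt F" "\<And>x. x \<in> D \<Longrightarrow> inp x = [u x, v x]" "\<And>x. x \<in> D \<Longrightarrow> out x = F (u x, v x)"
  shows "poly_time_on D inp out"
proof -
  obtain M p where M: "wf_tm M \<and> num_tapes M = 7 \<and>
    (\<forall>u v. computes_within M [u, v] (F (u, v)) (poly p (length u + length v)))"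
    using pt_poly_time[OF assms(1)] by blast
  show ?thesis unfolding poly_time_on_def
  proof (intro exI[of _ M] exI[of _ p] conjI ballI)
    show "wf_tm M" using M by blast
    show "computes_within M (inp x) (out x) (poly p (sum_list (map length (inp x))))" if "x \<in> D" for x
      using M assms(2,3)[OF that] by simp
  qed
qed

corollary poly_time_on_single:
  assumes "pt F" "\<And>x. x \<in> D \<Longrightarrow> inp x = [u x]" "\<And>x. x \<in> D \<Longrightarrow> out x = F (u x)"
  shows "poly_time_on D inp out"
proof -
  have "pt (\<lambda>p :: word \<times> word. F (fst p))" by (intro pt_comp[OF assms(1)] pt_intros)
  from pt_poly_time[OF this] obtain M p where M: "wf_tm M \<and> num_tapes M = 7 \<and>
    (\<forall>u v. computes_within M [u, v] (F (fst (u, v))) (poly p (length u + length v)))"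
    by blast
  \<comment> \<open>A missing second input and an empty one give the same tapes.\<close>
  have "init_config M [u, []] = init_config M [u]" for u
    using M by (simp add: init_config_def eval_nat_numeral)
  then have *: "computes_within M [u] (F u) (poly p (length u))" for u
    using conjunct2[OF conjunct2[OF M], rule_format, of u "[]"] M by (simp add: computes_within_def)
  show ?thesis unfolding poly_time_on_def
  proof (intro exI[of _ M] exI[of _ p] conjI ballI)
    show "wf_tm M" using M by blast
    show "computes_within M (inp x) (out x) (poly p (sum_list (map length (inp x))))" if "x \<in> D" for x
      using *[of "u x"] assms(2,3)[OF that] by simp
  qed
qed

section \<open>Rounding by a push-relabel algorithm\<close>

text \<open>A bead is given by its position and the list of its options; an option consists of the index
  of a piece and a node, which is the pair of the colour of the bead and the label of the piece.
  The first option is the chosen one. The height of a node is its multiplicity in a list.\<close>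

type_synonym ('c, 't) bead = "nat \<times> (nat \<times> ('c \<times> 't)) list"

definition cur :: "('c, 't) bead \<Rightarrow> 'c \<times> 't" where
  "cur b = snd (hd (snd b))"

definition load :: "('c, 't) bead list \<Rightarrow> 'c \<times> 't \<Rightarrow> nat" where
  "load S v = length (filter (\<lambda>b. cur b = v) S)"

definition height :: "('c \<times> 't) list \<Rightarrow> 'c \<times> 't \<Rightarrow> nat" where
  "height R v = length (filter (\<lambda>w. w = v) R)"

text \<open>The target of a node is the number of beads of its colour divided by \<open>k\<close>.
  The comparison is multiplied out, so the program needs neither division nor the targets as
  data.\<close>

definition overfull :: "nat \<Rightarrow> ('c, 't) bead list \<Rightarrow> 'c \<times> 't \<Rightarrow> bool" where
  "overfull k S v \<longleftrightarrow> length (filter (\<lambda>b. fst (cur b) = fst v) S) < k * load S v"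

definition lower :: "('c \<times> 't) list \<Rightarrow> ('c, 't) bead \<Rightarrow> (nat \<times> ('c \<times> 't)) list" where
  "lower R b = filter (\<lambda>q. height R (snd q) < height R (cur b)) (snd b)"

definition push_bead :: "('c \<times> 't) list \<Rightarrow> ('c, 't) bead \<Rightarrow> ('c, 't) bead" where
  "push_bead R b = (fst b, hd (lower R b) # filter (\<lambda>q. q \<noteq> hd (lower R b)) (snd b))"

definition pushable :: "nat \<Rightarrow> ('c, 't) bead list \<Rightarrow> ('c \<times> 't) list \<Rightarrow> ('c, 't) bead \<Rightarrow> bool" where
  "pushable k S R b \<longleftrightarrow> overfull k S (cur b) \<and> lower R b \<noteq> []"

text \<open>Replacing all beads equal to \<open>b\<close> changes a single one when positions are
  distinct. A state without overfull nodes is a fixed point, so the program may run for a fixed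
  number of rounds.\<close>

definition step :: "nat \<Rightarrow> ('c, 't) bead list \<times> ('c \<times> 't) list \<Rightarrow> ('c, 't) bead list \<times> ('c \<times> 't) list" where
  "step k s = (case filter (pushable k (fst s) (snd s)) (fst s) of
      b # _ \<Rightarrow> (map (\<lambda>x. if x = b then push_bead (snd s) x else x) (fst s), snd s)
    | [] \<Rightarrow> (case filter (\<lambda>b. overfull k (fst s) (cur b)) (fst s) of
        b # _ \<Rightarrow> (fst s, cur b # snd s)
      | [] \<Rightarrow> s))"

lemma sum_list_less:
  assumes "\<And>x. x \<in> set xs \<Longrightarrow> f x \<le> (g x :: nat)" "b \<in> set xs" "f b < g b"
  shows "(\<Sum>x\<leftarrow>xs. f x) < (\<Sum>x\<leftarrow>xs. g x)"
  using assms
proof (induction xs)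
  case (Cons a xs)
  have "(\<Sum>x\<leftarrow>xs. f x) \<le> (\<Sum>x\<leftarrow>xs. g x)" by (rule sum_list_mono) (use Cons in auto)
  moreover have "b \<noteq> a \<Longrightarrow> (\<Sum>x\<leftarrow>xs. f x) < (\<Sum>x\<leftarrow>xs. g x)" using Cons by auto
  ultimately show ?case using Cons.prems(1)[of a] Cons.prems(3) by (cases "b = a") auto
qed simp

lemma length_filter_mono:
  "(\<And>x. x \<in> set xs \<Longrightarrow> P x \<Longrightarrow> Q x) \<Longrightarrow> length (filter P xs) \<le> length (filter Q xs)"
  by (induction xs) auto

lemma length_filter_remove:
  "distinct xs \<Longrightarrow> length (filter P xs) \<le> Suc (length (filter (\<lambda>x. P x \<and> x \<noteq> b) xs))"
proof (induction xs)
  case (Cons a xs)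
  show ?case
  proof (cases "a = b")
    case True
    then have "filter (\<lambda>x. P x \<and> x \<noteq> b) xs = filter P xs"
      using Cons.prems by (intro filter_cong) auto
    then show ?thesis using True by auto
  qed (use Cons in auto)
qed simp

lemma sum_load:
  "finite U \<Longrightarrow> (\<Sum>u\<in>U. load S u) = length (filter (\<lambda>b. cur b \<in> U) S)"
  unfolding load_def
proof (induction S)
  case (Cons b S)
  have "(\<Sum>u\<in>U. length (filter (\<lambda>b. cur b = u) (b # S))) =
    (\<Sum>u\<in>U. (if u = cur b then 1 else 0) + length (filter (\<lambda>b. cur b = u) S))"
    by (rule sum.cong) auto
  also have "\<dots> = (if cur b \<in> U then 1 else 0) + length (filter (\<lambda>b. cur b \<in> U) S)"
    using Cons by (simp add: sum.distrib)
  finally show ?case by simp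
qed simp

text \<open>\<open>x i t\<close> is the fraction of bead \<open>i\<close> that lies in part
  \<open>t\<close>; where it is positive, \<open>t\<close> is an option of the bead.
  \<open>k * \<delta> < 1\<close> keeps the total excess over all nodes of one colour below a single
  bead.\<close>

locale fractional_assignment =
  fixes S0 :: "('c, 't) bead list" and C :: "'c set" and T :: "'t set" and k :: nat
    and \<alpha> :: "'c \<Rightarrow> nat" and colour :: "nat \<Rightarrow> 'c" and x :: "nat \<Rightarrow> 't \<Rightarrow> real" and \<delta> :: real
  assumes fin: "finite C" "finite T" and k: "card T = k"
    and dist: "distinct (map fst S0)"
    and opts: "\<And>b. b \<in> set S0 \<Longrightarrow> snd b \<noteq> []"
      "\<And>b q. b \<in> set S0 \<Longrightarrow> q \<in> set (snd b) \<Longrightarrow> fst (snd q) = colour (fst b) \<and> snd (snd q) \<in> T"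
      "\<And>b. b \<in> set S0 \<Longrightarrow> colour (fst b) \<in> C"
    and x_nonneg: "\<And>i t. 0 \<le> x i t"
    and x_sum: "\<And>b. b \<in> set S0 \<Longrightarrow> (\<Sum>t\<in>T. x (fst b) t) = 1"
    and x_pos: "\<And>b t. b \<in> set S0 \<Longrightarrow> t \<in> T \<Longrightarrow> x (fst b) t > 0 \<Longrightarrow> (\<exists>q\<in>set (snd b). snd (snd q) = t)"
    and x_load: "\<And>c t. c \<in> C \<Longrightarrow> t \<in> T \<Longrightarrow>
      (\<Sum>i\<in>{i \<in> fst ` set S0. colour i = c}. x i t) \<le> real (\<alpha> c) + \<delta>"
    and \<delta>: "0 \<le> \<delta>" "real k * \<delta> < 1"
    and total: "\<And>c. c \<in> C \<Longrightarrow> length (filter (\<lambda>b. colour (fst b) = c) S0) = k * \<alpha> c"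
begin

definition same :: "('c, 't) bead list \<Rightarrow> bool" where
  "same S \<longleftrightarrow> list_all2 (\<lambda>b b0. fst b = fst b0 \<and> set (snd b) = set (snd b0)) S S0"

lemma same_fst: "same S \<Longrightarrow> map fst S = map fst S0"
  unfolding same_def by (induction rule: list_all2_induct) auto

lemma same_dist: "same S \<Longrightarrow> distinct (map fst S)"
  using same_fst dist by simp

lemma same_ex: "same S \<Longrightarrow> b \<in> set S \<Longrightarrow> \<exists>b0\<in>set S0. fst b = fst b0 \<and> set (snd b) = set (snd b0)"
  by (auto simp: same_def list_all2_conv_all_nth in_set_conv_nth intro!: bexI[OF _ nth_mem])

lemma same_opts:
  assumes "same S" "b \<in> set S"
  shows "snd b \<noteq> []" "q \<in> set (snd b) \<Longrightarrow> fst (snd q) = colour (fst b) \<and> snd (snd q) \<in> T"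
    "colour (fst b) \<in> C" "(\<Sum>t\<in>T. x (fst b) t) = 1"
    "t \<in> T \<Longrightarrow> x (fst b) t > 0 \<Longrightarrow> \<exists>q\<in>set (snd b). snd (snd q) = t"
    "fst (cur b) = colour (fst b)" "snd (cur b) \<in> T"
proof -
  obtain b0 where b0: "b0 \<in> set S0" "fst b = fst b0" "set (snd b) = set (snd b0)"
    using same_ex[OF assms] by blast
  show 1: "snd b \<noteq> []" using opts(1)[OF b0(1)] b0(3) by auto
  show 2: "fst (snd q) = colour (fst b) \<and> snd (snd q) \<in> T" if "q \<in> set (snd b)" for q
    using opts(2)[OF b0(1), of q] b0 that by simp
  show "colour (fst b) \<in> C" "(\<Sum>t\<in>T. x (fst b) t) = 1"
    using opts(3)[OF b0(1)] x_sum[OF b0(1)] b0 by simp_all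
  show "t \<in> T \<Longrightarrow> x (fst b) t > 0 \<Longrightarrow> \<exists>q\<in>set (snd b). snd (snd q) = t"
    using x_pos[OF b0(1)] b0 by simp
  show "fst (cur b) = colour (fst b)" "snd (cur b) \<in> T"
    using 2[of "hd (snd b)"] 1 by (simp_all add: cur_def)
qed

lemma same_colour_count:
  assumes "same S" "c \<in> C"
  shows "length (filter (\<lambda>b. fst (cur b) = c) S) = k * \<alpha> c"
proof -
  have "length (filter (\<lambda>b. fst (cur b) = c) S) = length (filter (\<lambda>b. colour (fst b) = c) S)"
    using same_opts(6)[OF assms(1)] by (intro arg_cong[of _ _ length] filter_cong) simp_all
  also have "\<dots> = length (filter (\<lambda>i. colour i = c) (map fst S))"
    by (simp add: filter_map comp_def)
  also have "\<dots> = length (filter (\<lambda>b. colour (fst b) = c) S0)"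
    by (simp add: same_fst[OF assms(1)] filter_map comp_def)
  finally show ?thesis using total[OF assms(2)] by simp
qed

lemma overfull_iff:
  assumes "same S" "fst v \<in> C"
  shows "overfull k S v \<longleftrightarrow> \<alpha> (fst v) < load S v"
proof (cases "k = 0")
  case True
  then have "T = {}" using k fin by simp
  then have "S = []" using same_opts(7)[OF assms(1)] by (cases S) auto
  then show ?thesis by (simp add: overfull_def load_def)
next
  case False
  then show ?thesis by (simp add: overfull_def same_colour_count[OF assms])
qed

text \<open>The counting inequality of Hall's theorem: the fractions of the beads assigned to \<open>U\<close> lie
  entirely in \<open>U\<close>.\<close>

lemma no_closed_overload:
  assumes S: "same S" and U: "U \<subseteq> {c} \<times> T" "c \<in> C"
    and closed: "\<And>b q. b \<in> set S \<Longrightarrow> cur b \<in> U \<Longrightarrow> q \<in> set (snd b) \<Longrightarrow> snd q \<in> U"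
    and full: "\<And>u. u \<in> U \<Longrightarrow> \<alpha> c \<le> load S u" and v: "v \<in> U" "\<alpha> c < load S v"
  shows False
proof -
  have finU: "finite U" using U fin finite_subset by blast
  define F where "F = {b \<in> set S. cur b \<in> U}"
  define T' where "T' = {t \<in> T. (c, t) \<in> U}"
  have finT': "finite T'" using fin by (simp add: T'_def)
  have "U = Pair c ` T'" using U by (auto simp: T'_def)
  then have cardU: "card U = card T'" by (simp add: card_image inj_on_def)
  have "distinct S" using same_dist[OF S] by (simp add: distinct_map)
  then have cardF: "length (filter (\<lambda>b. cur b \<in> U) S) = card F"
    using distinct_card[OF distinct_filter, of S "\<lambda>b. cur b \<in> U"] by (simp add: F_def)
  have "card U * \<alpha> c < (\<Sum>u\<in>U. load S u)"
    using sum_strict_mono_ex1[OF finU, of "\<lambda>_. \<alpha> c" "load S"] full v by auto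
  \<comment> \<open>Integrality: a strict inequality between integers holds by at least one, whereas
    the fractional count below gains less than one.\<close>
  then have "Suc (card U * \<alpha> c) \<le> card F" using sum_load[OF finU] cardF by simp
  then have big: "real (card U) * real (\<alpha> c) + 1 \<le> real (card F)"
    by (metis of_nat_Suc of_nat_le_iff of_nat_mult add.commute)
  have inj: "inj_on fst F"
    using same_dist[OF S] by (auto simp: F_def distinct_map intro: inj_on_subset)
  \<comment> \<open>A positive fraction outside \<open>T'\<close> would yield an option outside
    \<open>U\<close>, against \<open>closed\<close>.\<close>
  have one: "(\<Sum>t\<in>T'. x (fst b) t) = 1" if b: "b \<in> F" for b
  proof -
    have bS: "b \<in> set S" "cur b \<in> U" using b by (auto simp: F_def)
    have "x (fst b) t = 0" if t: "t \<in> T - T'" for t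
    proof (rule ccontr)
      assume "x (fst b) t \<noteq> 0"
      then have "x (fst b) t > 0" using x_nonneg[of "fst b" t] by simp
      with same_opts(5)[OF S bS(1)] t obtain q where q: "q \<in> set (snd b)" "snd (snd q) = t" by blast
      have "snd q \<in> U" using closed[OF bS q(1)] .
      with q U(1) have "(c, t) \<in> U" by (cases "snd q") auto
      with t show False by (simp add: T'_def)
    qed
    then have "(\<Sum>t\<in>T'. x (fst b) t) = (\<Sum>t\<in>T. x (fst b) t)"
      by (intro sum.mono_neutral_left) (auto simp: fin T'_def)
    then show ?thesis using same_opts(4)[OF S bS(1)] by simp
  qed
  have FI: "fst ` F \<subseteq> {i \<in> fst ` set S0. colour i = c}"
  proof
    fix i assume "i \<in> fst ` F"
    then obtain b where b: "b \<in> set S" "cur b \<in> U" "i = fst b" by (auto simp: F_def)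
    have "fst (cur b) = c" using b(2) U(1) by auto
    then have "colour i = c" using same_opts(6)[OF S b(1)] b(3) by simp
    moreover have "i \<in> set (map fst S)" using b by simp
    then have "i \<in> fst ` set S0" using same_fst[OF S] by simp
    ultimately show "i \<in> {i \<in> fst ` set S0. colour i = c}" by simp
  qed
  have "real (card F) = (\<Sum>b\<in>F. \<Sum>t\<in>T'. x (fst b) t)" using one by simp
  also have "\<dots> = (\<Sum>i\<in>fst ` F. \<Sum>t\<in>T'. x i t)" by (simp add: sum.reindex[OF inj])
  also have "\<dots> \<le> (\<Sum>i\<in>{i \<in> fst ` set S0. colour i = c}. \<Sum>t\<in>T'. x i t)"
    by (rule sum_mono2) (use FI x_nonneg in \<open>auto intro: sum_nonneg\<close>)
  also have "\<dots> = (\<Sum>t\<in>T'. \<Sum>i\<in>{i \<in> fst ` set S0. colour i = c}. x i t)" by (rule sum.swap)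
  also have "\<dots> \<le> (\<Sum>t\<in>T'. real (\<alpha> c) + \<delta>)"
    by (rule sum_mono) (use x_load[OF U(2)] in \<open>auto simp: T'_def\<close>)
  also have "\<dots> = real (card T') * real (\<alpha> c) + real (card T') * \<delta>" by (simp add: algebra_simps)
  also have "real (card T') * \<delta> \<le> real k * \<delta>"
    using \<delta>(1) card_mono[OF fin(2), of T'] k by (intro mult_right_mono) (auto simp: T'_def)
  finally show False using big \<delta>(2) cardU by simp
qed

text \<open>A valid labelling in the sense of push-relabel: no residual arc descends by more than
  one level, and deficient nodes stay on the level of the sinks. A gap in the heights thus separates
  the nodes above it from every deficient node.\<close>

definition inv :: "('c, 't) bead list \<times> ('c \<times> 't) list \<Rightarrow> bool" where
  "inv s \<longleftrightarrow> same (fst s) \<and>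
     (\<forall>b\<in>set (fst s). \<forall>q\<in>set (snd b). height (snd s) (cur b) \<le> Suc (height (snd s) (snd q))) \<and>
     (\<forall>v\<in>C \<times> T. load (fst s) v < \<alpha> (fst v) \<longrightarrow> height (snd s) v = 0) \<and>
     (\<forall>v. height (snd s) v \<le> k)"

text \<open>If no node of the same colour had height \<open>g\<close>, the nodes above this gap would violate
  \<open>no_closed_overload\<close>; hence all heights below that of an overfull node are attained.\<close>

lemma overfull_height:
  assumes inv: "inv (S, R)" and v: "v \<in> C \<times> T" "\<alpha> (fst v) < load S v"
  shows "height R v < k"
proof -
  let ?c = "fst v"
  have S: "same S" using inv by (simp add: inv_def)
  have "\<exists>u\<in>{?c} \<times> T. height R u = g" if g: "g < height R v" for g
  proof (rule ccontr)
    assume none: "\<not> ?thesis"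
    let ?U = "{u \<in> {?c} \<times> T. g < height R u}"
    show False
    proof (rule no_closed_overload[OF S, of ?U ?c v])
      fix b q assume b: "b \<in> set S" "cur b \<in> ?U" "q \<in> set (snd b)"
      \<comment> \<open>From above \<open>g\<close>, a descent by at most one level ends at
        \<open>g\<close> or higher, and level \<open>g\<close> is empty.\<close>
      have "height R (cur b) \<le> Suc (height R (snd q))" using inv b by (auto simp: inv_def)
      then have "g \<le> height R (snd q)" using b(2) by auto
      moreover have "snd q \<in> {?c} \<times> T"
        using same_opts(2)[OF S b(1,3)] same_opts(6)[OF S b(1)] b(2) by (cases "snd q") auto
      moreover from this have "height R (snd q) \<noteq> g" using none by auto
      ultimately show "snd q \<in> ?U" by simp
    next
      fix u assume "u \<in> ?U"
      then have "height R u \<noteq> 0" "fst u = ?c" "u \<in> C \<times> T" using v by auto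
      then show "\<alpha> ?c \<le> load S u" using inv by (force simp: inv_def not_less[symmetric])
    qed (use v g in auto)
  qed
  \<comment> \<open>These are \<open>Suc (height R v)\<close> values attained on \<open>k\<close>
    nodes, whence the strict bound.\<close>
  then have "{..height R v} \<subseteq> height R ` ({?c} \<times> T)"
    using v by (cases v) (force simp: le_less)
  then have "card {..height R v} \<le> card (height R ` ({?c} \<times> T))"
    by (rule card_mono[rotated]) (simp add: fin)
  also have "\<dots> \<le> card ({?c} \<times> T)" by (rule card_image_le) (simp add: fin)
  also have "\<dots> = k" by (simp add: k card_cartesian_product)
  finally show ?thesis by simp
qed

text \<open>A lexicographic order as a single number. A push lowers the second sum; raising a node
  increases it by at most the number of beads but lowers the first sum, whose weight is one more
  than that number.\<close>

definition potential :: "('c, 't) bead list \<times> ('c \<times> 't) list \<Rightarrow> nat" where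
  "potential s = Suc (length (fst s)) * (\<Sum>v\<in>C \<times> T. k - height (snd s) v) +
     (\<Sum>b\<leftarrow>fst s. height (snd s) (cur b))"

definition quiet :: "('c, 't) bead list \<times> ('c \<times> 't) list \<Rightarrow> bool" where
  "quiet s \<longleftrightarrow> (\<forall>b\<in>set (fst s). \<not> overfull k (fst s) (cur b))"

lemma height_Cons: "height (v # R) u = height R u + (if u = v then 1 else 0)"
  by (simp add: height_def)

lemma step_quiet: "quiet s \<Longrightarrow> step k s = s"
  by (simp add: step_def quiet_def pushable_def cong: filter_cong split: list.splits)

lemma cur_node: "same S \<Longrightarrow> b \<in> set S \<Longrightarrow> cur b \<in> C \<times> T"
  using same_opts(3,6,7) by (metis mem_Times_iff)

lemma step_active:
  assumes inv: "inv s" and nq: "\<not> quiet s"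
  shows "inv (step k s) \<and> potential (step k s) < potential s"
proof -
  obtain S R where s: "s = (S, R)" by (cases s)
  have S: "same S" using inv s by (simp add: inv_def)
  have I1: "\<And>b q. b \<in> set S \<Longrightarrow> q \<in> set (snd b) \<Longrightarrow> height R (cur b) \<le> Suc (height R (snd q))"
    and I2: "\<And>v. v \<in> C \<times> T \<Longrightarrow> load S v < \<alpha> (fst v) \<Longrightarrow> height R v = 0"
    and I3: "\<And>v. height R v \<le> k"
    using inv by (auto simp: inv_def s)
  show ?thesis
  proof (cases "filter (pushable k S R) S")
    case (Cons b bs)
    then have "b \<in> set (filter (pushable k S R) S)" by simp
    then have b: "b \<in> set S" "pushable k S R b" by simp_all
    define g where "g = (\<lambda>x. if x = b then push_bead R x else x)"
    have st: "step k s = (map g S, R)" by (simp add: step_def s Cons g_def)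
    let ?o = "hd (lower R b)"
    have "?o \<in> set (lower R b)" using b(2) by (simp add: pushable_def)
    then have o: "?o \<in> set (snd b)" "height R (snd ?o) < height R (cur b)"
      by (simp_all add: lower_def)
    have gb: "cur (g b) = snd ?o" "set (snd (g b)) = set (snd b)" "fst (g b) = fst b"
      using o(1) by (auto simp: g_def push_bead_def cur_def)
    have g_other: "g y = y" if "y \<noteq> b" for y using that by (simp add: g_def)
    have g_set: "set (snd (g y)) = set (snd y)" "fst (g y) = fst y" for y
      using gb g_other[of y] by (cases "y = b"; simp)+
    have S': "same (map g S)"
      using S unfolding same_def list_all2_map1 by (rule list_all2_mono) (simp add: g_set)
    have ov: "\<alpha> (fst (cur b)) < load S (cur b)"
      using b cur_node[OF S b(1)] overfull_iff[OF S, of "cur b"] by (auto simp: pushable_def)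
    have "inv (map g S, R)" unfolding inv_def fst_conv snd_conv
    proof (intro conjI ballI allI impI S' I3)
      fix y q assume y: "y \<in> set (map g S)" "q \<in> set (snd y)"
      then obtain z where z: "z \<in> set S" "y = g z" by auto
      show "height R (cur y) \<le> Suc (height R (snd q))"
      proof (cases "z = b")
        case True
        then show ?thesis using I1[OF b(1), of q] y z gb o(2) by simp
      next
        case False
        then show ?thesis using I1[OF z(1), of q] y z g_other by simp
      qed
    next
      fix v assume v: "v \<in> C \<times> T" "load (map g S) v < \<alpha> (fst v)"
      show "height R v = 0"
      proof (cases "v = cur b")
        case True
        \<comment> \<open>The bead leaves an overfull node, which still keeps at least its target,
          so this node cannot become deficient.\<close>
        have "distinct S" using same_dist[OF S] by (simp add: distinct_map)
        from length_filter_remove[OF this, of "\<lambda>y. cur y = v" b]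
        have "load S v \<le> Suc (length (filter (\<lambda>y. cur y = v \<and> y \<noteq> b) S))" by (simp add: load_def)
        also have "length (filter (\<lambda>y. cur y = v \<and> y \<noteq> b) S) \<le> load (map g S) v"
          unfolding load_def filter_map length_map
          by (rule length_filter_mono) (use g_other in auto)
        finally show ?thesis using ov v(2) True by simp
      next
        case False
        have "load S v \<le> load (map g S) v"
          unfolding load_def filter_map length_map
        proof (rule length_filter_mono)
          fix y assume "cur y = v"
          then show "((\<lambda>b. cur b = v) \<circ> g) y" using g_other[of y] False by (cases "y = b") auto
        qed
        then show ?thesis using I2[OF v(1)] v(2) by simp
      qed
    qed
    moreover have "(\<Sum>y\<leftarrow>S. height R (cur (g y))) < (\<Sum>y\<leftarrow>S. height R (cur y))"
      by (rule sum_list_less[OF _ b(1)]) (use gb(1) o(2) g_other in \<open>auto simp: g_def less_imp_le\<close>)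
    then have "potential (map g S, R) < potential (S, R)"
      by (simp add: potential_def comp_def)
    ultimately show ?thesis unfolding st by (simp add: s)
  next
    case Nil
    obtain b bs where bs: "filter (\<lambda>b. overfull k S (cur b)) S = b # bs"
      using nq by (cases "filter (\<lambda>b. overfull k S (cur b)) S") (auto simp: quiet_def s filter_empty_conv)
    then have "b \<in> set (filter (\<lambda>b. overfull k S (cur b)) S)" by simp
    then have b: "b \<in> set S" "overfull k S (cur b)" by simp_all
    let ?v = "cur b"
    have st: "step k s = (S, ?v # R)" by (simp add: step_def s Nil bs)
    have node: "?v \<in> C \<times> T" using cur_node[OF S b(1)] .
    have ov: "\<alpha> (fst ?v) < load S ?v"
      using b node overfull_iff[OF S, of ?v] by auto
    have lt: "height R ?v < k" using overfull_height[OF inv[unfolded s] node ov] .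
    have "inv (S, ?v # R)" unfolding inv_def fst_conv snd_conv
    proof (intro conjI ballI allI impI S)
      fix y q assume y: "y \<in> set S" "q \<in> set (snd y)"
      show "height (?v # R) (cur y) \<le> Suc (height (?v # R) (snd q))"
      proof (cases "cur y = ?v")
        case True
        \<comment> \<open>A node is raised only when no bead is pushable. Hence the options of its
          beads are at least as high, and raising it by one keeps the labelling valid.\<close>
        have "\<not> pushable k S R y" using Nil y(1) by (metis filter_empty_conv)
        then have "lower R y = []" using True b(2) by (simp add: pushable_def)
        then have "height R (cur y) \<le> height R (snd q)"
          using y(2) by (auto simp: lower_def filter_empty_conv not_less)
        then show ?thesis using True by (simp add: height_Cons)
      next
        case False
        then show ?thesis using I1[OF y] by (simp add: height_Cons)
      qed
    next
      fix v assume v: "v \<in> C \<times> T" "load S v < \<alpha> (fst v)"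
      then show "height (?v # R) v = 0" using I2[OF v] ov by (auto simp: height_Cons)
    next
      fix v show "height (?v # R) v \<le> k" using I3[of v] lt by (auto simp: height_Cons)
    qed
    moreover have "potential (S, ?v # R) < potential (S, R)"
    proof -
      have "(\<Sum>u\<in>C \<times> T. k - height (?v # R) u) < (\<Sum>u\<in>C \<times> T. k - height R u)"
        by (rule sum_strict_mono_ex1) (use fin node lt in \<open>auto simp: height_Cons intro!: bexI[of _ ?v]\<close>)
      then have "Suc (length S) * Suc (\<Sum>u\<in>C \<times> T. k - height (?v # R) u)
          \<le> Suc (length S) * (\<Sum>u\<in>C \<times> T. k - height R u)"
        by (intro mult_le_mono2) simp
      moreover have "(\<Sum>y\<leftarrow>S. height (?v # R) (cur y)) \<le> (\<Sum>y\<leftarrow>S. height R (cur y)) + length S"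
        by (induction S) (auto simp: height_Cons)
      ultimately show ?thesis by (simp add: potential_def)
    qed
    ultimately show ?thesis unfolding st by (simp add: s)
  qed
qed

lemma inv_init: "inv (S0, [])"
  by (simp add: inv_def height_def same_def list_all2_same)

lemma iterate:
  "inv ((step k ^^ n) (S0, [])) \<and>
    (quiet ((step k ^^ n) (S0, [])) \<or> potential ((step k ^^ n) (S0, [])) + n \<le> potential (S0, []))"
proof (induction n)
  case 0
  then show ?case using inv_init by simp
next
  case (Suc n)
  let ?s = "(step k ^^ n) (S0, [])"
  show ?case
  proof (cases "quiet ?s")
    case True
    then show ?thesis using Suc step_quiet[OF True] by simp
  next
    case False
    then show ?thesis using Suc step_active[of ?s] by force
  qed
qed

text \<open>The bound on \<open>n\<close> is the initial potential: all heights are 0, so each of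
  the \<open>card C * k\<close> nodes contributes \<open>k\<close>. In a quiet state no load exceeds
  its target; as the loads of a colour add up to \<open>k\<close> times the target, all are
  exact.\<close>

theorem push_relabel:
  assumes "n > Suc (length S0) * (card C * k * k)"
    and S: "S = fst ((step k ^^ n) (S0, []))"
  shows "same S" "\<And>c t. c \<in> C \<Longrightarrow> t \<in> T \<Longrightarrow> load S (c, t) = \<alpha> c"
proof -
  let ?s = "(step k ^^ n) (S0, [])"
  have "potential (S0, []) = Suc (length S0) * (card C * k * k)"
    by (simp add: potential_def height_def card_cartesian_product k)
  then have quiet: "quiet ?s" and inv: "inv ?s" using iterate[of n] assms(1) by auto
  show same: "same S" using inv by (simp add: inv_def S)
  fix c t assume c: "c \<in> C" and t: "t \<in> T"
  have le: "load S (c, u) \<le> \<alpha> c" if u: "u \<in> T" for u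
  proof (rule ccontr)
    assume gt: "\<not> ?thesis"
    then have "filter (\<lambda>b. cur b = (c, u)) S \<noteq> []" unfolding load_def by force
    then obtain b where "b \<in> set S" "cur b = (c, u)" by (auto simp: filter_empty_conv)
    then have "\<not> overfull k S (c, u)" using quiet by (auto simp: quiet_def S)
    then show False using gt overfull_iff[OF same, of "(c, u)"] c by simp
  qed
  have "(\<Sum>u\<in>T. load S (c, u)) = (\<Sum>v\<in>Pair c ` T. load S v)"
    by (simp add: sum.reindex inj_on_def)
  also have "\<dots> = length (filter (\<lambda>b. cur b \<in> Pair c ` T) S)"
    by (rule sum_load) (simp add: fin)
  also have "filter (\<lambda>b. cur b \<in> Pair c ` T) S = filter (\<lambda>b. fst (cur b) = c) S"
    using cur_node[OF same] by (intro filter_cong) force+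
  also have "length \<dots> = (\<Sum>u\<in>T. \<alpha> c)" using same_colour_count[OF same c] k by simp
  finally have sum: "(\<Sum>u\<in>T. load S (c, u)) = (\<Sum>u\<in>T. \<alpha> c)" .
  show "load S (c, t) = \<alpha> c"
  proof (rule ccontr)
    assume "\<not> ?thesis"
    then have "load S (c, t) < \<alpha> c" using le[OF t] by simp
    then have "(\<Sum>u\<in>T. load S (c, u)) < (\<Sum>u\<in>T. \<alpha> c)"
      using le t fin by (intro sum_strict_mono_ex1) auto
    then show False using sum by simp
  qed
qed

end

section \<open>Running time of the push-relabel algorithm\<close>

lemma pt_cur [pt_intros]: "pt f \<Longrightarrow> pt (\<lambda>x. cur (f x))"
  unfolding cur_def by (intro pt_intros)

lemma pt_load [pt_intros]:
  assumes "pt f" "pt g" shows "pt (\<lambda>x. load (f x) (g x))"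
  unfolding load_def by (intro pt_intros assms pt_comp[OF assms(2)])

lemma pt_height [pt_intros]:
  assumes "pt f" "pt g" shows "pt (\<lambda>x. height (f x) (g x))"
  unfolding height_def by (intro pt_intros assms pt_comp[OF assms(2)])

lemma pt_overfull [pt_intros]:
  assumes "pt k" "pt f" "pt g" shows "pt (\<lambda>x. overfull (k x) (f x) (g x))"
  unfolding overfull_def by (intro pt_intros assms pt_comp[OF assms(3)])

lemma pt_lower [pt_intros]:
  assumes "pt f" "pt g" shows "pt (\<lambda>x. lower (f x) (g x))"
  unfolding lower_def by (intro pt_intros assms pt_comp[OF assms(1)] pt_comp[OF assms(2)])

lemma pt_push_bead [pt_intros]:
  assumes "pt f" "pt g" shows "pt (\<lambda>x. push_bead (f x) (g x))"
  unfolding push_bead_def by (intro pt_intros assms pt_comp[OF assms(1)] pt_comp[OF assms(2)])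

lemma pt_pushable [pt_intros]:
  assumes "pt k" "pt f" "pt g" "pt h" shows "pt (\<lambda>x. pushable (k x) (f x) (g x) (h x))"
  unfolding pushable_def by (intro pt_intros assms)

lemma pt_step [pt_intros]:
  assumes "pt k" "pt f" shows "pt (\<lambda>x. step (k x) (f x))"
  unfolding step_def by (intro pt_intros assms pt_comp[OF assms(1)] pt_comp[OF assms(2)])

lemma sz_move_front: "q \<in> set xs \<Longrightarrow> sz (q # filter (\<lambda>y. y \<noteq> q) xs) \<le> sz xs"
proof (induction xs)
  case (Cons y ys)
  show ?case
  proof (cases "y = q")
    case True
    then show ?thesis using sz_filter[of "\<lambda>y. y \<noteq> q" ys] by simp
  qed (use Cons in auto)
qed simp

lemma sz_push_bead: "lower R b \<noteq> [] \<Longrightarrow> sz (push_bead R b) \<le> sz b"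
proof -
  assume "lower R b \<noteq> []"
  then have "hd (lower R b) \<in> set (lower R b)" by simp
  then have "hd (lower R b) \<in> set (snd b)" by (simp add: lower_def)
  from sz_move_front[OF this] show ?thesis
    by (cases b) (simp add: push_bead_def)
qed

lemma sz_snd: "sz (snd p) \<le> sz p"
  by (cases p) simp

text \<open>The second summand is the constant size of the unspecified value that \<open>cur\<close>
  takes on a bead without options.\<close>

lemma sz_cur:
  fixes b :: "('c::encodable, 't::encodable) bead"
  shows "sz (cur b) \<le> sz b + sz (snd (hd ([] :: (nat \<times> 'c \<times> 't) list)))"
proof (cases "snd b")
  case (Cons q qs)
  then show ?thesis using sz_snd[of b] sz_snd[of q] by (simp add: cur_def)
qed (simp add: cur_def)

lemma sz_map_le: "(\<And>x. x \<in> set xs \<Longrightarrow> sz (g x) \<le> sz x) \<Longrightarrow> sz (map g xs) \<le> sz xs"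
  by (induction xs) (auto intro: add_mono)

text \<open>A push moves an option to the front and never enlarges a bead; raising adds one node to
  the list of heights. The growth is thus linear in the number of rounds, as
  \<open>pt_funpow\<close> requires.\<close>

lemma sz_step:
  fixes s :: "('c::encodable, 't::encodable) bead list \<times> ('c \<times> 't) list"
  shows "sz (fst (step k s)) \<le> sz (fst s)"
    and "sz (snd (step k s)) \<le> sz (snd s) + sz (fst s) + sz (snd (hd ([] :: (nat \<times> 'c \<times> 't) list))) + 1"
proof -
  have *: "b \<in> set (fst s) \<and> P b" if "filter P (fst s) = b # bs" for P b bs
  proof -
    have "b \<in> set (filter P (fst s))" using that by simp
    then show ?thesis by simp
  qed
  show "sz (fst (step k s)) \<le> sz (fst s)"
  proof (cases "filter (pushable k (fst s) (snd s)) (fst s)")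
    case Nil
    then show ?thesis by (simp add: step_def split: list.splits)
  next
    case (Cons b bs)
    then have "lower (snd s) b \<noteq> []" using *[OF Cons] by (simp add: pushable_def)
    then have "sz (map (\<lambda>x. if x = b then push_bead (snd s) x else x) (fst s)) \<le> sz (fst s)"
      by (intro sz_map_le) (simp add: sz_push_bead)
    then show ?thesis by (simp add: step_def Cons)
  qed
  have "sz (cur b) \<le> sz (fst s) + sz (snd (hd ([] :: (nat \<times> 'c \<times> 't) list)))" if "b \<in> set (fst s)" for b
    using sz_cur[of b] sz_member[OF that] by simp
  then show "sz (snd (step k s)) \<le> sz (snd s) + sz (fst s) + sz (snd (hd ([] :: (nat \<times> 'c \<times> 't) list))) + 1"
    unfolding step_def by (fastforce split: list.splits dest!: *)
qed

lemma pt_step_iterate [pt_intros]: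
  fixes S :: "'a::encodable \<Rightarrow> ('c::encodable, 't::encodable) bead list"
  assumes "pt k" "pt n" "pt S"
  shows "pt (\<lambda>x. (step (k x) ^^ n x) (S x, []))"
proof (rule pt_funpow)
  let ?D = "sz (snd (hd ([] :: (nat \<times> 'c \<times> 't) list))) + 1"
  show "pt (\<lambda>p. step (k (fst p)) (snd p))" by (intro pt_intros pt_comp[OF assms(1)])
  show "pt (\<lambda>x. (S x, [] :: ('c \<times> 't) list))" by (intro pt_intros assms)
  show "bdd (\<lambda>x. sz (S x) + (n x * (sz (S x) + ?D) + 2))"
    by (intro bdd_intros bdd_nat assms)
  fix x i assume i: "i \<le> n x"
  have "sz (fst ((step (k x) ^^ i) (S x, []))) \<le> sz (S x) \<and>
     sz (snd ((step (k x) ^^ i) (S x, []))) \<le> i * (sz (S x) + ?D) + 1"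
  proof (induction i)
    case (Suc i)
    then show ?case using sz_step[of "k x" "(step (k x) ^^ i) (S x, [])"] by auto
  qed simp
  moreover have "i * (sz (S x) + ?D) \<le> n x * (sz (S x) + ?D)" using i by (rule mult_right_mono) simp
  ultimately show "sz ((step (k x) ^^ i) (S x, [])) \<le> sz (S x) + (n x * (sz (S x) + ?D) + 2)"
    by (cases "(step (k x) ^^ i) (S x, [])") simp
qed (rule assms)


section \<open>Programs on words\<close>

text \<open>The parser collects the bits of every closed bracket together with its nesting depth.\<close>

definition parse_step :: "nat \<times> word \<times> (nat \<times> word) list \<Rightarrow> symbol \<Rightarrow> nat \<times> word \<times> (nat \<times> word) list" where
  "parse_step a s = (if s = Open then (Suc (fst a), [], snd (snd a))
     else if s = Close then (fst a - 1, [], snd (snd a) @ [(fst a, fst (snd a))])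
     else (fst a, fst (snd a) @ [s], snd (snd a)))"

definition parse :: "word \<Rightarrow> (nat \<times> word) list" where
  "parse w = snd (snd (foldl parse_step (0, [], []) w))"

lemma sz_symbol: "sz (s :: symbol) \<le> 5"
  by (cases s) (simp_all add: sz_def wd_symbol)

lemma sz_snoc: "sz (xs @ [y]) = sz xs + Suc (sz y)"
  using sz_append[of xs "[y]"] by simp

text \<open>Each closing bracket records its depth in unary, and depths are at most the length of
  the word; this makes the bound quadratic.\<close>

lemma sz_parse:
  "fst (foldl parse_step (0, [], []) w) \<le> length w \<and>
   sz (foldl parse_step (0, [], []) w) \<le> 5 + length w * (2 * length w + 10)"
proof (induction w rule: rev_induct)
  case (snoc s w)
  obtain d c out where a: "foldl parse_step (0, [], []) w = (d, c, out)" by (cases "foldl parse_step (0, [], []) w") auto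
  have d: "d \<le> length w" and sz: "2 + sz d + sz c + sz out \<le> 5 + length w * (2 * length w + 10)"
    using snoc a by simp_all
  have "sz (parse_step (d, c, out) s) \<le> 2 + sz d + sz c + sz out + 10 + 2 * length w"
    using d sz_symbol[of s] sz_pos[of c] by (auto simp: parse_step_def sz_snoc sz_nat)
  also have "\<dots> \<le> 5 + length w * (2 * length w + 10) + 10 + 2 * length w" using sz by simp
  also have "\<dots> \<le> 5 + length (w @ [s]) * (2 * length (w @ [s]) + 10)" by (simp add: algebra_simps)
  finally have "sz (parse_step (d, c, out) s) \<le> \<dots>" .
  moreover have "fst (parse_step (d, c, out) s) \<le> Suc d" by (auto simp: parse_step_def)
  ultimately show ?case using d by (simp add: a)
qed simp

lemma pt_parse [pt_intros]: "pt f \<Longrightarrow> pt (\<lambda>x. parse (f x))"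
proof (rule pt_comp[of parse])
  have "pt (\<lambda>w. foldl parse_step (0, [], []) w)"
  proof (rule pt_foldl)
    show "pt (\<lambda>p. parse_step (fst (snd p)) (snd (snd p)))"
      unfolding parse_step_def by (intro pt_intros)
    show "bdd (\<lambda>w :: word. 5 + length w * (2 * length w + 10))" by (intro bdd_intros pt_intros)
    show "sz (foldl parse_step (0, [], []) (take i w)) \<le> 5 + length w * (2 * length w + 10)"
      if "i \<le> length w" for i and w :: word
      using that conjunct2[OF sz_parse[of "take i w"]]
      by (simp add: min_absorb2) (meson add_left_mono add_right_mono le_refl mult_le_mono mult_le_mono2 order_trans)
  qed (intro pt_intros)+
  then show "pt parse" unfolding parse_def by (intro pt_intros)
qed

text \<open>The encoding of \<open>2 ^ p\<close>: sign, \<open>p\<close> zeros below the leading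
  digit of the numerator, then sign and denominator 1.\<close>

definition rat_word :: "nat \<Rightarrow> word" where
  "rat_word p = Zero # Open # replicate p Zero @ [One, Close, Zero, Open, One, Close]"

lemma pt_rat_word [pt_intros]: "pt f \<Longrightarrow> pt (\<lambda>x. rat_word (f x))"
  unfolding rat_word_def by (intro pt_intros)

text \<open>In the word of a necklace the beads are the brackets at depth 2, while \<open>k\<close>
  and the list itself are at depth 1. Colours remain binary words, as only their equality
  matters.\<close>

definition colours :: "word \<Rightarrow> word list" where
  "colours w = map snd (filter (\<lambda>t. fst t = 2) (parse w))"

lemma pt_colours [pt_intros]: "pt f \<Longrightarrow> pt (\<lambda>x. colours (f x))"
  unfolding colours_def by (intro pt_intros)

text \<open>Here \<open>w\<close> is the whole instance word. Its length enters the exponent of the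
  mass because it is at hand without decoding and, for an instance, \<open>2 ^ length w\<close>
  exceeds \<open>k\<close>. The first bracket holds the bits of \<open>k\<close>, which are
  copied.\<close>

definition division_word :: "nat \<Rightarrow> word \<Rightarrow> word" where
  "division_word e w = Open # snd (hd (parse w)) @ Close # rat_word 0 @ rat_word (length (colours w)) @
     Open # concat (map (\<lambda>i. Open # concat (map (\<lambda>q. rat_word (fst q) @ rat_word (Suc (fst q)) @
         rat_word (length w + e - fst q))
       (filter (\<lambda>q. snd q = i) (zip [0..<length (colours w)] (colours w)))) @ [Close])
       (remdups (colours w))) @ [Close]"

lemma pt_division_word: "pt (division_word e)"
  unfolding division_word_def by (intro pt_intros)

text \<open>Least significant digits come first, so the last differing position decides. The padding
  at the high end gives both words the same length.\<close>

definition le_bits :: "word \<Rightarrow> word \<Rightarrow> bool" where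
  "le_bits a b = foldl (\<lambda>r q. if fst q = snd q then r else snd q = One) True
     (zip (a @ replicate (length b) Zero) (b @ replicate (length a) Zero))"

lemma pt_le_bits [pt_intros]:
  assumes "pt f" "pt g" shows "pt (\<lambda>x. le_bits (f x) (g x))"
  unfolding le_bits_def
  by (rule pt_foldl[where B = "\<lambda>_. 3"]) (intro pt_intros bdd_intros assms sz_bool)+

text \<open>Zeros in front multiply by a power of two. Hence the quotient of the two words is
  compared with \<open>2 ^ Suc p\<close> without any division.\<close>

definition level :: "nat \<Rightarrow> word \<times> word \<Rightarrow> nat" where
  "level N q = length (filter (\<lambda>p. le_bits (replicate (Suc p) Zero @ snd q) (fst q)) [0..<N])"

lemma pt_level [pt_intros]:
  assumes "pt f" "pt g" shows "pt (\<lambda>x. level (f x) (g x))"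
  unfolding level_def by (intro pt_intros assms pt_comp[OF assms(2)])

text \<open>The parser delivers numerators and denominators alternately; the first component holds a
  numerator that waits for its denominator.\<close>

definition pair_step :: "'a list \<times> ('a \<times> 'a) list \<Rightarrow> 'a \<Rightarrow> 'a list \<times> ('a \<times> 'a) list" where
  "pair_step a z = (if fst a = [] then ([z], snd a) else ([], snd a @ [(hd (fst a), z)]))"

definition pair_up :: "'a list \<Rightarrow> ('a \<times> 'a) list" where
  "pair_up xs = snd (foldl pair_step ([], []) xs)"

lemma sz_pair_up:
  "length (fst (foldl pair_step ([], []) xs)) \<le> 1 \<and>
   sz (fst (foldl pair_step ([], []) xs)) + sz (snd (foldl pair_step ([], []) xs)) \<le> 1 + sz xs"
proof (induction xs rule: rev_induct)
  case (snoc z xs)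
  obtain u v where a: "foldl pair_step ([], []) xs = (u, v)" by (cases "foldl pair_step ([], []) xs") auto
  have "length u \<le> 1" "sz u + sz v \<le> 1 + sz xs" using snoc a by simp_all
  then have "length (fst (pair_step (u, v) z)) \<le> 1 \<and>
      sz (fst (pair_step (u, v) z)) + sz (snd (pair_step (u, v) z)) \<le> 1 + sz (xs @ [z])"
    by (cases u) (auto simp: pair_step_def sz_snoc)
  then show ?case by (simp add: a)
qed simp

lemma pt_pair_up [pt_intros]:
  fixes f :: "'a::encodable \<Rightarrow> 'b::encodable list"
  shows "pt f \<Longrightarrow> pt (\<lambda>x. pair_up (f x))"
proof (rule pt_comp[of pair_up])
  have "pt (\<lambda>xs :: 'b list. foldl pair_step ([], []) xs)"
  proof (rule pt_foldl)
    show "pt (\<lambda>p :: 'b list \<times> ('b list \<times> ('b \<times> 'b) list) \<times> 'b. pair_step (fst (snd p)) (snd (snd p)))"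
      unfolding pair_step_def by (intro pt_intros)
    show "bdd (\<lambda>xs :: 'b list. 2 + sz xs)" by (intro bdd_intros pt_intros)
    show "sz (foldl pair_step ([], []) (take i xs)) \<le> 2 + sz xs"
      if "i \<le> length xs" for i and xs :: "'b list"
      using sz_pair_up[of "take i xs"] sz_take[of i xs]
      by (cases "foldl pair_step ([], []) (take i xs)") simp
  qed (intro pt_intros)+
  then show "pt (pair_up :: 'b list \<Rightarrow> _)" unfolding pair_up_def by (intro pt_intros)
qed

section \<open>From unary to binary numbers\<close>

fun inc_bits :: "word \<Rightarrow> word" where
  "inc_bits [] = [One]"
| "inc_bits (One # w) = Zero # inc_bits w"
| "inc_bits (s # w) = One # w"

lemma inc_bits_bits: "inc_bits (bits n) = bits (Suc n)"
proof (induction n rule: less_induct)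
  case (less n)
  show ?case
  proof (cases "n = 0")
    case True
    then show ?thesis by (simp add: bits_0 bits_pos)
  next
    case False
    then have "inc_bits (bits (n div 2)) = bits (Suc (n div 2))" using less by simp
    then show ?thesis using False by (cases "odd n") (simp_all add: bits_pos)
  qed
qed

text \<open>The truth value is the carry.\<close>

definition inc_step :: "bool \<times> word \<Rightarrow> symbol \<Rightarrow> bool \<times> word" where
  "inc_step a s = (if fst a then (if s = One then (True, snd a @ [Zero]) else (False, snd a @ [One]))
     else (False, snd a @ [s]))"

lemma foldl_inc_step:
  "foldl inc_step (False, v) w = (False, v @ w)"
  "(let a = foldl inc_step (True, v) w in if fst a then snd a @ [One] else snd a) = v @ inc_bits w"
proof -
  show *: "foldl inc_step (False, v) w = (False, v @ w)" for v w
    by (induction w arbitrary: v) (simp_all add: inc_step_def)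
  show "(let a = foldl inc_step (True, v) w in if fst a then snd a @ [One] else snd a) = v @ inc_bits w"
    by (induction w arbitrary: v rule: inc_bits.induct) (auto simp: inc_step_def * Let_def)
qed

lemma length_inc_step: "length (snd (foldl inc_step a w)) = length (snd a) + length w"
  by (induction w arbitrary: a) (simp_all add: inc_step_def)

lemma pt_inc_bits [pt_intros]: "pt f \<Longrightarrow> pt (\<lambda>x. inc_bits (f x))"
proof (rule pt_comp[of inc_bits])
  have "pt (\<lambda>w. foldl inc_step (True, []) w)"
  proof (rule pt_foldl)
    show "pt (\<lambda>p. inc_step (fst (snd p)) (snd (snd p)))"
      unfolding inc_step_def by (intro pt_intros)
    show "bdd (\<lambda>w :: word. 6 * length w + 5)" by (intro bdd_intros pt_intros)
    show "sz (foldl inc_step (True, []) (take i w)) \<le> 6 * length w + 5"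
      if "i \<le> length w" for i and w :: word
      using that length_inc_step[of "(True, [])" "take i w"] sz_word[of "snd (foldl inc_step (True, []) (take i w))"]
        sz_bool[of "fst (foldl inc_step (True, []) (take i w))"]
      by (cases "foldl inc_step (True, []) (take i w)") simp
  qed (intro pt_intros)+
  then have "pt (\<lambda>w. if fst (foldl inc_step (True, []) w) then snd (foldl inc_step (True, []) w) @ [One]
      else snd (foldl inc_step (True, []) w))"
    by (intro pt_intros)
  then show "pt inc_bits" using foldl_inc_step(2)[of "[]"] by (simp add: Let_def)
qed

lemma length_bits: "length (bits n) \<le> n"
proof (induction n rule: less_induct)
  case (less n)
  show ?case
  proof (cases "n = 0")
    case False
    then show ?thesis using less[of "n div 2"] by (simp add: bits_pos)
  qed (simp add: bits_0)
qed

text \<open>The argument is unary, so counting up to it in binary takes only polynomially many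
  increments.\<close>

lemma pt_bits [pt_intros]:
  assumes "pt f" shows "pt (\<lambda>x. bits (f x))"
proof -
  have *: "(inc_bits ^^ n) [] = bits n" for n
    by (induction n) (simp_all add: bits_0 inc_bits_bits)
  have "pt (\<lambda>x. (inc_bits ^^ f x) [])"
  proof (rule pt_funpow)
    show "bdd (\<lambda>x. 6 * f x + 1)" by (intro bdd_intros bdd_nat assms)
    show "sz ((inc_bits ^^ i) []) \<le> 6 * f x + 1" if "i \<le> f x" for x i
      using that sz_word[of "bits i"] length_bits[of i] by (simp add: *)
  qed (intro pt_intros assms)+
  then show ?thesis by (simp add: *)
qed

text \<open>A piece consists of its index, the levels of its end points and its label.\<close>

definition pieces :: "nat \<Rightarrow> word \<Rightarrow> (nat \<times> nat \<times> nat \<times> word) list" where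
  "pieces N y = (let ts = takeWhile (\<lambda>t. fst t = 2) (parse y);
      fs = map (level N) (pair_up (map snd ts));
      ls = map snd (filter (\<lambda>t. fst t = 2) (drop (length ts) (parse y)))
    in zip [0..<length ls] (zip (0 # fs) (zip (fs @ [N]) ls)))"

text \<open>A piece whose ends have levels \<open>a\<close> and \<open>b\<close> is offered to all
  beads from \<open>a\<close> to \<open>b\<close>, even if it only borders on bead \<open>b\<close>.
  This generosity is harmless, since the order of the choices follows from the levels alone.\<close>

definition options :: "(nat \<times> nat \<times> nat \<times> 't) list \<Rightarrow> nat \<Rightarrow> 'c \<Rightarrow> (nat \<times> ('c \<times> 't)) list" where
  "options ps p c = map (\<lambda>q. (fst q, (c, snd (snd (snd q)))))
     (filter (\<lambda>q. fst (snd q) \<le> p \<and> p \<le> fst (snd (snd q))) ps)"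

definition start_beads :: "'c list \<Rightarrow> (nat \<times> nat \<times> nat \<times> 't) list \<Rightarrow> ('c, 't) bead list" where
  "start_beads ws ps = map (\<lambda>q. (fst q, options ps (fst q) (snd q))) (zip [0..<length ws] ws)"

text \<open>The parameter of \<open>step\<close> is recovered as the number of different labels, as
  every part of a solution owns a piece. The fourth power suffices because neither the number of
  colours nor \<open>k\<close> exceeds the number of beads.\<close>

definition final_beads :: "'c list \<Rightarrow> (nat \<times> nat \<times> nat \<times> 't) list \<Rightarrow> ('c, 't) bead list" where
  "final_beads ws ps = (let m = Suc (length ws) in
     fst ((step (length (remdups (map (\<lambda>q. snd (snd (snd q))) ps))) ^^ (m * (m * (m * m)))) (start_beads ws ps, [])))"

definition new_cuts :: "nat \<Rightarrow> ('c, 't) bead list \<Rightarrow> nat list" where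
  "new_cuts c S = map (\<lambda>j. length (filter (\<lambda>b. fst (hd (snd b)) \<le> j) S)) [0..<c]"

definition round_word :: "word \<times> word \<Rightarrow> word" where
  "round_word q = (let ws = colours (fst q); ps = pieces (length ws) (snd q) in
     Open # concat (map (\<lambda>z. Open # bits z @ [Close]) (new_cuts (length ps - 1) (final_beads ws ps))) @
     Close # Open # concat (map (\<lambda>p. Open # snd (snd (snd p)) @ [Close]) ps) @ [Close])"

lemma pt_choices [pt_intros]:
  assumes "pt f" "pt g" "pt h" shows "pt (\<lambda>x. options (f x) (g x) (h x))"
  unfolding options_def by (intro pt_intros assms pt_comp[OF assms(2)] pt_comp[OF assms(3)])

lemma pt_start_beads [pt_intros]:
  assumes "pt f" "pt g" shows "pt (\<lambda>x. start_beads (f x) (g x))"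
  unfolding start_beads_def by (intro pt_intros assms pt_comp[OF assms(2)])

lemma pt_final_beads [pt_intros]:
  assumes "pt f" "pt g" shows "pt (\<lambda>x. final_beads (f x) (g x))"
  unfolding final_beads_def Let_def by (intro pt_intros assms)

lemma pt_new_cuts [pt_intros]:
  assumes "pt f" "pt g" shows "pt (\<lambda>x. new_cuts (f x) (g x))"
  unfolding new_cuts_def by (intro pt_intros assms pt_comp[OF assms(2)])

lemma pt_pieces [pt_intros]:
  assumes "pt f" "pt g" shows "pt (\<lambda>x. pieces (f x) (g x))"
  unfolding pieces_def Let_def by (intro pt_intros assms pt_comp[OF assms(1)])

lemma pt_round_word: "pt round_word"
  unfolding round_word_def Let_def by (intro pt_intros)

section \<open>Correctness of parser and encoder\<close>

lemma parse_step_simps [simp]: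
  "parse_step (d, c, out) Open = (Suc d, [], out)"
  "parse_step (d, c, out) Close = (d - 1, [], out @ [(d, c)])"
  "parse_step (d, c, out) Zero = (d, c @ [Zero], out)"
  "parse_step (d, c, out) One = (d, c @ [One], out)"
  by (simp_all add: parse_step_def)

lemma parse_bits: "foldl parse_step (d, c, out) (bits n) = (d, c @ bits n, out)"
proof (induction n arbitrary: c rule: less_induct)
  case (less n)
  show ?case
  proof (cases "n = 0")
    case False
    then show ?thesis using less[of "n div 2"] by (simp add: bits_pos)
  qed (simp add: bits_0)
qed

lemma parse_nat: "foldl parse_step (d, c, out) (enc_nat n) = (d, [], out @ [(Suc d, bits n)])"
  by (simp add: Defs.enc_nat_def parse_bits)

lemma parse_int:
  "foldl parse_step (d, c, out) (enc_int z) = (d, [], out @ [(Suc d, bits (nat \<bar>z\<bar>))])"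
  by (simp add: enc_int_def parse_nat)

lemma parse_rat:
  "foldl parse_step (d, c, out) (enc_rat q) = (d, [], out @ [(Suc d, bits (nat \<bar>fst (quotient_of q)\<bar>)),
     (Suc d, bits (nat \<bar>snd (quotient_of q)\<bar>))])"
  by (simp add: enc_rat_def enc_pair_def case_prod_beta parse_int)

lemma parse_concat:
  assumes "\<And>d c out x. foldl parse_step (d, c, out) (e x) = (d, [], out @ h d x)"
  shows "foldl parse_step (d, [], out) (concat (map e xs)) = (d, [], out @ concat (map (h d) xs))"
  by (induction xs arbitrary: out) (simp_all add: assms)

lemma parse_list:
  assumes "\<And>d c out x. foldl parse_step (d, c, out) (e x) = (d, [], out @ h d x)"
  shows "foldl parse_step (d, c, out) (enc_list e xs) =
    (d, [], out @ concat (map (h (Suc d)) xs) @ [(Suc d, [])])"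
  by (simp add: Defs.enc_list_def parse_concat[of e h, OF assms])

definition necklace_word :: "nat \<Rightarrow> nat list \<Rightarrow> word" where
  "necklace_word k w = enc_pair enc_nat (enc_list enc_nat) (k, w)"

definition solution_word :: "rat list \<Rightarrow> nat list \<Rightarrow> word" where
  "solution_word cs ls = enc_pair (enc_list enc_rat) (enc_list enc_nat) (cs, ls)"

lemma parse_necklace_word:
  "parse (necklace_word k w) = (1, bits k) # map (\<lambda>n. (2, bits n)) w @ [(1, [])]"
proof -
  have "foldl parse_step (0, [], []) (necklace_word k w) =
    (0, [], [(1, bits k)] @ concat (map (\<lambda>n. [(2, bits n)]) w) @ [(1, [])])"
    unfolding necklace_word_def enc_pair_def prod.case foldl_append parse_nat
    by (subst parse_list[of enc_nat "\<lambda>d n. [(Suc d, bits n)]"]) (simp_all add: parse_nat numeral_2_eq_2)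
  then show ?thesis by (simp add: parse_def concat_map_singleton)
qed

lemma colours_necklace_word [simp]: "colours (necklace_word k w) = map bits w"
  by (simp add: colours_def parse_necklace_word comp_def)

definition num_den :: "rat \<Rightarrow> word \<times> word" where
  "num_den q = (bits (nat \<bar>fst (quotient_of q)\<bar>), bits (nat \<bar>snd (quotient_of q)\<bar>))"

lemma parse_solution_word:
  "parse (solution_word cs ls) = concat (map (\<lambda>q. [(2, fst (num_den q)), (2, snd (num_den q))]) cs) @
     (1, []) # map (\<lambda>n. (2, bits n)) ls @ [(1, [])]"
proof -
  have r: "foldl parse_step (d, c, out) (enc_list enc_rat cs) = (d, [], out @ concat (map (\<lambda>q.
     [(Suc (Suc d), fst (num_den q)), (Suc (Suc d), snd (num_den q))]) cs) @ [(Suc d, [])])" for d c out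
    by (subst parse_list[of enc_rat "\<lambda>d q. [(Suc d, fst (num_den q)), (Suc d, snd (num_den q))]"])
       (simp_all add: parse_rat num_den_def)
  have n: "foldl parse_step (d, c, out) (enc_list enc_nat ls) =
     (d, [], out @ concat (map (\<lambda>n. [(Suc (Suc d), bits n)]) ls) @ [(Suc d, [])])" for d c out
    by (subst parse_list[of enc_nat "\<lambda>d n. [(Suc d, bits n)]"]) (simp_all add: parse_nat)
  show ?thesis
    by (simp add: parse_def solution_word_def enc_pair_def r n concat_map_singleton numeral_2_eq_2)
qed

lemma pair_up_concat: "pair_up (concat (map (\<lambda>q. [fst q, snd q]) qs)) = qs"
proof -
  have "foldl pair_step ([], out) (concat (map (\<lambda>q. [fst q, snd q]) qs)) = ([], out @ qs)" for out
    by (induction qs arbitrary: out) (simp_all add: pair_step_def)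
  then show ?thesis by (simp add: pair_up_def)
qed

section \<open>Comparing binary numbers and locating cuts\<close>

primrec bval :: "word \<Rightarrow> nat" where
  "bval [] = 0"
| "bval (s # w) = (if s = One then 1 else 0) + 2 * bval w"

lemma bval_bits [simp]: "bval (bits n) = n"
proof (induction n rule: less_induct)
  case (less n)
  show ?case
  proof (cases "n = 0")
    case False
    then show ?thesis using less[of "n div 2"] by (simp add: bits_pos)
  qed (simp add: bits_0)
qed

lemma bits_inject [simp]: "bits m = bits n \<longleftrightarrow> m = n"
  using bval_bits by metis

lemma set_bits: "set (bits n) \<subseteq> {Zero, One}"
proof (induction n rule: less_induct)
  case (less n)
  show ?case
  proof (cases "n = 0")
    case False
    then show ?thesis using less[of "n div 2"] by (simp add: bits_pos)
  qed (simp add: bits_0)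
qed

lemma bval_append_Zero: "bval (a @ replicate m Zero) = bval a"
  by (induction a) (simp_all, induction m, simp_all)

lemma bval_Zero_append: "bval (replicate m Zero @ a) = 2 ^ m * bval a"
  by (induction m) simp_all

text \<open>\<open>r\<close> is the verdict on the lower digits; it counts only if the higher ones
  agree.\<close>

lemma foldl_compare:
  assumes "length a = length b" "set a \<subseteq> {Zero, One}" "set b \<subseteq> {Zero, One}"
  shows "foldl (\<lambda>r q. if fst q = snd q then r else snd q = One) r (zip a b) \<longleftrightarrow>
    bval a < bval b \<or> bval a = bval b \<and> r"
  using assms
proof (induction a b arbitrary: r rule: list_induct2)
  case (Cons x a y b)
  then show ?case by auto
qed simp

lemma le_bits_iff:
  assumes "set a \<subseteq> {Zero, One}" "set b \<subseteq> {Zero, One}"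
  shows "le_bits a b \<longleftrightarrow> bval a \<le> bval b"
  unfolding le_bits_def
  by (subst foldl_compare) (use assms in \<open>auto simp: bval_append_Zero\<close>)

text \<open>If \<open>2 ^ p \<le> q < 2 ^ Suc p\<close> and \<open>p \<le> N\<close>, this is
  \<open>p\<close>, the index of the bead that contains \<open>q\<close>; the right end
  \<open>2 ^ N\<close> gets \<open>N\<close>.\<close>

definition lev :: "nat \<Rightarrow> rat \<Rightarrow> nat" where
  "lev N q = card {p. p < N \<and> 2 ^ Suc p \<le> q}"

lemma level_num_den:
  assumes "q > 0" shows "level N (num_den q) = lev N q"
proof -
  obtain a b where ab: "quotient_of q = (a, b)" by (cases "quotient_of q")
  have b: "b > 0" using quotient_of_denom_pos[OF ab] .
  have q: "q = of_int a / of_int b" using quotient_of_div[OF ab] .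
  then have a: "a > 0" using assms b by (simp add: zero_less_divide_iff)
  have "le_bits (replicate (Suc p) Zero @ snd (num_den q)) (fst (num_den q)) \<longleftrightarrow> 2 ^ Suc p \<le> q" for p
  proof -
    have "le_bits (replicate (Suc p) Zero @ snd (num_den q)) (fst (num_den q)) \<longleftrightarrow>
        2 ^ Suc p * nat b \<le> nat a"
      unfolding num_den_def using a b set_bits
      by (subst le_bits_iff) (auto simp: ab bval_Zero_append simp del: replicate_Suc power_Suc)
    also have "\<dots> \<longleftrightarrow> int (2 ^ Suc p * nat b) \<le> int (nat a)" by (rule of_nat_le_iff[symmetric])
    also have "\<dots> \<longleftrightarrow> 2 ^ Suc p * b \<le> a" using a b by simp
    also have "\<dots> \<longleftrightarrow> of_int (2 ^ Suc p * b) \<le> (of_int a :: rat)" by (rule of_int_le_iff[symmetric])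
    also have "\<dots> \<longleftrightarrow> 2 ^ Suc p \<le> q" using b by (simp add: q field_simps)
    finally show ?thesis .
  qed
  then have "level N (num_den q) = length (filter (\<lambda>p. 2 ^ Suc p \<le> q) [0..<N])"
    by (simp add: level_def)
  also have "\<dots> = lev N q"
    using distinct_card[OF distinct_filter[OF distinct_upt], of "\<lambda>p. 2 ^ Suc p \<le> q" 0 N]
    by (simp add: lev_def conj_commute)
  finally show ?thesis .
qed

lemma lev_mono: "q \<le> r \<Longrightarrow> lev N q \<le> lev N r"
  unfolding lev_def by (rule card_mono) auto

lemma lev_ge: "p \<le> N \<Longrightarrow> 2 ^ p \<le> q \<Longrightarrow> p \<le> lev N q"
proof -
  assume p: "p \<le> N" "2 ^ p \<le> q"
  have "{..<p} \<subseteq> {p. p < N \<and> 2 ^ Suc p \<le> q}"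
  proof
    fix i assume "i \<in> {..<p}"
    then have "(2::rat) ^ Suc i \<le> 2 ^ p" by (intro power_increasing) auto
    then show "i \<in> {p. p < N \<and> 2 ^ Suc p \<le> q}" using p \<open>i \<in> {..<p}\<close> by auto
  qed
  from card_mono[OF _ this] show ?thesis by (simp add: lev_def)
qed

lemma lev_le: "q < 2 ^ Suc p \<Longrightarrow> lev N q \<le> p"
proof -
  assume q: "q < 2 ^ Suc p"
  have "{p. p < N \<and> 2 ^ Suc p \<le> q} \<subseteq> {..<p}"
  proof
    fix i assume "i \<in> {p. p < N \<and> 2 ^ Suc p \<le> q}"
    then have "(2::rat) ^ Suc i \<le> q" by simp
    then have "(2::rat) ^ Suc i < 2 ^ Suc p" using q by (rule le_less_trans)
    from power_less_imp_less_exp[OF _ this] show "i \<in> {..<p}" by simp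
  qed
  from card_mono[OF _ this] show ?thesis by (simp add: lev_def)
qed

definition piece_list :: "nat \<Rightarrow> rat list \<Rightarrow> nat list \<Rightarrow> (nat \<times> nat \<times> nat \<times> word) list" where
  "piece_list N cs ls = zip [0..<length ls]
     (zip (0 # map (lev N) cs) (zip (map (lev N) cs @ [N]) (map bits ls)))"

text \<open>The closing bracket of the list of cuts has depth 1 and ends \<open>takeWhile\<close>;
  the later brackets at depth 2 are the labels. The parser drops signs, so positive cuts lose no
  information.\<close>

lemma pieces_solution_word:
  assumes "\<And>q. q \<in> set cs \<Longrightarrow> q > 0"
  shows "pieces N (solution_word cs ls) = piece_list N cs ls"
proof -
  let ?ts = "concat (map (\<lambda>q. [(2::nat, fst (num_den q)), (2, snd (num_den q))]) cs)"
  have all2: "\<forall>t\<in>set ?ts. fst t = 2" by auto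
  have tw: "takeWhile (\<lambda>t. fst t = 2) (parse (solution_word cs ls)) = ?ts"
    unfolding parse_solution_word using all2 by (subst takeWhile_append2) auto
  have snd_ts: "map snd ?ts = concat (map (\<lambda>q. [fst q, snd q]) (map num_den cs))"
    by (induction cs) simp_all
  have fs: "map (level N) (pair_up (map snd ?ts)) = map (lev N) cs"
    unfolding snd_ts pair_up_concat using assms by (simp add: level_num_den)
  have ls: "map snd (filter (\<lambda>t. fst t = 2) (drop (length ?ts) (parse (solution_word cs ls)))) = map bits ls"
    unfolding parse_solution_word by (simp add: comp_def)
  show ?thesis unfolding pieces_def Let_def tw fs ls by (simp add: piece_list_def)
qed

section \<open>The division instance and its word\<close>

lemma bits_power: "bits (2 ^ p) = replicate p Zero @ [One]"
  by (induction p) (simp_all add: bits_pos bits_0)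

lemma enc_rat_power: "enc_rat (2 ^ p) = rat_word p"
proof -
  have "quotient_of (2 ^ p) = (2 ^ p, 1)"
    using quotient_of_int[of "2 ^ p"] by (simp add: Rat.of_int_def)
  moreover have "nat (2 ^ p) = 2 ^ p" by (simp add: nat_power_eq)
  ultimately show ?thesis
    using bits_power[of 0] by (simp add: enc_rat_def enc_pair_def enc_int_def Defs.enc_nat_def bits_power rat_word_def nat_power_eq)
qed

text \<open>Bead \<open>p\<close> occupies \<open>[2 ^ p, 2 ^ Suc p)\<close> and has mass \<open>2 ^ L\<close>. Powers of two are written in
  binary without any arithmetic, and locating a cut amounts to comparing shifted binary numbers.\<close>

definition bead_block :: "nat \<Rightarrow> nat \<Rightarrow> rat \<times> rat \<times> rat" where
  "bead_block L p = (2 ^ p, 2 ^ Suc p, 2 ^ (L - p))"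

definition colour_blocks :: "nat \<Rightarrow> nat list \<Rightarrow> nat \<Rightarrow> blocks" where
  "colour_blocks L w i = map (bead_block L) (filter (\<lambda>p. w ! p = i) [0..<length w])"

definition division_instance :: "nat \<Rightarrow> nat list \<Rightarrow> rat \<times> rat \<times> blocks list" where
  "division_instance L w = (1, 2 ^ length w, map (colour_blocks L w) (remdups w))"

lemma remdups_map_bits: "remdups (map bits w) = map bits (remdups w)"
  by (induction w) auto

lemma division_word_correct:
  "division_word e (necklace_word k w) =
     enc_pair enc_nat (enc_pair enc_rat (enc_pair enc_rat
       (enc_list (enc_list (enc_pair enc_rat (enc_pair enc_rat enc_rat))))))
       (k, division_instance (length (necklace_word k w) + e) w)"
proof -
  let ?L = "length (necklace_word k w) + e"
  \<comment> \<open>Since \<open>bits\<close> is injective, selecting beads by the word of a colour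
    selects them by the colour.\<close>
  have zip: "filter (\<lambda>q. snd q = bits i) (zip [0..<length w] (map bits w)) =
      map (\<lambda>p. (p, bits i)) (filter (\<lambda>p. w ! p = i) [0..<length w])" for i
  proof -
    have "zip [0..<length w] (map bits w) = map (\<lambda>p. (p, bits (w ! p))) [0..<length w]"
      by (rule nth_equalityI) simp_all
    then show ?thesis by (auto simp: filter_map comp_def intro!: map_cong)
  qed
  have block: "enc_pair enc_rat (enc_pair enc_rat enc_rat) (bead_block ?L p) =
     rat_word p @ rat_word (Suc p) @ rat_word (?L - p)" for p
    by (simp only: enc_pair_def bead_block_def prod.case enc_rat_power)
  have one: "enc_rat 1 = rat_word 0" using enc_rat_power[of 0] by simp
  have agent: "Open # concat (map (\<lambda>q. rat_word (fst q) @ rat_word (Suc (fst q)) @ rat_word (?L - fst q))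
       (filter (\<lambda>q. snd q = bits i) (zip [0..<length w] (map bits w)))) @ [Close] =
     enc_list (enc_pair enc_rat (enc_pair enc_rat enc_rat)) (colour_blocks ?L w i)" for i
    unfolding zip Defs.enc_list_def colour_blocks_def by (simp add: comp_def block)
  have hd: "snd (hd (parse (necklace_word k w))) = bits k" by (simp add: parse_necklace_word)
  show ?thesis
    unfolding division_word_def hd colours_necklace_word remdups_map_bits map_map comp_def length_map agent
    unfolding enc_pair_def division_instance_def prod.case one enc_rat_power Defs.enc_nat_def
    by (simp add: Defs.enc_list_def comp_def)
qed


section \<open>The value measures\<close>

lemma step_density_Cons:
  "step_density ((l, r, h) # bs) x = of_rat h * indicator {of_rat l ..< of_rat r} x + step_density bs x"
  by (simp add: step_density_def)

lemma step_density_nonneg: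
  "(\<And>l r h. (l, r, h) \<in> set bs \<Longrightarrow> 0 \<le> h) \<Longrightarrow> 0 \<le> step_density bs x"
  unfolding step_density_def by (intro sum_list_nonneg) (auto simp: zero_le_of_rat_iff)

lemma step_density_measurable [measurable]: "step_density bs \<in> borel_measurable borel"
proof (induction bs)
  case Nil
  then show ?case by (simp add: step_density_def[abs_def])
next
  case (Cons b bs)
  obtain l r h where b: "b = (l, r, h)" by (cases b)
  show ?case using Cons unfolding b step_density_Cons[abs_def] by measurable
qed

text \<open>Linearity of the integral over the list of blocks. Each block is bounded, so its
  intersection with \<open>A\<close> has finite length and \<open>measure\<close> may be
  used.\<close>

lemma emeasure_value_measure:
  assumes "\<And>l r h. (l, r, h) \<in> set bs \<Longrightarrow> 0 \<le> h" "A \<in> sets borel"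
  shows "emeasure (value_measure bs) A =
    ennreal (\<Sum>(l, r, h)\<leftarrow>bs. of_rat h * measure lborel ({of_rat l ..< of_rat r} \<inter> A))"
proof -
  have "emeasure (value_measure bs) A = (\<integral>\<^sup>+x. ennreal (step_density bs x) * indicator A x \<partial>lborel)"
    unfolding value_measure_def using assms(2) by (subst emeasure_density) auto
  also have "\<dots> = ennreal (\<Sum>(l, r, h)\<leftarrow>bs. of_rat h * measure lborel ({of_rat l ..< of_rat r} \<inter> A))"
    using assms(1)
  proof (induction bs)
    case Nil
    then show ?case by (simp add: step_density_def)
  next
    case (Cons b bs)
    obtain l r h where b: "b = (l, r, h)" by (cases b)
    have h: "0 \<le> h" and bs: "\<And>l r h. (l, r, h) \<in> set bs \<Longrightarrow> 0 \<le> h"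
      using Cons.prems[of l r h] Cons.prems b by auto
    let ?I = "{of_rat l ..< of_rat r :: real}"
    have fin: "emeasure lborel (?I \<inter> A) = ennreal (measure lborel (?I \<inter> A))"
    proof (rule emeasure_eq_ennreal_measure)
      have "emeasure lborel (?I \<inter> A) \<le> emeasure lborel ?I"
        by (rule emeasure_mono) auto
      also have "\<dots> < \<infinity>" by (cases "of_rat l \<le> (of_rat r :: real)") auto
      finally show "emeasure lborel (?I \<inter> A) \<noteq> top" by simp
    qed
    have "(\<integral>\<^sup>+x. ennreal (step_density (b # bs) x) * indicator A x \<partial>lborel) =
      (\<integral>\<^sup>+x. ennreal (of_rat h) * indicator (?I \<inter> A) x + ennreal (step_density bs x) * indicator A x \<partial>lborel)"
    proof (rule nn_integral_cong)
      fix x :: real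
      have "ennreal (step_density (b # bs) x) =
          ennreal (of_rat h * indicator ?I x) + ennreal (step_density bs x)"
        unfolding b step_density_Cons using h step_density_nonneg[where bs = bs and x = x, OF bs]
        by (intro ennreal_plus) (auto simp: zero_le_of_rat_iff)
      then show "ennreal (step_density (b # bs) x) * indicator A x =
         ennreal (of_rat h) * indicator (?I \<inter> A) x + ennreal (step_density bs x) * indicator A x"
        by (auto simp: indicator_def)
    qed
    also have "\<dots> = ennreal (of_rat h) * emeasure lborel (?I \<inter> A) +
        (\<integral>\<^sup>+x. ennreal (step_density bs x) * indicator A x \<partial>lborel)"
      using assms(2) by (subst nn_integral_add) (auto simp: nn_integral_cmult_indicator)
    also have "\<dots> = ennreal (of_rat h * measure lborel (?I \<inter> A)) +
        ennreal (\<Sum>(l, r, h)\<leftarrow>bs. of_rat h * measure lborel ({of_rat l ..< of_rat r} \<inter> A))"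
      using Cons.IH[OF bs] h by (simp add: fin ennreal_mult' zero_le_of_rat_iff)
    also have "\<dots> = ennreal (of_rat h * measure lborel (?I \<inter> A) +
        (\<Sum>(l, r, h)\<leftarrow>bs. of_rat h * measure lborel ({of_rat l ..< of_rat r} \<inter> A)))"
      using h bs by (intro ennreal_plus[symmetric] sum_list_nonneg) (auto simp: zero_le_of_rat_iff)
    finally show ?case by (simp add: b)
  qed
  finally show ?thesis .
qed

lemma measure_value_measure:
  assumes "\<And>l r h. (l, r, h) \<in> set bs \<Longrightarrow> 0 \<le> h" "A \<in> sets borel"
  shows "measure (value_measure bs) A =
    (\<Sum>(l, r, h)\<leftarrow>bs. of_rat h * measure lborel ({of_rat l ..< of_rat r} \<inter> A))"
proof -
  have "0 \<le> (\<Sum>(l, r, h)\<leftarrow>bs. of_rat h * measure lborel ({of_rat l ..< of_rat r :: real} \<inter> A))"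
    using assms(1) by (intro sum_list_nonneg) (auto simp: zero_le_of_rat_iff)
  moreover have e: "emeasure (value_measure bs) A =
      ennreal (\<Sum>(l, r, h)\<leftarrow>bs. of_rat h * measure lborel ({of_rat l ..< of_rat r} \<inter> A))"
    using assms by (rule emeasure_value_measure)
  ultimately show ?thesis
    unfolding Sigma_Algebra.measure_def[of "value_measure bs"] e by (intro enn2real_ennreal)
qed

text \<open>The divisor is the length of bead \<open>p\<close>, namely
  \<open>2 ^ Suc p - 2 ^ p\<close>.\<close>

definition fraction :: "real set \<Rightarrow> nat \<Rightarrow> real" where
  "fraction A p = measure lborel ({2 ^ p ..< 2 ^ Suc p} \<inter> A) / 2 ^ p"

text \<open>The height \<open>2 ^ (L - p)\<close> compensates the length \<open>2 ^ p\<close>, so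
  all beads have mass \<open>2 ^ L\<close>; \<open>length w \<le> L\<close> keeps the natural
  subtraction exact.\<close>

lemma measure_colour_blocks:
  assumes "A \<in> sets borel" "length w \<le> L"
  shows "measure (value_measure (colour_blocks L w i)) A =
    2 ^ L * (\<Sum>p\<in>{p. p < length w \<and> w ! p = i}. fraction A p)"
proof -
  let ?ps = "filter (\<lambda>p. w ! p = i) [0..<length w]"
  have "measure (value_measure (colour_blocks L w i)) A =
     (\<Sum>(l, r, h)\<leftarrow>colour_blocks L w i. of_rat h * measure lborel ({of_rat l ..< of_rat r} \<inter> A))"
    by (rule measure_value_measure) (auto simp: colour_blocks_def bead_block_def assms)
  also have "\<dots> = (\<Sum>p\<leftarrow>?ps. 2 ^ (L - p) * measure lborel ({2 ^ p ..< 2 ^ Suc p} \<inter> A))"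
    by (simp add: colour_blocks_def comp_def bead_block_def of_rat_power of_rat_mult)
  also have "\<dots> = (\<Sum>p\<leftarrow>?ps. 2 ^ L * fraction A p)"
  proof (intro arg_cong[of _ _ sum_list] map_cong refl)
    fix p assume "p \<in> set ?ps"
    then have "(2::real) ^ L = 2 ^ (L - p) * 2 ^ p" using assms(2) by (simp add: power_add[symmetric])
    then show "2 ^ (L - p) * measure lborel ({2 ^ p ..< 2 ^ Suc p} \<inter> A) = 2 ^ L * fraction A p"
      by (simp add: fraction_def)
  qed
  also have "\<dots> = (\<Sum>p\<in>set ?ps. 2 ^ L * fraction A p)"
    by (rule sum_list_distinct_conv_sum_set) simp
  also have "set ?ps = {p. p < length w \<and> w ! p = i}" by auto
  finally show ?thesis by (simp add: sum_distrib_left)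
qed

lemma part_borel: "part a b D t \<in> sets (borel :: real measure)"
  by (cases D) (auto simp: Let_def intro!: sets.finite_UN)

section \<open>Rounding a division\<close>

lemma downset_card:
  assumes "A \<subseteq> {..<N::nat}" "\<And>p q. p \<in> A \<Longrightarrow> q < p \<Longrightarrow> q \<in> A"
  shows "p \<in> A \<longleftrightarrow> p < card A"
proof (cases "A = {}")
  case False
  have fin: "finite A" using assms(1) finite_subset by blast
  have "A = {..<Suc (Max A)}"
  proof
    show "A \<subseteq> {..<Suc (Max A)}" using Max_ge[OF fin] by (auto simp: less_Suc_eq_le)
    show "{..<Suc (Max A)} \<subseteq> A"
      using Max_in[OF fin False] assms(2) by (auto simp: less_Suc_eq_le le_less)
  qed
  then show ?thesis by (metis card_lessThan lessThan_iff)
qed simp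

lemma part_iff:
  "x \<in> part a b (cs, ls) t \<longleftrightarrow>
    (\<exists>j<length ls. ls ! j = t \<and> (a # cs @ [b]) ! j \<le> x \<and> x < (a # cs @ [b]) ! Suc j)"
  by (auto simp: Let_def)

text \<open>If bead \<open>p\<close> is given to piece \<open>s p\<close> and \<open>s\<close> is monotone, then cut \<open>j\<close> has to follow the beads of
  the pieces up to \<open>j\<close>.\<close>

definition pos_cuts :: "nat \<Rightarrow> nat \<Rightarrow> (nat \<Rightarrow> nat) \<Rightarrow> nat list" where
  "pos_cuts N c s = map (\<lambda>j. card {p. p < N \<and> s p \<le> j}) [0..<c]"

text \<open>With \<open>0\<close> in front and \<open>N\<close> at the end, end point
  \<open>j\<close> counts the beads of the pieces below \<open>j\<close>. By monotonicity these form
  an initial segment, so comparing \<open>p\<close> with the end point amounts to comparing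
  \<open>s p\<close> with \<open>j\<close>.\<close>

lemma part_pos_cuts:
  assumes mono: "\<And>p q. p < q \<Longrightarrow> q < N \<Longrightarrow> s p \<le> s q"
    and s: "\<And>p. p < N \<Longrightarrow> s p \<le> c" and ls: "length ls = c + 1" and p: "p < N"
  shows "p \<in> part 0 N (pos_cuts N c s, ls) t \<longleftrightarrow> ls ! s p = t"
proof -
  let ?es = "0 # pos_cuts N c s @ [N]"
  have es: "?es ! j = card {p. p < N \<and> s p < j}" if j: "j \<le> c + 1" for j
  proof -
    consider "j = 0" | i where "j = Suc i" "i < c" | "j = Suc c" using j by (cases j) force+
    then show ?thesis
    proof cases
      case 3
      have "{p. p < N \<and> s p < Suc c} = {..<N}" using s by (auto simp: less_Suc_eq_le)
      then show ?thesis using 3 by (simp add: pos_cuts_def nth_append)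
    qed (simp_all add: pos_cuts_def nth_append less_Suc_eq_le)
  qed
  have lt: "p < ?es ! j \<longleftrightarrow> s p < j" if j: "j \<le> c + 1" for j
  proof -
    have "p \<in> {p. p < N \<and> s p < j} \<longleftrightarrow> p < card {p. p < N \<and> s p < j}"
      by (rule downset_card[of _ N]) (use mono in \<open>auto intro: le_less_trans less_trans\<close>)
    then show ?thesis using p unfolding es[OF j] by simp
  qed
  have "p \<in> part 0 N (pos_cuts N c s, ls) t \<longleftrightarrow>
      (\<exists>j<c + 1. ls ! j = t \<and> \<not> p < ?es ! j \<and> p < ?es ! Suc j)"
    unfolding part_iff ls not_less by blast
  also have "\<dots> \<longleftrightarrow> (\<exists>j<c + 1. ls ! j = t \<and> \<not> s p < j \<and> s p < Suc j)"
    using lt by (metis Suc_leI Suc_eq_plus1 less_imp_le_nat)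
  also have "\<dots> \<longleftrightarrow> ls ! s p = t"
    using s[OF p] by (auto simp: less_Suc_eq not_less_iff_gr_or_eq intro!: exI[of _ "s p"])
  finally show ?thesis .
qed

lemma valid_pos_cuts:
  assumes "length ls = c + 1" "set ls \<subseteq> {..<k}"
  shows "valid_division 0 N c k (pos_cuts N c s, ls)"
proof -
  have "sorted (pos_cuts N c s)"
    by (auto simp: pos_cuts_def sorted_iff_nth_mono intro!: card_mono)
  moreover have "card {p. p < N \<and> s p \<le> j} \<le> card {..<N}" for j
    by (rule card_mono) auto
  ultimately show ?thesis using assms by (auto simp: pos_cuts_def)
qed

lemma count_list_card: "count_list w i = card {p. p < length w \<and> w ! p = i}"
  by (simp add: count_list_eq_length_filter length_filter_conv_card eq_commute)

lemma fraction_nonneg: "0 \<le> fraction A p"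
  by (simp add: fraction_def)

lemma real_part_eq: "real_part 1 (2 ^ N) (cs, ls) t = part 1 (2 ^ N) (map of_rat cs, ls) t"
  by (simp add: of_rat_power)

text \<open>The parts partition \<open>{1..<2 ^ N}\<close>, which contains the whole bead.\<close>

lemma sum_fraction:
  assumes "valid_division (1::real) (2 ^ N) c k D" "p < N"
  shows "(\<Sum>t<k. fraction (part 1 (2 ^ N) D t) p) = 1"
proof -
  let ?I = "{2 ^ p ..< 2 ^ Suc p :: real}" and ?P = "part 1 (2 ^ N) D"
  have *: "(\<Union>t<k. ?P t) = {1..<2 ^ N}" "disjoint_family_on ?P {..<k}"
    using parts_partition[OF assms(1)] by simp_all
  have I: "?I \<subseteq> {1..<2 ^ N}"
  proof
    fix r :: real assume r: "r \<in> ?I"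
    have "(1::real) \<le> 2 ^ p" by simp
    then have "1 \<le> r" using r by (metis atLeastLessThan_iff order_trans)
    moreover have "(2::real) ^ Suc p \<le> 2 ^ N"
      using assms(2) by (intro power_increasing) auto
    then have "r < 2 ^ N" using r by (metis atLeastLessThan_iff less_le_trans)
    ultimately show "r \<in> {1..<2 ^ N}" by simp
  qed
  have fin: "emeasure lborel (?I \<inter> ?P t) \<noteq> \<infinity>" for t
  proof -
    have "emeasure lborel (?I \<inter> ?P t) \<le> emeasure lborel ?I" by (rule emeasure_mono) auto
    also have "\<dots> < \<infinity>" by simp
    finally show ?thesis by simp
  qed
  have "measure lborel (\<Union>t<k. ?I \<inter> ?P t) = (\<Sum>t<k. measure lborel (?I \<inter> ?P t))"
    using *(2) fin by (intro measure_finite_Union) (auto simp: disjoint_family_on_def intro!: sets.Int part_borel)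
  moreover have "(\<Union>t<k. ?I \<inter> ?P t) = ?I" using *(1) I by blast
  moreover have "measure lborel ?I = 2 ^ p" by simp
  ultimately have "(\<Sum>t<k. measure lborel (?I \<inter> ?P t)) = 2 ^ p" by simp
  then show ?thesis by (simp add: fraction_def sum_divide_distrib[symmetric])
qed

lemma piece_list_member:
  assumes "length ls = Suc (length cs)"
  shows "q \<in> set (piece_list N cs ls) \<longleftrightarrow>
    (\<exists>j<length ls. q = (j, (0 # map (lev N) cs) ! j, (map (lev N) cs @ [N]) ! j, bits (ls ! j)))"
proof -
  have "length (piece_list N cs ls) = length ls" using assms by (simp add: piece_list_def)
  moreover have "piece_list N cs ls ! j = (j, (0 # map (lev N) cs) ! j, (map (lev N) cs @ [N]) ! j, bits (ls ! j))"
    if "j < length ls" for j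
    using that assms by (simp add: piece_list_def del: upt_Suc)
  ultimately show ?thesis unfolding in_set_conv_nth by (metis (no_types))
qed

lemma options_piece_list:
  assumes "length ls = Suc (length cs)"
  shows "q \<in> set (options (piece_list N cs ls) p c) \<longleftrightarrow>
    (\<exists>j<length ls. q = (j, c, bits (ls ! j)) \<and> (0 # map (lev N) cs) ! j \<le> p \<and> p \<le> (map (lev N) cs @ [N]) ! j)"
  unfolding options_def set_map set_filter
  by (auto simp: piece_list_member[OF assms] image_iff)

text \<open>A positive fraction forces some piece labelled \<open>t\<close> to meet the bead. The
  two resulting strict inequalities between its ends and the powers of two pass from reals to
  rationals and then to levels.\<close>

lemma fraction_pos_option:
  assumes ls: "length ls = Suc (length cs)" and p: "p < N"
    and pos: "fraction (part 1 (2 ^ N) (map of_rat cs, ls) t) p > 0"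
  shows "\<exists>q\<in>set (options (piece_list N cs ls) p c). snd (snd q) = bits t"
proof -
  let ?I = "{2 ^ p ..< 2 ^ Suc p :: real}" and ?P = "part 1 (2 ^ N) (map of_rat cs, ls) t"
  let ?es = "1 # map of_rat cs @ [2 ^ N] :: real list"
  let ?rs = "1 # cs @ [2 ^ N]"
  have es: "?es ! j = of_rat (?rs ! j)" if "j < Suc (length ls)" for j
  proof -
    have "?es = map of_rat ?rs" by (simp add: of_rat_power)
    then show ?thesis using that ls by (metis length_Cons length_append_singleton nth_map)
  qed
  have "?I \<inter> ?P \<noteq> {}" using pos by (auto simp: fraction_def)
  then obtain r j where j: "j < length ls" "ls ! j = t" and r: "r \<in> ?I" "?es ! j \<le> r" "r < ?es ! Suc j"
    using part_iff by blast
  have "of_rat (?rs ! j) < (of_rat (2 ^ Suc p) :: real)"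
    using r es[of j] j(1) by (simp add: of_rat_power of_rat_mult)
  then have lo: "?rs ! j < 2 ^ Suc p" by (simp only: of_rat_less)
  have "of_rat (2 ^ p) < (of_rat (?rs ! Suc j) :: real)"
    using r es[of "Suc j"] j(1) by (simp add: of_rat_power)
  then have hi: "2 ^ p < ?rs ! Suc j" by (simp only: of_rat_less)
  have "(0 # map (lev N) cs) ! j \<le> p"
  proof (cases j)
    case (Suc i)
    then show ?thesis using lo ls j(1) lev_le[of "cs ! i" p N] by (simp add: nth_append)
  qed simp
  moreover have "p \<le> (map (lev N) cs @ [N]) ! j"
  proof (cases "j < length cs")
    case True
    then show ?thesis using hi p lev_ge[of p N "cs ! j"] by (simp add: nth_append)
  next
    case False
    then show ?thesis using j(1) ls p by (simp add: nth_append)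
  qed
  ultimately have "(j, c, bits (ls ! j)) \<in> set (options (piece_list N cs ls) p c)"
    unfolding options_piece_list[OF ls] using j(1) by (intro exI[of _ j] conjI refl)
  then show ?thesis using j(2) by (intro bexI[of _ "(j, c, bits (ls ! j))"]) simp_all
qed

lemma start_beads_bits:
  "start_beads (map bits w) ps = map (\<lambda>p. (p, options ps p (bits (w ! p)))) [0..<length w]"
proof -
  have "zip [0..<length w] (map bits w) = map (\<lambda>p. (p, bits (w ! p))) [0..<length w]"
    by (rule nth_equalityI) simp_all
  then show ?thesis by (simp add: start_beads_def)
qed

text \<open>Chosen options of distinct beads are in the order of the beads since the levels of the cuts
  are increasing.\<close>

lemma piece_order:
  assumes ls: "length ls = Suc (length cs)" and cs: "sorted cs"
    and j: "j < length ls" "p \<le> (map (lev N) cs @ [N]) ! j"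
    and i: "i < length ls" "(0 # map (lev N) cs) ! i \<le> q" and pq: "q < p"
  shows "i \<le> j"
proof (rule ccontr)
  assume "\<not> i \<le> j"
  then obtain i' where i': "i = Suc i'" "j \<le> i'" by (cases i) auto
  then have "cs ! j \<le> cs ! i'" using cs ls i(1) by (simp add: sorted_iff_nth_mono)
  then have "lev N (cs ! j) \<le> lev N (cs ! i')" by (rule lev_mono)
  then show False using i' i j ls pq by (simp add: nth_append split: if_splits)
qed

text \<open>The division is a \<open>fractional_assignment\<close> with error
  \<open>\<epsilon> / 2 ^ L\<close>. By \<open>piece_order\<close> the assignment found by
  \<open>push_relabel\<close> is monotone along the necklace, so \<open>pos_cuts\<close> realizes it
  with the given labels and number of cuts.\<close>

lemma round_correct:
  fixes \<epsilon> :: real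
  assumes k: "1 \<le> k" "k \<le> n" and w: "is_necklace n k \<alpha> w"
    and D: "valid_division 1 (2 ^ length w) c k (cs, ls)"
    and L: "length w \<le> L" and \<epsilon>: "0 \<le> \<epsilon>" "real k * \<epsilon> < 2 ^ L"
    and sol: "\<And>i t j. i < n \<Longrightarrow> t < k \<Longrightarrow> j < k \<Longrightarrow>
      \<bar>measure (value_measure (colour_blocks L w i)) (real_part 1 (2 ^ length w) (cs, ls) t) -
       measure (value_measure (colour_blocks L w i)) (real_part 1 (2 ^ length w) (cs, ls) j)\<bar> \<le> \<epsilon>"
    and zs: "zs = new_cuts (length cs) (final_beads (map bits w) (piece_list (length w) cs ls))"
  shows "valid_division 0 (length w) c k (zs, ls)"
    and "\<And>i t. i < n \<Longrightarrow> t < k \<Longrightarrow> beads w i (part 0 (length w) (zs, ls) t) = \<alpha> i"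
proof -
  define N where "N = length w"
  define P where "P = part 1 (2 ^ N :: real) (map of_rat cs, ls)"
  define ps where "ps = piece_list N cs ls"
  define S0 where "S0 = start_beads (map bits w) ps"
  define S where "S = final_beads (map bits w) ps"
  define s where "s p = fst (hd (snd (S ! p)))" for p
  have v: "length cs = c" "sorted cs" "length ls = c + 1" "set ls \<subseteq> {..<k}"
    "\<And>q. q \<in> set cs \<Longrightarrow> 1 \<le> q \<and> q \<le> 2 ^ N"
    using D by (auto simp: N_def)
  have ls: "length ls = Suc (length cs)" using v by simp
  have DR: "valid_division (1::real) (2 ^ N) c k (map of_rat cs, ls)"
  proof -
    have "sorted (map (of_rat :: rat \<Rightarrow> real) cs)"
      using v(2) by (simp add: sorted_map sorted_wrt_mono_rel of_rat_less_eq)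
    moreover have "1 \<le> (of_rat q :: real) \<and> (of_rat q :: real) \<le> 2 ^ N" if "q \<in> set cs" for q
      using v(5)[OF that] of_rat_less_eq[of 1 q, where 'a = real] of_rat_less_eq[of q "2 ^ N", where 'a = real]
      by (simp add: of_rat_power)
    ultimately show ?thesis using v by auto
  qed
  have wn: "length w = k * (\<Sum>i<n. \<alpha> i)" "set w \<subseteq> {..<n}" and \<alpha>: "\<And>i. i < n \<Longrightarrow> \<alpha> i > 0"
    and cnt: "\<And>i. i < n \<Longrightarrow> card {p. p < N \<and> w ! p = i} = k * \<alpha> i"
    using w by (auto simp: is_necklace_def count_list_card N_def)
  have nN: "n \<le> N"
  proof -
    have "n = (\<Sum>i<n. 1)" by simp
    also have "\<dots> \<le> (\<Sum>i<n. \<alpha> i)" by (rule sum_mono) (use \<alpha> in \<open>simp add: Suc_le_eq\<close>)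
    also have "\<dots> \<le> k * (\<Sum>i<n. \<alpha> i)" using k(1) by simp
    finally show ?thesis by (simp add: N_def wn(1))
  qed
  have wp: "w ! p < n" if "p < N" for p
    using that wn(2) by (metis N_def lessThan_iff nth_mem subsetD)
  have Pb: "P t \<in> sets borel" for t unfolding P_def by (rule part_borel)
  have sum1: "(\<Sum>t<k. fraction (P t) p) = 1" if "p < N" for p
    unfolding P_def by (rule sum_fraction[OF DR that])
  define m where "m i t = (\<Sum>p\<in>{p. p < N \<and> w ! p = i}. fraction (P t) p)" for i t
  have meas: "measure (value_measure (colour_blocks L w i)) (real_part 1 (2 ^ length w) (cs, ls) t) = 2 ^ L * m i t"
    for i t unfolding real_part_eq N_def[symmetric] P_def[symmetric] m_def
    using measure_colour_blocks[OF Pb L] by (simp add: N_def)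
  have m_sum: "(\<Sum>t<k. m i t) = real k * real (\<alpha> i)" if "i < n" for i
  proof -
    have "(\<Sum>t<k. m i t) = (\<Sum>p\<in>{p. p < N \<and> w ! p = i}. \<Sum>t<k. fraction (P t) p)"
      unfolding m_def by (rule sum.swap)
    also have "\<dots> = real (card {p. p < N \<and> w ! p = i})" using sum1 by simp
    finally show ?thesis using cnt[OF that] by simp
  qed
  define \<delta> where "\<delta> = \<epsilon> / 2 ^ L"
  have \<delta>: "0 \<le> \<delta>" "real k * \<delta> < 1" using \<epsilon> by (simp_all add: \<delta>_def divide_less_eq)
  have m_diff: "\<bar>m i t - m i j\<bar> \<le> \<delta>" if "i < n" "t < k" "j < k" for i t j
  proof -
    have "2 ^ L * \<bar>m i t - m i j\<bar> = \<bar>2 ^ L * m i t - 2 ^ L * m i j\<bar>"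
      by (simp add: abs_mult right_diff_distrib[symmetric])
    also have "\<dots> \<le> \<epsilon>" using sol[OF that] unfolding meas .
    finally show ?thesis by (simp add: \<delta>_def field_simps)
  qed
  have m_near: "\<bar>m i t - real (\<alpha> i)\<bar> \<le> \<delta>" if i: "i < n" and t: "t < k" for i t
  proof -
    \<comment> \<open>The average of \<open>m i\<close> over the parts is \<open>\<alpha> i\<close>;
      a value within \<open>\<delta>\<close> of all the others is also within
      \<open>\<delta>\<close> of their average.\<close>
    have "real k * (m i t - real (\<alpha> i)) = (\<Sum>j<k. m i t - m i j)"
      by (simp add: sum_subtractf m_sum[OF i] right_diff_distrib)
    then have "real k * \<bar>m i t - real (\<alpha> i)\<bar> = \<bar>\<Sum>j<k. m i t - m i j\<bar>"
      by (metis abs_mult abs_of_nat)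
    also have "\<dots> \<le> (\<Sum>j<k. \<bar>m i t - m i j\<bar>)" by (rule sum_abs)
    also have "\<dots> \<le> (\<Sum>j<k. \<delta>)" by (rule sum_mono) (use m_diff[OF i t] in simp)
    finally show ?thesis using k(1) by simp
  qed
  \<comment> \<open>\<open>final_beads\<close> reads \<open>k\<close> off the labels, so every part
    must own a piece: its share of colour 0 is at least
    \<open>\<alpha> 0 - \<delta> > 0\<close>.\<close>
  have labels: "set ls = {..<k}"
  proof (intro equalityI v(4) subsetI)
    fix t assume t: "t \<in> {..<k}"
    have 0: "0 < n" using k by simp
    have "\<delta> \<le> real k * \<delta>" using k(1) \<delta>(1) mult_right_mono[of 1 "real k" \<delta>] by simp
    then have "\<delta> < 1" using \<delta>(2) by simp
    moreover have "real (\<alpha> 0) \<ge> 1" using \<alpha>[OF 0] by simp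
    ultimately have "m 0 t \<noteq> 0" using m_near[OF 0, of t] t by auto
    then have "P t \<noteq> {}" by (auto simp: m_def fraction_def)
    then obtain r where "r \<in> P t" by blast
    then show "t \<in> set ls" unfolding P_def part_iff by (metis nth_mem)
  qed
  have S0: "S0 = map (\<lambda>p. (p, options ps p (bits (w ! p)))) [0..<N]"
    by (simp add: S0_def start_beads_bits N_def)
  have set_S0: "b \<in> set S0 \<longleftrightarrow> (\<exists>p<N. b = (p, options ps p (bits (w ! p))))" for b
    by (auto simp: S0)
  have fst_S0: "fst ` set S0 = {..<N}" by (auto simp: S0 image_image)
  have pos_opt: "\<exists>q\<in>set (options ps p (bits (w ! p))). snd (snd q) = bits t"
    if "p < N" "fraction (P t) p > 0" for p t
    unfolding ps_def using that(2) unfolding P_def by (rule fraction_pos_option[OF ls that(1)])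
  \<comment> \<open>Colours and parts are represented by their bits, as in the program;
    \<open>bval\<close> decodes them.\<close>
  interpret fractional_assignment S0 "bits ` {..<n}" "bits ` {..<k}" k "\<lambda>c. \<alpha> (bval c)"
    "\<lambda>p. bits (w ! p)" "\<lambda>p t. fraction (P (bval t)) p" \<delta>
  proof
    show "card (bits ` {..<k}) = k" by (simp add: card_image inj_on_def)
    show "distinct (map fst S0)" by (simp add: S0 comp_def)
    show "snd b \<noteq> []" if b: "b \<in> set S0" for b
    proof -
      obtain p where p: "p < N" "b = (p, options ps p (bits (w ! p)))" using b set_S0 by blast
      have "\<exists>t<k. fraction (P t) p \<noteq> 0"
      proof (rule ccontr)
        assume "\<not> ?thesis"
        then have "(\<Sum>t<k. fraction (P t) p) = 0" by (intro sum.neutral) auto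
        then show False using sum1[OF p(1)] by simp
      qed
      then obtain t where "fraction (P t) p > 0" using fraction_nonneg less_eq_real_def by metis
      then show ?thesis using pos_opt[OF p(1)] p(2) by force
    qed
    show "fst (snd q) = bits (w ! fst b) \<and> snd (snd q) \<in> bits ` {..<k}"
      if b: "b \<in> set S0" and q: "q \<in> set (snd b)" for b q
    proof -
      obtain p where p: "b = (p, options ps p (bits (w ! p)))" using b unfolding set_S0 by auto
      then have "q \<in> set (options (piece_list N cs ls) p (bits (w ! p)))" using q by (simp add: ps_def)
      then obtain j where j: "j < length ls" "q = (j, bits (w ! p), bits (ls ! j))"
        unfolding options_piece_list[OF ls] by auto
      have "ls ! j < k" using v(4) nth_mem[OF j(1)] by auto
      then show ?thesis using p j(2) by simp
    qed
    show "bits (w ! fst b) \<in> bits ` {..<n}" if "b \<in> set S0" for b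
      using that wp by (auto simp: set_S0)
    show "(\<Sum>t\<in>bits ` {..<k}. fraction (P (bval t)) (fst b)) = 1" if "b \<in> set S0" for b
      using that sum1 by (auto simp: set_S0 sum.reindex inj_on_def)
    show "\<exists>q\<in>set (snd b). snd (snd q) = t"
      if "b \<in> set S0" "t \<in> bits ` {..<k}" "0 < fraction (P (bval t)) (fst b)" for b t
      using that pos_opt by (auto simp: set_S0)
    show "(\<Sum>p\<in>{p \<in> fst ` set S0. bits (w ! p) = c}. fraction (P (bval t)) p) \<le> real (\<alpha> (bval c)) + \<delta>"
      if c: "c \<in> bits ` {..<n}" and t: "t \<in> bits ` {..<k}" for c t
    proof -
      obtain i u where iu: "c = bits i" "i < n" "t = bits u" "u < k" using c t by auto
      then have "{p \<in> fst ` set S0. bits (w ! p) = c} = {p. p < N \<and> w ! p = i}"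
        by (auto simp: fst_S0)
      then show ?thesis using m_near[of i u] iu by (simp add: m_def abs_le_iff)
    qed
    show "length (filter (\<lambda>b. bits (w ! fst b) = c) S0) = k * \<alpha> (bval c)" if c: "c \<in> bits ` {..<n}" for c
    proof -
      obtain i where i: "c = bits i" "i < n" using c by auto
      have "length (filter (\<lambda>b. bits (w ! fst b) = c) S0) = length (filter (\<lambda>p. w ! p = i) [0..<N])"
        by (simp add: S0 filter_map comp_def i)
      also have "\<dots> = card {p. p < N \<and> w ! p = i}"
        by (simp add: length_filter_conv_card cong: conj_cong)
      finally show ?thesis using cnt[OF i(2)] i(1) by simp
    qed
  qed (use fraction_nonneg \<delta> in auto)
  have parts: "length (remdups (map (\<lambda>q. snd (snd (snd q))) ps)) = k"
  proof -
    have "map (\<lambda>q. snd (snd (snd q))) ps = map bits ls"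
      unfolding ps_def piece_list_def by (rule nth_equalityI) (simp_all add: ls)
    then show ?thesis by (simp add: remdups_map_bits length_remdups_card_conv labels)
  qed
  let ?m = "Suc N * (Suc N * (Suc N * Suc N))"
  have S: "S = fst ((step k ^^ ?m) (S0, []))"
    unfolding S_def final_beads_def Let_def parts S0_def by (simp add: N_def)
  have "Suc (length S0) * (card (bits ` {..<n}) * k * k) < ?m"
  proof -
    have n: "card (bits ` {..<n}) = n" by (simp add: card_image inj_on_def)
    have "n * k * k \<le> N * N * N" using nN assms(2) by (intro mult_mono) auto
    also have "N * N * N < Suc N * (Suc N * Suc N)" by (simp add: algebra_simps)
    finally have "Suc N * (n * k * k) < ?m" by (rule mult_strict_left_mono) simp
    moreover have "length S0 = N" by (simp add: S0)
    ultimately show ?thesis by (simp only: n)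
  qed
  note final = push_relabel[OF this S]
  have len: "length S = N" using arg_cong[OF same_fst[OF final(1)], of length] by (simp add: S0)
  have Sp: "fst (S ! p) = p" "snd (S ! p) \<noteq> []" "set (snd (S ! p)) = set (options ps p (bits (w ! p)))"
    if p: "p < N" for p
  proof -
    have "fst (S ! p) = fst (S0 ! p) \<and> set (snd (S ! p)) = set (snd (S0 ! p))"
      using final(1) p len by (simp add: same_def list_all2_conv_all_nth)
    then show "fst (S ! p) = p" "set (snd (S ! p)) = set (options ps p (bits (w ! p)))"
      using p by (simp_all add: S0)
    show "snd (S ! p) \<noteq> []" using same_opts(1)[OF final(1), of "S ! p"] p len by simp
  qed
  have chosen: "s p < length ls" "cur (S ! p) = (bits (w ! p), bits (ls ! s p))"
    "(0 # map (lev N) cs) ! s p \<le> p" "p \<le> (map (lev N) cs @ [N]) ! s p" if p: "p < N" for p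
  proof -
    have "hd (snd (S ! p)) \<in> set (options ps p (bits (w ! p)))" using Sp[OF p] by (metis hd_in_set)
    then obtain j where "j < length ls" "hd (snd (S ! p)) = (j, bits (w ! p), bits (ls ! j))"
      "(0 # map (lev N) cs) ! j \<le> p" "p \<le> (map (lev N) cs @ [N]) ! j"
      unfolding ps_def options_piece_list[OF ls] by blast
    then show "s p < length ls" "cur (S ! p) = (bits (w ! p), bits (ls ! s p))"
      "(0 # map (lev N) cs) ! s p \<le> p" "p \<le> (map (lev N) cs @ [N]) ! s p"
      by (simp_all add: s_def cur_def)
  qed
  have mono: "s p \<le> s q" if "p < q" "q < N" for p q
    using piece_order[OF ls v(2) chosen(1)[of q] chosen(4)[of q] chosen(1)[of p] chosen(3)[of p]] that by simp
  \<comment> \<open>The algorithm keeps the beads in their places, so counting entries of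
    \<open>S\<close> is counting positions.\<close>
  have zs': "zs = pos_cuts N c s"
    unfolding zs N_def[symmetric] ps_def[symmetric] S_def[symmetric] new_cuts_def pos_cuts_def
    by (simp add: length_filter_conv_card len s_def v(1))
  show "valid_division 0 (length w) c k (zs, ls)"
    unfolding zs' N_def[symmetric] by (rule valid_pos_cuts) (use v in simp_all)
  fix i t assume i: "i < n" and t: "t < k"
  have "beads w i (part 0 (length w) (zs, ls) t) =
    card {p. p < N \<and> (w ! p = i \<and> ls ! s p = t)}"
    unfolding beads_def zs' N_def[symmetric]
    using part_pos_cuts[of N s c ls] mono chosen(1) v(3)
    by (intro arg_cong[of _ _ card]) (auto simp: less_Suc_eq_le simp del: part.simps)
  also have "\<dots> = load S (bits i, bits t)"
    unfolding load_def length_filter_conv_card len using chosen(2)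
    by (intro arg_cong[of _ _ card]) auto
  also have "\<dots> = \<alpha> i" using final(2)[of "bits i" "bits t"] i t by simp
  finally show "beads w i (part 0 (length w) (zs, ls) t) = \<alpha> i" .
qed


section \<open>Necklace splittings as divisions\<close>

text \<open>Cuts at powers of two fall on ends of beads, so a bead lies entirely inside or outside a
  part.\<close>

lemma fraction_power_cuts:
  assumes "length ls = Suc (length cs)" "p < N"
  shows "fraction (part 1 (2 ^ N) (map of_rat (map ((^) 2) cs), ls) t) p =
    (if p \<in> part 0 N (cs, ls) t then 1 else 0)"
proof -
  let ?I = "{2 ^ p ..< 2 ^ Suc p :: real}"
  let ?P = "part 1 (2 ^ N) (map of_rat (map ((^) 2) cs), ls) t :: real set"
  let ?es = "0 # cs @ [N]"
  have es: "(1 # map of_rat (map ((^) 2) cs) @ [2 ^ N]) ! j = (2 ^ (?es ! j) :: real)"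
    if "j < Suc (length ls)" for j
  proof -
    have "1 # map of_rat (map ((^) 2) cs) @ [2 ^ N] = map ((^) (2::real)) ?es"
      by (simp add: of_rat_power)
    then show ?thesis using that assms(1) by (metis length_Cons length_append_singleton nth_map)
  qed
  have P: "r \<in> ?P \<longleftrightarrow> (\<exists>j<length ls. ls ! j = t \<and> 2 ^ (?es ! j) \<le> r \<and> r < 2 ^ (?es ! Suc j))" for r
  proof -
    have E: "(1 # map of_rat (map ((^) 2) cs) @ [2 ^ N]) ! j = (2 ^ (?es ! j) :: real)"
      "(1 # map of_rat (map ((^) 2) cs) @ [2 ^ N]) ! Suc j = (2 ^ (?es ! Suc j) :: real)"
      if "j < length ls" for j
      by (rule es, use that in simp)+
    show ?thesis unfolding part_iff by (simp only: E cong: conj_cong)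
  qed
  show ?thesis
  proof (cases "p \<in> part 0 N (cs, ls) t")
    case True
    then obtain j where j: "j < length ls" "ls ! j = t" "?es ! j \<le> p" "p < ?es ! Suc j"
      unfolding part_iff by blast
    have "(2::real) ^ (?es ! j) \<le> 2 ^ p" "(2::real) ^ Suc p \<le> 2 ^ (?es ! Suc j)"
      using j by (intro power_increasing; simp)+
    note le = this
    have "?I \<subseteq> ?P"
    proof
      fix r assume "r \<in> ?I"
      then have "2 ^ (?es ! j) \<le> r" "r < 2 ^ (?es ! Suc j)"
        using le unfolding atLeastLessThan_iff by (meson order_trans less_le_trans)+
      then show "r \<in> ?P" unfolding P using j(1,2) by blast
    qed
    then have "?I \<inter> ?P = ?I" by blast
    then have "fraction ?P p = 1" unfolding fraction_def by simp
    then show ?thesis using True by simp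
  next
    case False
    have "?I \<inter> ?P = {}"
    proof (rule ccontr)
      assume "?I \<inter> ?P \<noteq> {}"
      then obtain r j where r: "r \<in> ?I" "j < length ls" "ls ! j = t" "2 ^ (?es ! j) \<le> r" "r < 2 ^ (?es ! Suc j)"
        using P by blast
      have I: "2 ^ p \<le> r" "r < 2 ^ Suc p" using r(1) by auto
      have "?es ! j < Suc p"
        by (rule power_less_imp_less_exp[OF _ le_less_trans[OF r(4) I(2)]]) simp
      moreover have "p < ?es ! Suc j"
        by (rule power_less_imp_less_exp[OF _ le_less_trans[OF I(1) r(5)]]) simp
      ultimately have "?es ! j < Suc p" "p < ?es ! Suc j" by -
      then show False using False r(2,3) unfolding part_iff less_Suc_eq_le by blast
    qed
    then show ?thesis using False by (simp add: fraction_def)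
  qed
qed

lemma power_cuts_measure:
  assumes "length ls = Suc (length cs)" "length w \<le> L"
  shows "measure (value_measure (colour_blocks L w i)) (real_part 1 (2 ^ length w) (map ((^) 2) cs, ls) t) =
    2 ^ L * real (beads w i (part 0 (length w) (cs, ls) t))"
proof -
  let ?A = "{p. p < length w \<and> w ! p = i}"
  have eq: "(\<Sum>p\<in>?A. fraction (part 1 (2 ^ length w) (map of_rat (map ((^) 2) cs), ls) t) p) =
     (\<Sum>p\<in>?A. if p \<in> part 0 (length w) (cs, ls) t then 1 else 0)"
    by (rule sum.cong[OF refl], rule fraction_power_cuts[OF assms(1)]) simp
  have "measure (value_measure (colour_blocks L w i)) (real_part 1 (2 ^ length w) (map ((^) 2) cs, ls) t) =
    2 ^ L * (\<Sum>p\<in>{p. p < length w \<and> w ! p = i}. if p \<in> part 0 (length w) (cs, ls) t then 1 else 0)"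
    unfolding real_part_eq measure_colour_blocks[OF part_borel assms(2)] eq ..
  also have "(\<Sum>p\<in>{p. p < length w \<and> w ! p = i}. if p \<in> part 0 (length w) (cs, ls) t then 1 else 0) =
     real (beads w i (part 0 (length w) (cs, ls) t))"
  proof -
    have "beads w i (part 0 (length w) (cs, ls) t) = card (?A \<inter> part 0 (length w) (cs, ls) t)"
      unfolding beads_def by (rule arg_cong[of _ _ card]) blast
    then show ?thesis by (simp add: sum.If_cases del: part.simps)
  qed
  finally show ?thesis .
qed

lemma power_cuts_valid:
  assumes "valid_division 0 N c k (cs, ls)"
  shows "valid_division (1::rat) (2 ^ N) c k (map ((^) 2) cs, ls)"
proof -
  have "sorted (map ((^) (2::rat)) cs)"
    using assms by (auto simp: sorted_map intro!: sorted_wrt_mono_rel[of cs "(\<le>)"] power_increasing)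
  then show ?thesis using assms by auto
qed

section \<open>The reduction\<close>

lemma poly_bounded_below:
  fixes q :: "real poly"
  assumes pos: "\<And>n::nat. n \<ge> 1 \<Longrightarrow> 0 < poly q (real n)"
  shows "\<exists>c>0. \<forall>n\<ge>1. c \<le> poly q (real n)"
proof -
  have q0: "q \<noteq> 0" using pos[of 1] by auto
  \<comment> \<open>Absolute values treat both signs of the leading coefficient alike; positivity at
    the naturals removes them later. The finitely many arguments below \<open>n0\<close> are covered
    by a minimum.\<close>
  have "\<exists>n0\<ge>1. \<forall>x\<ge>n0. \<bar>lead_coeff q\<bar> \<le> \<bar>poly q x\<bar>"
  proof (cases "lead_coeff q > 0")
    case True
    then obtain n0 where "\<forall>x\<ge>n0. lead_coeff q \<le> poly q x" using poly_pinfty_gt_lc by blast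
    with True show ?thesis by (intro exI[of _ "max n0 1"]) (auto intro: order_trans)
  next
    case False
    then have "lead_coeff (- q) > 0" using q0 by (simp add: less_le)
    then obtain n0 where "\<forall>x\<ge>n0. lead_coeff (- q) \<le> poly (- q) x" using poly_pinfty_gt_lc by blast
    with False show ?thesis by (intro exI[of _ "max n0 1"]) (auto simp: abs_if intro: order_trans)
  qed
  then obtain n0 where n0: "\<forall>x\<ge>n0. \<bar>lead_coeff q\<bar> \<le> \<bar>poly q x\<bar>" by blast
  define A where "A = insert \<bar>lead_coeff q\<bar> ((\<lambda>n. poly q (real n)) ` {1..nat \<lceil>n0\<rceil>})"
  have A: "finite A" "A \<noteq> {}" by (simp_all add: A_def)
  show ?thesis
  proof (intro exI[of _ "Min A"] conjI allI impI)
    show "0 < Min A" using Min_in[OF A] q0 pos by (auto simp: A_def)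
    fix n :: nat assume n: "1 \<le> n"
    show "Min A \<le> poly q (real n)"
    proof (cases "n \<le> nat \<lceil>n0\<rceil>")
      case True
      then show ?thesis using A n by (intro Min_le) (auto simp: A_def)
    next
      case False
      then have "real n \<ge> n0" by linarith
      then have "\<bar>lead_coeff q\<bar> \<le> poly q (real n)" using n0 pos[OF n] by fastforce
      moreover have "Min A \<le> \<bar>lead_coeff q\<bar>" using A by (intro Min_le) (auto simp: A_def)
      ultimately show ?thesis by simp
    qed
  qed
qed

text \<open>One exponent serves all \<open>n \<ge> 1\<close>, so it can be built into the machine,
  which is not given \<open>\<epsilon> n\<close>.\<close>

lemma inverse_polynomial_bounded:
  assumes "inverse_polynomial \<epsilon>"
  shows "\<exists>e. \<forall>n\<ge>1. 0 \<le> \<epsilon> n \<and> \<epsilon> n \<le> 2 ^ e"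
proof -
  obtain p q :: "real poly" where pq: "\<And>n. n \<ge> 1 \<Longrightarrow> 0 < poly p (real n) \<and> 0 < poly q (real n) \<and>
      1 / poly p (real n) \<le> \<epsilon> n \<and> \<epsilon> n \<le> 1 / poly q (real n)"
    using assms unfolding inverse_polynomial_def by blast
  obtain c where c: "c > 0" "\<And>n. n \<ge> 1 \<Longrightarrow> c \<le> poly q (real n)"
    using poly_bounded_below[of q] pq by blast
  obtain e where e: "1 / c < 2 ^ e" using real_arch_pow[of 2 "1 / c"] by auto
  show ?thesis
  proof (intro exI[of _ e] allI impI conjI)
    fix n :: nat assume n: "1 \<le> n"
    have "0 < 1 / poly p (real n)" using pq[OF n] by simp
    then show "0 \<le> \<epsilon> n" using pq[OF n] by linarith
    have "1 / poly q (real n) \<le> 1 / c" using c(1) c(2)[OF n] by (intro divide_left_mono) auto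
    then show "\<epsilon> n \<le> 2 ^ e" using pq[OF n] e by linarith
  qed
qed

lemma length_le_necklace_word: "length w \<le> length (necklace_word k w)"
proof -
  have "length w \<le> length (concat (map enc_nat w))"
    by (induction w) (simp_all add: Defs.enc_nat_def)
  then show ?thesis by (simp add: necklace_word_def enc_pair_def Defs.enc_list_def)
qed

text \<open>The solution map on decoded data; \<open>round_word\<close> is its counterpart on
  words.\<close>

definition round_division :: "nat list \<Rightarrow> rat division \<Rightarrow> nat division" where
  "round_division w D = (new_cuts (length (fst D))
     (final_beads (map bits w) (piece_list (length w) (fst D) (snd D))), snd D)"

lemma round_word_correct:
  assumes "\<And>q. q \<in> set cs \<Longrightarrow> q > 0" "length ls = Suc (length cs)"
  shows "round_word (necklace_word k w, solution_word cs ls) =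
    enc_pair (Defs.enc_list Defs.enc_nat) (Defs.enc_list Defs.enc_nat) (round_division w (cs, ls))"
proof -
  have labels: "map (\<lambda>p. Open # snd (snd (snd p)) @ [Close]) (piece_list N cs ls) =
      map (\<lambda>b. Open # b @ [Close]) (map bits ls)" for N
    unfolding piece_list_def by (rule nth_equalityI) (simp_all add: assms(2) del: upt_Suc)
  have len: "length (piece_list N cs ls) - 1 = length cs" for N
    by (simp add: piece_list_def assms(2))
  have ps: "pieces N (solution_word cs ls) = piece_list N cs ls" for N
    using assms(1) by (rule pieces_solution_word)
  show ?thesis
    unfolding round_word_def Let_def fst_conv snd_conv colours_necklace_word length_map ps len labels
    by (simp add: round_division_def enc_pair_def Defs.enc_list_def Defs.enc_nat_def[abs_def] comp_def)
qed

theorem theorem5: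
  fixes l :: "nat \<Rightarrow> nat" and \<epsilon> :: "nat \<Rightarrow> real"
  assumes "poly_bounded l" and "inverse_polynomial \<epsilon>"
  shows "poly_time_reducible
    (\<lambda>(n, k). neck_split n (l n) k)
    (\<lambda>(n, k). con_division n (l n) (\<epsilon> n) k)"
proof -
  obtain e where e: "\<And>n. n \<ge> 1 \<Longrightarrow> 0 \<le> \<epsilon> n \<and> \<epsilon> n \<le> 2 ^ e"
    using inverse_polynomial_bounded[OF assms(2)] by blast
  define L where "L k w = length (necklace_word k w) + e" for k w
  define f :: "nat \<times> nat \<Rightarrow> nat list \<Rightarrow> rat \<times> rat \<times> blocks list" where
    "f p w = division_instance (L (snd p) w) w" for p w
  define g :: "nat \<times> nat \<Rightarrow> nat list \<Rightarrow> rat division \<Rightarrow> nat division" where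
    "g p w D = round_division w D" for p w D
  let ?A = "\<lambda>(n, k). neck_split n (l n) k" and ?B = "\<lambda>(n, k). con_division n (l n) (\<epsilon> n) k"
  have encA: "enc_instance (?A p) w = necklace_word (snd p) w" for p w
    by (cases p) (simp add: neck_split_def necklace_word_def)
  have encB: "enc_instance (?B p) (f p w) = division_word e (necklace_word (snd p) w)" for p w
    by (cases p) (simp add: con_division_def f_def L_def division_word_correct)
  have solB: "enc_solution (?B p) D = solution_word (fst D) (snd D)" for p D
    by (cases p, cases D) (simp add: con_division_def solution_word_def)
  have solA: "enc_solution (?A p) D = enc_pair (Defs.enc_list Defs.enc_nat) (Defs.enc_list Defs.enc_nat) D" for p D
    by (cases p) (simp add: neck_split_def)
  have sol_valid: "valid_division 1 (2 ^ length w) ((k - 1) * l n) k D"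
    if "is_solution (?B (n, k)) (f (n, k) w) D" for n k w D
    using that by (simp add: con_division_def f_def division_instance_def)
  have time_f: "poly_time_on {(p, x). x \<in> instances (?A p)} (\<lambda>(p, x). [enc_instance (?A p) x])
       (\<lambda>(p, x). enc_instance (?B p) (f p x))"
  proof (rule poly_time_on_single[OF pt_division_word[of e], where u = "\<lambda>(p, x). enc_instance (?A p) x"])
    fix z :: "(nat \<times> nat) \<times> nat list"
    obtain n k w where z: "z = ((n, k), w)" by (metis surj_pair)
    show "(\<lambda>(p, x). enc_instance (?B p) (f p x)) z = division_word e ((\<lambda>(p, x). enc_instance (?A p) x) z)"
      using encB[of "(n, k)" w] encA[of "(n, k)" w] unfolding z by simp
  qed auto
  have time_g: "poly_time_on {(p, x, y). x \<in> instances (?A p) \<and> is_solution (?B p) (f p x) y}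
       (\<lambda>(p, x, y). [enc_instance (?A p) x, enc_solution (?B p) y])
       (\<lambda>(p, x, y). enc_solution (?A p) (g p x y))"
  proof (rule poly_time_on_pair[OF pt_round_word, where u = "\<lambda>(p, x, y). enc_instance (?A p) x"
        and v = "\<lambda>(p, x, y). enc_solution (?B p) y"])
    fix z assume z: "z \<in> {(p, x, y). x \<in> instances (?A p) \<and> is_solution (?B p) (f p x) y}"
    obtain n k w cs ls where zz: "z = ((n, k), w, (cs, ls))" by (metis surj_pair)
    have "valid_division 1 (2 ^ length w) ((k - 1) * l n) k (cs, ls)"
      by (rule sol_valid) (use z zz in simp)
    then have "\<And>q. q \<in> set cs \<Longrightarrow> q > 0" "length ls = Suc (length cs)" by force+
    from round_word_correct[OF this]
    show "(\<lambda>(p, x, y). enc_solution (?A p) (g p x y)) z =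
      round_word ((\<lambda>(p, x, y). enc_instance (?A p) x) z, (\<lambda>(p, x, y). enc_solution (?B p) y) z)"
      unfolding zz prod.case encA[of "(n, k)", unfolded prod.case] solA[of "(n, k)", unfolded prod.case]
        solB[of "(n, k)", unfolded prod.case]
      by (simp add: g_def)
  qed auto
  have correct: "f (n, k) w \<in> instances (?B (n, k)) \<and>
      (\<forall>y. is_solution (?B (n, k)) (f (n, k) w) y \<longrightarrow> is_solution (?A (n, k)) w (g (n, k) w y)) \<and>
      ((\<exists>z. is_solution (?A (n, k)) w z) \<longrightarrow> (\<exists>y. is_solution (?B (n, k)) (f (n, k) w) y))"
    if w: "w \<in> instances (?A (n, k))" for n k w
  proof -
    obtain \<alpha> where nk: "1 \<le> k" "k \<le> n" and \<alpha>: "is_necklace n k \<alpha> w"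
      using w by (auto simp: neck_split_def)
    let ?L = "L k w" and ?N = "length w"
    have pos: "\<And>i. i < n \<Longrightarrow> \<alpha> i > 0" and cnt: "\<And>i. i < n \<Longrightarrow> count_list w i = \<alpha> i * k"
      and sub: "set w \<subseteq> {..<n}"
      using \<alpha> by (auto simp: is_necklace_def)
    \<comment> \<open>A splitting must serve every \<open>\<alpha>\<close> that fits the necklace.
      As \<open>k > 0\<close>, the bead counts determine it on the colours below
      \<open>n\<close>.\<close>
    have unique: "\<beta> i = \<alpha> i" if "is_necklace n k \<beta> w" "i < n" for \<beta> i
      using that cnt[OF that(2)] nk(1) by (auto simp: is_necklace_def)
    have "i \<in> set w" if "i < n" for i
    proof -
      have "count_list w i \<noteq> 0" using pos[OF that] cnt[OF that] nk(1) by simp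
      then show ?thesis by (simp add: count_list_0_iff)
    qed
    with sub have set_w: "set w = {..<n}" by auto
    have len: "length (remdups w) = n" by (simp add: length_remdups_card_conv set_w)
    have nN: "n \<le> ?N" using len length_remdups_leq[of w] by simp
    have NL: "?N \<le> ?L" using length_le_necklace_word[of w k] by (simp add: L_def)
    have agent: "map (colour_blocks ?L w) (remdups w) ! i = colour_blocks ?L w (remdups w ! i)" if "i < n" for i
      using that len by simp
    \<comment> \<open>Agents follow the order of \<open>remdups w\<close>, so the agent of colour
      \<open>i\<close> need not have index \<open>i\<close>.\<close>
    have idx: "\<exists>j<n. remdups w ! j = i" if "i < n" for i
      using that set_w len by (metis in_set_conv_nth lessThan_iff set_remdups)
    have n1: "n \<ge> 1" using nk by simp
    have \<epsilon>: "0 \<le> \<epsilon> n" "real k * \<epsilon> n < 2 ^ ?L"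
    proof -
      show "0 \<le> \<epsilon> n" using e[OF n1] by simp
      \<comment> \<open>In \<open>L\<close>, the length of the input word pays for the factor
        \<open>k\<close> and the summand \<open>e\<close> for \<open>\<epsilon> n\<close>.\<close>
      have "k < 2 ^ ?N" using nk(2) nN less_exp[of ?N] by linarith
      also have "(2::nat) ^ ?N \<le> 2 ^ length (necklace_word k w)"
        using length_le_necklace_word[of w k] by (intro power_increasing) auto
      finally have "real k < real (2 ^ length (necklace_word k w))" by (rule of_nat_less_iff[THEN iffD2])
      then have "real k < 2 ^ length (necklace_word k w)" by simp
      then have "real k * 2 ^ e < 2 ^ length (necklace_word k w) * 2 ^ e" by simp
      moreover have "real k * \<epsilon> n \<le> real k * 2 ^ e" using e[OF n1] by (simp add: mult_left_mono)
      ultimately have "real k * \<epsilon> n < 2 ^ length (necklace_word k w) * 2 ^ e" by linarith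
      then show "real k * \<epsilon> n < 2 ^ ?L" by (simp add: L_def power_add)
    qed
    have inst: "f (n, k) w \<in> instances (?B (n, k))"
    proof -
      have "valid_blocks 1 (2 ^ ?N) (colour_blocks ?L w i)" for i
      proof -
        have "sorted_wrt (<) (filter (\<lambda>p. w ! p = i) [0..<?N])"
          by (rule sorted_wrt_filter) (rule sorted_wrt_upt)
        then have "sorted_wrt (\<lambda>(l, r, h) (l', r', h'). r \<le> l') (colour_blocks ?L w i)"
          unfolding colour_blocks_def sorted_wrt_map
          by (rule sorted_wrt_mono_rel[rotated])
             (auto simp: bead_block_def Suc_le_eq simp del: power_Suc intro!: power_increasing)
        moreover have "(1::rat) \<le> 2 ^ p \<and> (2::rat) ^ p < 2 ^ Suc p \<and> (2::rat) ^ Suc p \<le> 2 ^ ?N" if "p < ?N" for p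
          using that power_increasing[of "Suc p" ?N "2::rat"] by simp
        ultimately show ?thesis by (auto simp: valid_blocks_def colour_blocks_def bead_block_def)
      qed
      moreover have "(1::rat) < 2 ^ ?N" using n1 nN by (intro one_less_power) auto
      ultimately show ?thesis using nk len
        by (auto simp: con_division_def f_def division_instance_def)
    qed
    moreover have "is_solution (?A (n, k)) w (g (n, k) w y)" if y: "is_solution (?B (n, k)) (f (n, k) w) y" for y
    proof -
      obtain cs ls where D: "y = (cs, ls)" by (cases y)
      have valid: "valid_division 1 (2 ^ ?N) ((k - 1) * l n) k (cs, ls)"
        by (rule sol_valid[OF y[unfolded D]])
      have diff: "\<bar>measure (value_measure (colour_blocks ?L w i)) (real_part 1 (2 ^ ?N) (cs, ls) t) -
        measure (value_measure (colour_blocks ?L w i)) (real_part 1 (2 ^ ?N) (cs, ls) j)\<bar> \<le> \<epsilon> n"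
        if i: "i < n" and t: "t < k" and j: "j < k" for i t j
      proof -
        obtain i' where i': "i' < n" "remdups w ! i' = i" using idx[OF i] by blast
        have "\<forall>i<n. \<forall>t<k. \<forall>j<k.
          \<bar>measure (value_measure (map (colour_blocks ?L w) (remdups w) ! i)) (real_part 1 (2 ^ ?N) (cs, ls) t) -
           measure (value_measure (map (colour_blocks ?L w) (remdups w) ! i)) (real_part 1 (2 ^ ?N) (cs, ls) j)\<bar> \<le> \<epsilon> n"
          using y unfolding D by (simp add: con_division_def f_def division_instance_def del: real_part.simps)
        then have "\<bar>measure (value_measure (map (colour_blocks ?L w) (remdups w) ! i')) (real_part 1 (2 ^ ?N) (cs, ls) t) -
           measure (value_measure (map (colour_blocks ?L w) (remdups w) ! i')) (real_part 1 (2 ^ ?N) (cs, ls) j)\<bar> \<le> \<epsilon> n"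
          using i'(1) t j by blast
        then show ?thesis unfolding agent[OF i'(1)] i'(2) .
      qed
      note round = round_correct[OF nk \<alpha> valid NL \<epsilon> diff refl]
      have g: "g (n, k) w y = (new_cuts (length cs) (final_beads (map bits w) (piece_list ?N cs ls)), ls)"
        by (simp add: g_def round_division_def D)
      show ?thesis unfolding g prod.case
        using round unique by (simp add: neck_split_def del: valid_division.simps part.simps)
    qed
    moreover have "\<exists>y. is_solution (?B (n, k)) (f (n, k) w) y" if z: "is_solution (?A (n, k)) w z" for z
    proof -
      obtain cs ls where D: "z = (cs, ls)" by (cases z)
      have valid: "valid_division 0 ?N ((k - 1) * l n) k (cs, ls)"
        and beads: "\<And>i j. i < n \<Longrightarrow> j < k \<Longrightarrow> beads w i (part 0 ?N (cs, ls) j) = \<alpha> i"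
        using z \<alpha> unfolding D by (simp_all add: neck_split_def del: valid_division.simps part.simps)
      have ls: "length ls = Suc (length cs)" using valid by simp
      \<comment> \<open>The parts of a splitting have exactly equal values, so
        \<open>0 \<le> \<epsilon> n\<close> suffices.\<close>
      have "\<bar>measure (value_measure (map (colour_blocks ?L w) (remdups w) ! i)) (real_part 1 (2 ^ ?N) (map ((^) 2) cs, ls) t) -
           measure (value_measure (map (colour_blocks ?L w) (remdups w) ! i)) (real_part 1 (2 ^ ?N) (map ((^) 2) cs, ls) j)\<bar> \<le> \<epsilon> n"
        if i: "i < n" and t: "t < k" and j: "j < k" for i t j
      proof -
        have "remdups w ! i < n" using nth_mem[of i "remdups w"] i len set_w by auto
        then show ?thesis
          unfolding agent[OF i] power_cuts_measure[OF ls NL] using beads t j \<epsilon>(1) by simp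
      qed
      then have "is_solution (?B (n, k)) (f (n, k) w) (map ((^) 2) cs, ls)"
        using power_cuts_valid[OF valid]
        by (simp add: con_division_def f_def division_instance_def del: real_part.simps valid_division.simps)
      then show ?thesis by blast
    qed
    ultimately show ?thesis by blast
  qed
  have "\<forall>p. \<forall>x\<in>instances (?A p). f p x \<in> instances (?B p) \<and>
      (\<forall>y. is_solution (?B p) (f p x) y \<longrightarrow> is_solution (?A p) x (g p x y)) \<and>
      ((\<exists>z. is_solution (?A p) x z) \<longrightarrow> (\<exists>y. is_solution (?B p) (f p x) y))"
  proof (intro allI ballI)
    fix p w assume w: "w \<in> instances (?A p)"
    obtain n k where p: "p = (n, k)" by (cases p)
    show "f p w \<in> instances (?B p) \<and>
      (\<forall>y. is_solution (?B p) (f p w) y \<longrightarrow> is_solution (?A p) w (g p w y)) \<and>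
      ((\<exists>z. is_solution (?A p) w z) \<longrightarrow> (\<exists>y. is_solution (?B p) (f p w) y))"
      using correct[OF w[unfolded p]] unfolding p .
  qed
  then show ?thesis
    unfolding poly_time_reducible_def by (intro exI[of _ f] exI[of _ g] conjI[OF time_f conjI[OF time_g]])
qed

end
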